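(* Let $f(q)=\log q\cdot\log\log q$. Then $$\dim\big(\mathrm{Mad}_P(f)\cap \mathrm{Mad}_L(f)\big)=2,$$ where $\dim$ denotes Hausdorff dimension and $$\mathrm{Mad}_P(f):=\Big\{(\alpha,\beta)\in\mathbb{R}^2:\ \liminf_{q\to\infty} f(q)\cdot q\cdot\|q\alpha\|\cdot\|q\beta\|>0\Big\},$$ $$\mathrm{Mad}_L(f):=\Big\{(\alpha,\beta)\in\mathbb{R}^2:\ \liminf_{|AB|\to\infty} f(|A|^*|B|^* )\cdot|A|^*|B|^*\cdot\|A\alpha-B\beta\|>0\Big\},$$ the second $\liminf$ being taken over pairs of integers $(A,B)\in\mathbb{Z}^2$ with $|AB|\to\infty$.
   Context: $\|x\|$ denotes the distance from the real number $x$ to the nearest integer, and $|x|^*:=\max\{|x|,1\}$. $q$ ranges over positive integers. *)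

theory Defs
  imports "HOL-Analysis.Analysis"
begin

definition dist_nearest_int :: "real \<Rightarrow> real" where
  "dist_nearest_int x = infdist x \<int>"

definition abs_star :: "real \<Rightarrow> real" where
  "abs_star x = max \<bar>x\<bar> 1"

(* The case s = 0 is separate because 0 powr 0 = 0 in HOL, whereas the usual convention is
   diam(U)^0 = 1 for nonempty U (so that the 0-dimensional measure is counting measure). *)
definition diam_pow :: "real \<Rightarrow> 'a::metric_space set \<Rightarrow> ennreal" where
  "diam_pow s U =
     (if U = {} then 0 else if s = 0 then 1 else ennreal (diameter U powr s))"

(* Boundedness is explicit because diameter has no meaningful value on unbounded sets. *)
definition hausdorff_pre_measure :: "real \<Rightarrow> real \<Rightarrow> 'a::metric_space set \<Rightarrow> ennreal" where
  "hausdorff_pre_measure s \<delta> E =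
     (INF U \<in> {U :: nat \<Rightarrow> 'a set.
          E \<subseteq> (\<Union>i. U i) \<and> (\<forall>i. bounded (U i) \<and> diameter (U i) \<le> \<delta>)}.
        \<Sum>i. diam_pow s (U i))"

definition hausdorff_measure :: "real \<Rightarrow> 'a::metric_space set \<Rightarrow> ennreal" where
  "hausdorff_measure s E = (SUP \<delta> \<in> {0<..}. hausdorff_pre_measure s \<delta> E)"

definition hausdorff_dim :: "'a::metric_space set \<Rightarrow> ereal" where
  "hausdorff_dim E = (INF s \<in> {s. 0 \<le> s \<and> hausdorff_measure s E = 0}. ereal s)"

definition Mad_P :: "(real \<Rightarrow> real) \<Rightarrow> (real \<times> real) set" where
  "Mad_P f = {(\<alpha>, \<beta>).
     Liminf sequentially
       (\<lambda>q::nat. ereal (f (real q) * real q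
          * dist_nearest_int (real q * \<alpha>) * dist_nearest_int (real q * \<beta>))) > 0}"

(* The filter is generated by the sets of integer pairs with |A * B| \<ge> N. *)
definition Mad_L :: "(real \<Rightarrow> real) \<Rightarrow> (real \<times> real) set" where
  "Mad_L f = {(\<alpha>, \<beta>).
     Liminf (filtercomap (\<lambda>(A::int, B::int). \<bar>A * B\<bar>) at_top)
       (\<lambda>(A, B). ereal (f (abs_star (of_int A) * abs_star (of_int B))
          * (abs_star (of_int A) * abs_star (of_int B))
          * dist_nearest_int (of_int A * \<alpha> - of_int B * \<beta>))) > 0}"

end

theory Submission
  imports Defs "HOL-Real_Asymp.Real_Asymp"
begin

text \<open>
  A Cantor set of dyadic squares is built, with sides 2 to the minus L(n), whose points avoid
  all rational points and rational lines of approximation quality 2 to the minus e(n), up to the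
  heights visible at scale n. At each scale there are about L(n) dyadic classes of points
  (sizes of q, of q\<alpha> - r and of q\<beta> - p) and of lines (sizes of A, B and of the linear form), times
  the 2 e(n+2) binary scales that a step skips; each class should cover a proportion 2 to the
  minus e(n) of a square, so 2 to the e(n) of order L(n) log L(n) suffices, which is the function f.

  That a class really covers no more than this proportion of a given square is a lattice point
  count in a box of volume V in dimension three. It is O(V) unless the dual lattice
  has a short vector; a short vector dual to a cluster of rational points is a rational line passing very near
  the square, and conversely, and both are excluded because the square has survived so far.
  For this the square must be larger than the removed pieces by a power of 2 to the e(n),
  so the pieces removed at level n + 2 are counted inside a level n square, and a level n + 1 square is
  discarded if too many of its own children are to be removed.
\<close>

section \<open>Lattice points in boxes\<close>

text \<open>The size of 2^e(n) is a self-consistent choice. A step has length about 2 e(n), so e(n)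
  of order log n makes L(n) of order n log n. There are then of order n log n classes at each of
  about 2 log n skipped scales, n (log n)^2 in all, which is the quantity inside
  \<open>expo\<close>. Conversely, denominators of size 2^h are settled at a level with L(n) of
  order h, so n is of order h / log h, and n (log n)^2 is of order h log h. With h in the role of
  log q this is log q log log q.

  Keeping only half of the subsquares in each step costs a factor 2^n in the number 4^L(n) of
  available squares. As L(n) / n tends to infinity, this loss does not lower the dimension.

  No measure is put on the limit set. All surviving squares of a generation receive the same number
  of children, so the proportion of squares that meet a ball plays the part of its mass.\<close>

lemma infnorm_le_iff_3:
  "infnorm (x::real^3) \<le> c \<longleftrightarrow> \<bar>x$1\<bar> \<le> c \<and> \<bar>x$2\<bar> \<le> c \<and> \<bar>x$3\<bar> \<le> c"
proof
  assume "infnorm x \<le> c"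
  then show "\<bar>x$1\<bar> \<le> c \<and> \<bar>x$2\<bar> \<le> c \<and> \<bar>x$3\<bar> \<le> c"
    using component_le_infnorm_cart order_trans by blast
next
  assume a: "\<bar>x$1\<bar> \<le> c \<and> \<bar>x$2\<bar> \<le> c \<and> \<bar>x$3\<bar> \<le> c"
  show "infnorm x \<le> c"
    unfolding infnorm_cart
  proof (rule cSup_least)
    fix y assume "y \<in> {\<bar>x $ i\<bar> |i. i \<in> UNIV}"
    then show "y \<le> c" using a by (auto, metis exhaust_3)
  qed auto
qed

lemma abs_mult_diff_le:
  fixes a b c d :: real
  assumes "\<bar>a\<bar> \<le> m" "\<bar>b\<bar> \<le> n" "\<bar>c\<bar> \<le> m" "\<bar>d\<bar> \<le> n"
  shows "\<bar>a * b - c * d\<bar> \<le> 2 * m * n"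
proof -
  have "\<bar>a * b\<bar> \<le> m * n" "\<bar>c * d\<bar> \<le> m * n"
    using assms by (auto simp: abs_mult intro!: mult_mono)
  then show ?thesis by linarith
qed

lemma infnorm_cross3_le:
  "infnorm (cross3 x y) \<le> 2 * infnorm x * infnorm y"
proof -
  have c: "\<bar>x$i\<bar> \<le> infnorm x" "\<bar>y$i\<bar> \<le> infnorm y" for i
    by (rule component_le_infnorm_cart)+
  show ?thesis
    unfolding infnorm_le_iff_3 cross3_def
    using abs_mult_diff_le[OF c c] by (simp add: vector_def)
qed

lemma abs_inner_le_infnorm_3:
  fixes x y :: "real^3"
  shows "\<bar>x \<bullet> y\<bar> \<le> 3 * infnorm x * infnorm y"
proof -
  have c: "\<bar>x$i * y$i\<bar> \<le> infnorm x * infnorm y" for i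
    unfolding abs_mult by (intro mult_mono component_le_infnorm_cart) (auto simp: infnorm_pos_le)
  show ?thesis
    using c[of 1] c[of 2] c[of 3] by (simp add: inner_vec_def sum_3)
qed

text \<open>Cramer's rule for the basis x, y, w. It yields the coordinates of points in a plane
  parallel to two lattice vectors.\<close>

lemma cross3_expansion:
  fixes x y z :: "real^3"
  defines "w \<equiv> cross3 x y"
  shows "(w \<bullet> w) *\<^sub>R z = (cross3 z y \<bullet> w) *\<^sub>R x + (cross3 x z \<bullet> w) *\<^sub>R y + (z \<bullet> w) *\<^sub>R w"
  unfolding w_def
  by (simp add: cross3_def inner_vec_def sum_3 vec_eq_iff vector_def forall_3) (intro conjI; algebra)

lemma real_card_le_fibers:
  assumes "finite B" "\<And>x. x \<in> A \<Longrightarrow> f x \<in> B"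
    and "\<And>b. b \<in> B \<Longrightarrow> finite {x \<in> A. f x = b} \<and> real (card {x \<in> A. f x = b}) \<le> k"
  shows "real (card A) \<le> real (card B) * k"
proof -
  have "A = (\<Union>b\<in>B. {x \<in> A. f x = b})" using assms(2) by auto
  then have "card A \<le> (\<Sum>b\<in>B. card {x \<in> A. f x = b})"
    using card_UN_le[OF assms(1), of "\<lambda>b. {x \<in> A. f x = b}"] by simp
  then have "real (card A) \<le> (\<Sum>b\<in>B. real (card {x \<in> A. f x = b}))"
    using of_nat_mono by fastforce
  also have "\<dots> \<le> (\<Sum>b\<in>B. k)" by (intro sum_mono) (use assms(3) in auto)
  finally show ?thesis by simp
qed

lemma card_int_atLeastAtMost_le:
  fixes m k :: real
  assumes "\<And>i::int. i \<in> S \<Longrightarrow> m \<le> of_int i \<and> of_int i \<le> m + k" "0 \<le> k"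
  shows "finite S" "real (card S) \<le> k + 1"
proof -
  have sub: "S \<subseteq> {\<lceil>m\<rceil>..\<lfloor>m + k\<rfloor>}" using assms by (auto simp: ceiling_le_iff le_floor_iff)
  then show "finite S" using finite_subset by blast
  have "card S \<le> card {\<lceil>m\<rceil>..\<lfloor>m + k\<rfloor>}" by (rule card_mono) (use sub in auto)
  also have "\<dots> = nat (\<lfloor>m + k\<rfloor> - \<lceil>m\<rceil> + 1)" by simp
  finally have "real (card S) \<le> real (nat (\<lfloor>m + k\<rfloor> - \<lceil>m\<rceil> + 1))" by simp
  also have "\<dots> \<le> k + 1" using assms(2) by linarith
  finally show "real (card S) \<le> k + 1" .
qed

text \<open>
  Let x1, x2 be shortest independent lattice vectors, of lengths l1, l2. The points lie
  on O(V l1 l2) planes parallel to x1 and x2, and in each plane their coordinates with respect to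
  x1, x2 are bounded and separated, leaving O(1 / (l1 l2)) points. The bound 1 < 12 V l1 l2
  supplied by the dual lattice is what absorbs the error when V l1 l2 is small.
\<close>

lemma lattice_count:
  fixes \<Lambda> P :: "(real^3) set" and V :: real
  assumes sub: "\<And>x y. x \<in> \<Lambda> \<Longrightarrow> y \<in> \<Lambda> \<Longrightarrow> x - y \<in> \<Lambda>"
    and det: "\<And>x y z. x \<in> \<Lambda> \<Longrightarrow> y \<in> \<Lambda> \<Longrightarrow> z \<in> \<Lambda> \<Longrightarrow> V * (z \<bullet> cross3 x y) \<in> \<int>"
    and fin: "finite {x \<in> \<Lambda>. infnorm x \<le> 2}"
    and dual: "\<And>x y. x \<in> \<Lambda> \<Longrightarrow> y \<in> \<Lambda> \<Longrightarrow> cross3 x y \<noteq> 0 \<Longrightarrow> 1 < 6 * V * infnorm (cross3 x y)"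
    and V: "0 < V"
    and P: "P \<subseteq> \<Lambda>" "\<And>x. x \<in> P \<Longrightarrow> infnorm x \<le> 1"
    and ne: "u \<in> P" "v \<in> P" "cross3 u v \<noteq> 0"
  shows "real (card P) \<le> 7680 * V"
proof -
  have z: "0 \<in> \<Lambda>" using sub ne(1) P by force
  have add: "x + y \<in> \<Lambda>" if "x \<in> \<Lambda>" "y \<in> \<Lambda>" for x y
    using sub[OF that(1) sub[OF z that(2)]] by simp
  have muln: "real n *\<^sub>R x \<in> \<Lambda>" if "x \<in> \<Lambda>" for n x
    by (induction n) (auto simp: z add that algebra_simps)
  have mul: "of_int n *\<^sub>R x \<in> \<Lambda>" if "x \<in> \<Lambda>" for n x
  proof (cases "n \<ge> 0")
    case True
    then show ?thesis using muln[OF that, of "nat n"] by simp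
  next
    case False
    then show ?thesis using sub[OF z muln[OF that, of "nat (-n)"]] by simp
  qed
  \<comment> \<open>Only a bounded part of \<Lambda> is known to be finite. Vectors outside
    \<open>D\<close> are longer than 2, hence longer than the minima taken over \<open>D\<close>, so
    \<open>min1\<close> and \<open>min2\<close> hold on all of \<Lambda>.\<close>
  define D where "D = {x \<in> \<Lambda>. infnorm x \<le> 2}"
  have finD: "finite D" using fin D_def by simp
  have PD: "x \<in> D" if "x \<in> P" for x using P that unfolding D_def by force
  have "u \<noteq> 0" using ne(3) by auto
  then have "finite (D - {0})" "D - {0} \<noteq> {}" using finD PD[OF ne(1)] by auto
  from ex_min_if_finite[OF finite_imageI[OF this(1)], of infnorm] this(2)
  obtain x1 where x1: "x1 \<in> D" "x1 \<noteq> 0" "\<And>x. x \<in> D - {0} \<Longrightarrow> infnorm x1 \<le> infnorm x"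
    by (metis (no_types, lifting) DiffD1 DiffD2 imageE image_eqI image_is_empty insertI1 leI)
  define l1 where "l1 = infnorm x1"
  have l1: "0 < l1" "l1 \<le> 2" using x1 unfolding l1_def D_def by (auto simp: infnorm_pos_lt)
  have min1: "l1 \<le> infnorm x" if "x \<in> \<Lambda>" "x \<noteq> 0" for x
    using x1(3)[of x] that l1 unfolding D_def l1_def by (cases "infnorm x \<le> 2") auto
  define E where "E = {x \<in> D. cross3 x1 x \<noteq> 0}"
  have "E \<noteq> {}"
  proof
    assume "E = {}"
    then have "cross3 x1 u = 0" "cross3 x1 v = 0" using ne PD unfolding E_def by auto
    then have "cross3 u v = 0" using x1(2)
      by (metis (no_types, lifting) collinear_lemma cross_eq_0 cross_mult_left cross_mult_right cross_refl mult_zero_right scale_zero_right cross_zero_left cross_zero_right)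
    then show False using ne by simp
  qed
  moreover have "finite E" using finD unfolding E_def by auto
  ultimately obtain x2 where x2: "x2 \<in> E" "\<And>x. x \<in> E \<Longrightarrow> infnorm x2 \<le> infnorm x"
    using ex_min_if_finite[of "infnorm ` E"]
    by (metis (no_types, lifting) finite_imageI imageE image_eqI image_is_empty leI)
  define l2 where "l2 = infnorm x2"
  have x1L: "x1 \<in> \<Lambda>" and x2L: "x2 \<in> \<Lambda>" using x1 x2 unfolding E_def D_def by auto
  define w where "w = cross3 x1 x2"
  have w0: "w \<noteq> 0" using x2 unfolding w_def E_def by auto
  have l12: "l1 \<le> l2" unfolding l2_def using min1 x2L w0 unfolding w_def by force
  have l2: "0 < l2" "l2 \<le> 2" using l1 l12 x2 unfolding l2_def E_def D_def by auto
  have min2: "l2 \<le> infnorm x" if "x \<in> \<Lambda>" "cross3 x1 x \<noteq> 0" for x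
    using x2(2)[of x] that l2 unfolding E_def D_def l2_def by (cases "infnorm x \<le> 2") auto
  have comb: "cross3 x1 (s *\<^sub>R x2 + t *\<^sub>R x1) = s *\<^sub>R w" for s t
    unfolding w_def by (simp add: cross_add_right cross_mult_right)
  \<comment> \<open>Rounding t / s to an integer n gives the lattice vector x2 + n x1, which is
    independent of x1 and so has length at least l2; the rounding costs at most l1 / 2 \<le> l2 / 2.
    Thus the norm controls the x2-coordinate even if x1 and x2 are far from orthogonal.\<close>
  have key1: "\<bar>s\<bar> * l2 / 2 \<le> infnorm (s *\<^sub>R x2 + t *\<^sub>R x1)" for s t
  proof (cases "s = 0")
    case True then show ?thesis by (simp add: infnorm_pos_le)
  next
    case False
    define n where "n = round (t / s)"
    have n: "\<bar>t / s - of_int n\<bar> \<le> 1/2"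
      unfolding n_def using of_int_round_abs_le[of "t/s"] by (simp add: abs_minus_commute)
    have "x2 + of_int n *\<^sub>R x1 \<in> \<Lambda>" by (intro add mul x1L x2L)
    moreover have "cross3 x1 (x2 + of_int n *\<^sub>R x1) \<noteq> 0" using comb[of 1 "of_int n"] w0 by simp
    ultimately have "l2 \<le> infnorm (x2 + of_int n *\<^sub>R x1)" using min2 by blast
    also have "x2 + of_int n *\<^sub>R x1 = (x2 + (t/s) *\<^sub>R x1) + (of_int n - t/s) *\<^sub>R x1"
      by (simp add: algebra_simps)
    also have "infnorm \<dots> \<le> infnorm (x2 + (t/s) *\<^sub>R x1) + \<bar>of_int n - t/s\<bar> * l1"
      using infnorm_triangle infnorm_mul l1_def by metis
    also have "\<bar>of_int n - t/s\<bar> * l1 \<le> l2 / 2"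
      using mult_mono[OF n l12] l1 by (simp add: abs_minus_commute)
    finally have "l2 / 2 \<le> infnorm (x2 + (t/s) *\<^sub>R x1)" by simp
    then have "\<bar>s\<bar> * (l2 / 2) \<le> \<bar>s\<bar> * infnorm (x2 + (t/s) *\<^sub>R x1)" by (intro mult_left_mono) auto
    also have "\<dots> = infnorm (s *\<^sub>R x2 + t *\<^sub>R x1)"
      using False by (simp flip: infnorm_mul add: scaleR_right_distrib)
    finally show ?thesis by simp
  qed
  \<comment> \<open>The same rounding, applied to t: a lattice vector with 0 < |s| < 1/2 would turn
    into one independent of x1 and shorter than l2 / 2 + l2 / 2.\<close>
  have key2: "s = 0" if "s *\<^sub>R x2 + t *\<^sub>R x1 \<in> \<Lambda>" "\<bar>s\<bar> < 1/2" for s t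
  proof (rule ccontr)
    assume s: "s \<noteq> 0"
    define n where "n = round t"
    have n: "\<bar>t - of_int n\<bar> \<le> 1/2"
      unfolding n_def using of_int_round_abs_le[of t] by (simp add: abs_minus_commute)
    have eq: "(s *\<^sub>R x2 + t *\<^sub>R x1) - of_int n *\<^sub>R x1 = s *\<^sub>R x2 + (t - of_int n) *\<^sub>R x1"
      by (simp add: algebra_simps)
    have "s *\<^sub>R x2 + (t - of_int n) *\<^sub>R x1 \<in> \<Lambda>" unfolding eq[symmetric] by (intro sub that mul x1L)
    moreover have "cross3 x1 (s *\<^sub>R x2 + (t - of_int n) *\<^sub>R x1) \<noteq> 0" using comb s w0 by simp
    ultimately have "l2 \<le> infnorm (s *\<^sub>R x2 + (t - of_int n) *\<^sub>R x1)" using min2 by blast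
    also have "\<dots> \<le> \<bar>s\<bar> * l2 + \<bar>t - of_int n\<bar> * l1"
      using infnorm_triangle infnorm_mul l1_def l2_def by metis
    also have "\<bar>t - of_int n\<bar> * l1 \<le> l2 / 2"
      using mult_mono[OF n l12] l1 by simp
    also have "\<bar>s\<bar> * l2 < l2 / 2" using that(2) l2 by simp
    finally show False by simp
  qed
  have inl: "infnorm w \<le> 2 * l1 * l2" unfolding w_def l1_def l2_def by (rule infnorm_cross3_le)
  have "1 < 6 * V * infnorm w" using dual[OF x1L x2L] w0 unfolding w_def by blast
  also have "\<dots> \<le> 6 * V * (2 * l1 * l2)" using inl V by (intro mult_left_mono) auto
  finally have big: "1 < 12 * V * l1 * l2" by simp
  \<comment> \<open>By \<open>det\<close> the number under the floor is an integer on \<Lambda>; its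
    values label the planes parallel to x1 and x2.\<close>
  define F where "F y = \<lfloor>V * (y \<bullet> w)\<rfloor>" for y
  have Feq: "of_int (F y) = V * (y \<bullet> w)" if "y \<in> \<Lambda>" for y
    unfolding F_def using det[OF x1L x2L that] unfolding w_def by (metis Ints_cases floor_of_int)
  define B where "B = F ` P"
  have Brange: "- (6 * V * l1 * l2) \<le> of_int i \<and> of_int i \<le> - (6 * V * l1 * l2) + 12 * V * l1 * l2"
    if i: "i \<in> B" for i
  proof -
    obtain y where y: "y \<in> P" "i = F y" using i unfolding B_def by blast
    have "\<bar>y \<bullet> w\<bar> \<le> 3 * infnorm y * infnorm w" by (rule abs_inner_le_infnorm_3)
    also have "\<dots> \<le> 3 * 1 * (2 * l1 * l2)"
      using P(2)[OF y(1)] inl by (intro mult_mono) (auto simp: infnorm_pos_le)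
    finally have "V * \<bar>y \<bullet> w\<bar> \<le> V * (6 * l1 * l2)" using V by (intro mult_left_mono) auto
    then have "\<bar>V * (y \<bullet> w)\<bar> \<le> 6 * V * l1 * l2" using V by (simp add: abs_mult algebra_simps)
    then show ?thesis using Feq y P by auto
  qed
  have B: "finite B" "real (card B) \<le> 12 * V * l1 * l2 + 1"
    using card_int_atLeastAtMost_le[OF Brange] V l1 l2 by auto
  have fiber: "finite {y \<in> P. F y = i} \<and> real (card {y \<in> P. F y = i}) \<le> 320 / (l1 * l2)"
    if "i \<in> B" for i
  proof -
    obtain y0 where y0: "y0 \<in> P" "F y0 = i" using \<open>i \<in> B\<close> unfolding B_def by auto
    define s where "s y = (cross3 x1 (y - y0) \<bullet> w) / (w \<bullet> w)" for y
    define t where "t y = (cross3 (y - y0) x2 \<bullet> w) / (w \<bullet> w)" for y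
    let ?Q = "{y \<in> P. F y = i}"
    have ww: "w \<bullet> w \<noteq> 0" using w0 by simp
    have dec: "y - y0 = s y *\<^sub>R x2 + t y *\<^sub>R x1" if "y \<in> ?Q" for y
    proof -
      have "y \<in> \<Lambda>" "y0 \<in> \<Lambda>" using that y0 P by auto
      then have "V * (y \<bullet> w) = V * (y0 \<bullet> w)" using Feq[of y] Feq[of y0] that y0 by auto
      then have "(y - y0) \<bullet> w = 0" using V by (simp add: inner_diff_left)
      then have "(w \<bullet> w) *\<^sub>R (y - y0) = (cross3 (y - y0) x2 \<bullet> w) *\<^sub>R x1 + (cross3 x1 (y - y0) \<bullet> w) *\<^sub>R x2"
        using cross3_expansion[of x1 x2 "y - y0"] unfolding w_def by simp
      then have "(1 / (w \<bullet> w)) *\<^sub>R (w \<bullet> w) *\<^sub>R (y - y0) = t y *\<^sub>R x1 + s y *\<^sub>R x2"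
        unfolding s_def t_def by (simp add: scaleR_right_distrib)
      then show ?thesis using ww by simp
    qed
    have nrm: "infnorm (y - y0) \<le> 2" if "y \<in> ?Q" for y
      using infnorm_triangle[of y "-y0"] P(2)[of y] P(2)[of y0] y0 that by (simp add: infnorm_neg)
    have sb: "\<bar>s y\<bar> \<le> 4 / l2" if "y \<in> ?Q" for y
      using key1[of "s y" "t y"] nrm[OF that] dec[OF that] l2 by (simp add: field_simps)
    have tb: "\<bar>t y\<bar> \<le> 6 / l1" if "y \<in> ?Q" for y
    proof -
      have "t y *\<^sub>R x1 = (y - y0) - s y *\<^sub>R x2" using dec[OF that] by simp
      then have "\<bar>t y\<bar> * l1 \<le> infnorm (y - y0) + \<bar>s y\<bar> * l2"
        unfolding l1_def l2_def
        using infnorm_triangle[of "y - y0" "- (s y *\<^sub>R x2)"] by (simp add: infnorm_neg infnorm_mul[symmetric])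
      also have "\<dots> \<le> 2 + 4" using nrm[OF that] sb[OF that] l2 by (intro add_mono) (auto simp: field_simps)
      finally show ?thesis using l1 by (simp add: field_simps)
    qed
    \<comment> \<open>The factor 2 makes the floors separate points: equal floors give |s - s'| <
      1/2, so s = s' by \<open>key2\<close>, and equal floors of t then leave a multiple of x1
      shorter than l1, which is 0.\<close>
    define S where "S = (\<lambda>y. \<lfloor>2 * s y\<rfloor>) ` ?Q"
    define T where "T = (\<lambda>y. \<lfloor>t y\<rfloor>) ` ?Q"
    have "- (8 / l2) - 1 \<le> of_int k \<and> of_int k \<le> - (8 / l2) - 1 + (16 / l2 + 1)" if k: "k \<in> S" for k
    proof -
      obtain y where y: "y \<in> ?Q" "k = \<lfloor>2 * s y\<rfloor>" using k unfolding S_def by blast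
      have "\<bar>2 * s y\<bar> \<le> 8 / l2" using sb[OF y(1)] by simp
      then show ?thesis unfolding y(2) by linarith
    qed
    then have S: "finite S" "real (card S) \<le> (16 / l2 + 1) + 1"
      by (rule card_int_atLeastAtMost_le; use l2 in simp)+
    have "- (6 / l1) - 1 \<le> of_int k \<and> of_int k \<le> - (6 / l1) - 1 + (12 / l1 + 1)" if k: "k \<in> T" for k
    proof -
      obtain y where y: "y \<in> ?Q" "k = \<lfloor>t y\<rfloor>" using k unfolding T_def by blast
      show ?thesis using tb[OF y(1)] unfolding y(2) by linarith
    qed
    then have T: "finite T" "real (card T) \<le> (12 / l1 + 1) + 1"
      by (rule card_int_atLeastAtMost_le; use l1 in simp)+
    have inj: "inj_on (\<lambda>y. (\<lfloor>2 * s y\<rfloor>, \<lfloor>t y\<rfloor>)) ?Q"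
    proof (rule inj_onI)
      fix y y' assume y: "y \<in> ?Q" and y': "y' \<in> ?Q" and eq: "(\<lfloor>2 * s y\<rfloor>, \<lfloor>t y\<rfloor>) = (\<lfloor>2 * s y'\<rfloor>, \<lfloor>t y'\<rfloor>)"
      have d: "y - y' = (s y - s y') *\<^sub>R x2 + (t y - t y') *\<^sub>R x1"
      proof -
        have "y - y' = (y - y0) - (y' - y0)" by simp
        then show ?thesis unfolding dec[OF y] dec[OF y'] by (simp add: algebra_simps)
      qed
      have yL: "y - y' \<in> \<Lambda>" using y y' P(1) by (intro sub) auto
      have "\<lfloor>2 * s y\<rfloor> = \<lfloor>2 * s y'\<rfloor>" using eq by simp
      then have "\<bar>s y - s y'\<bar> < 1/2" by linarith
      then have "s y - s y' = 0" using key2 d yL by metis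
      then have d': "y - y' = (t y - t y') *\<^sub>R x1" using d by simp
      have "\<lfloor>t y\<rfloor> = \<lfloor>t y'\<rfloor>" using eq by simp
      then have tt: "\<bar>t y - t y'\<bar> < 1" by linarith
      have "infnorm (y - y') < l1" unfolding d' infnorm_mul l1_def[symmetric] using tt l1 by simp
      then show "y = y'" using min1[OF yL] by auto
    qed
    have sub2: "(\<lambda>y. (\<lfloor>2 * s y\<rfloor>, \<lfloor>t y\<rfloor>)) ` ?Q \<subseteq> Sigma S (\<lambda>_. T)" unfolding S_def T_def by auto
    have finST: "finite (Sigma S (\<lambda>_. T))" using S T by simp
    have c: "card ?Q \<le> card (Sigma S (\<lambda>_. T))" using card_inj_on_le[OF inj sub2 finST] .
    have f: "finite ?Q" using inj_on_finite[OF inj sub2 finST] .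
    have "real (card ?Q) \<le> real (card S) * real (card T)"
      using c unfolding card_cartesian_product of_nat_mult[symmetric] by (rule of_nat_mono)
    \<comment> \<open>Since l1 and l2 are at most 2, the additive 2 in each count is at most 4 / l2,
      respectively 4 / l1.\<close>
    also have "\<dots> \<le> (20 / l2) * (16 / l1)"
      using S T l1 l2 by (intro mult_mono) (auto simp: field_simps intro: order_trans)
    finally show ?thesis using f by (simp add: field_simps)
  qed
  have "real (card P) \<le> real (card B) * (320 / (l1 * l2))"
    by (rule real_card_le_fibers[where f = F]) (use B fiber in \<open>auto simp: B_def\<close>)
  also have "\<dots> \<le> (24 * V * l1 * l2) * (320 / (l1 * l2))"
    using B big l1 l2 by (intro mult_right_mono) auto
  also have "\<dots> = 7680 * V" using l1 l2 by simp
  finally show ?thesis .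
qed

section \<open>Primitive integer triples, and the two dual counts of rational points and rational
  lines\<close>

definition primitive :: "int \<times> int \<times> int \<Rightarrow> bool" where
  "primitive = (\<lambda>(a, b, c). gcd a (gcd b c) = 1)"

text \<open>Multiplying a primitive triple by k gives gcd |k|. Multiplying each triple by an entry
  of the other yields the same triple by proportionality, so corresponding entries agree in absolute
  value; the proportions then force a common sign.\<close>

lemma primitive_parallel:
  fixes a b c a' b' c' :: int
  assumes "primitive (a, b, c)" "primitive (a', b', c')"
    and eq: "a * b' = b * a'" "b * c' = c * b'" "c * a' = a * c'"
  shows "(a', b', c') = (a, b, c) \<or> (a', b', c') = - (a, b, c)"
proof -
  have g: "gcd (k * a) (gcd (k * b) (k * c)) = \<bar>k\<bar>" "gcd (k * a') (gcd (k * b') (k * c')) = \<bar>k\<bar>" for k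
    using assms(1,2) gcd_mult_distrib_int[of k a "gcd b c"] gcd_mult_distrib_int[of k a' "gcd b' c'"]
    unfolding primitive_def by (simp_all add: gcd_mult_left gcd.assoc[symmetric])
  have "\<bar>a\<bar> = \<bar>a'\<bar>" using g(1)[of a'] g(2)[of a] eq by (simp add: mult.commute)
  moreover have "\<bar>b\<bar> = \<bar>b'\<bar>" using g(1)[of b'] g(2)[of b] eq by (simp add: mult.commute)
  moreover have "\<bar>c\<bar> = \<bar>c'\<bar>" using g(1)[of c'] g(2)[of c] eq by (simp add: mult.commute)
  ultimately show ?thesis using eq
    by (auto simp: abs_eq_iff)
qed

lemma exists_primitive_part:
  fixes a b c :: int
  assumes "(a, b, c) \<noteq> 0"
  obtains k a' b' c' where "1 \<le> k" "primitive (a', b', c')" "a = k * a'" "b = k * b'" "c = k * c'"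
proof -
  define k where "k = gcd a (gcd b c)"
  have nz: "k \<noteq> 0" using assms unfolding k_def by (auto simp: zero_prod_def)
  have k1: "1 \<le> k" using nz unfolding k_def by (simp add: int_one_le_iff_zero_less order_less_le)
  have d: "k dvd a" "k dvd b" "k dvd c" unfolding k_def by (auto intro: dvd_trans)
  then obtain a' b' c' where e: "a = k * a'" "b = k * b'" "c = k * c'" by (metis dvdE)
  have "k = gcd (k * a') (gcd (k * b') (k * c'))" using k_def e by simp
  also have "\<dots> = k * gcd a' (gcd b' c')" using k1 by (simp add: gcd_mult_left)
  finally have "gcd a' (gcd b' c') = 1" using nz by simp
  then show thesis using that[of k a' b' c'] k1 e unfolding primitive_def by simp
qed

lemma abs_le_of_int_mult_abs:
  fixes k :: int and x :: real
  assumes "1 \<le> k"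
  shows "\<bar>x\<bar> \<le> \<bar>of_int k * x\<bar>"
proof -
  have "1 * \<bar>x\<bar> \<le> of_int k * \<bar>x\<bar>" using assms by (intro mult_right_mono) auto
  then show ?thesis using assms by (simp add: abs_mult)
qed

text \<open>If S contains two independent directions, \<open>lattice_count\<close> applies.
  Otherwise S lies on one line, where \<open>par\<close> leaves at most s and - s, and 1 \<le> V
  covers these. This degenerate case is the reason for counting primitive triples: multiples of one
  short vector could exceed any bound of order V.\<close>

lemma lattice_points_count:
  fixes g :: "int \<times> int \<times> int \<Rightarrow> real^3" and V :: real
  assumes diff: "\<And>s t. g (s - t) = g s - g t"
    and det: "\<And>s t u. V * (g u \<bullet> cross3 (g s) (g t)) \<in> \<int>"
    and fin: "finite {t. infnorm (g t) \<le> 2}" and inj: "inj g"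
    and dual: "\<And>s t. cross3 (g s) (g t) \<noteq> 0 \<Longrightarrow> 1 < 6 * V * infnorm (cross3 (g s) (g t))"
    and par: "\<And>s t. s \<in> S \<Longrightarrow> t \<in> S \<Longrightarrow> cross3 (g s) (g t) = 0 \<Longrightarrow> t = s \<or> t = - s"
    and S: "\<And>t. t \<in> S \<Longrightarrow> infnorm (g t) \<le> 1" and V: "1 \<le> V"
  shows "finite S \<and> real (card S) \<le> 7680 * V"
proof (rule conjI)
  have sub: "S \<subseteq> {t. infnorm (g t) \<le> 2}" using S by force
  then show finS: "finite S" using fin finite_subset by blast
  show "real (card S) \<le> 7680 * V"
  proof (cases "\<exists>s\<in>S. \<exists>t\<in>S. cross3 (g s) (g t) \<noteq> 0")
    case True
    then obtain s t where st: "s \<in> S" "t \<in> S" "cross3 (g s) (g t) \<noteq> 0" by blast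
    have "{x \<in> range g. infnorm x \<le> 2} = g ` {t. infnorm (g t) \<le> 2}" by auto
    then have fin': "finite {x \<in> range g. infnorm x \<le> 2}" using fin by simp
    have "real (card (g ` S)) \<le> 7680 * V"
    proof (rule lattice_count[where \<Lambda> = "range g" and u = "g s" and v = "g t"])
      show "x - y \<in> range g" if "x \<in> range g" "y \<in> range g" for x y
        using that diff[symmetric] by auto
    qed (use det dual S st V fin' in auto)
    moreover have "card (g ` S) = card S" using inj by (meson card_image inj_on_subset subset_UNIV)
    ultimately show ?thesis by simp
  next
    case False
    show ?thesis
    proof (cases "S = {}")
      case True then show ?thesis using V by simp
    next
      case False': False
      then obtain s where "s \<in> S" by blast
      then have "S \<subseteq> {s, - s}" using par False by blast
      then have "card S \<le> card {s, - s}" by (intro card_mono) auto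
      also have "\<dots> \<le> 2" by (simp add: card_insert_if)
      finally show ?thesis using V by linarith
    qed
  qed
qed

text \<open>The vectors (q, q\<alpha> - r, q\<beta> - p), rescaled to the unit cube, form a lattice
  of covolume 1 / (T1 T2 T3). The cross product of two of them has as entries, up to scaling, the
  data of the rational line (A, B, C) through the two rational points. A short cross product is thus
  a line with small coefficients that passes close to (\<alpha>, \<beta>), which
  \<open>dual0\<close> forbids.\<close>

lemma point_count:
  fixes \<alpha> \<beta> T1 T2 T3 :: real and S :: "(int \<times> int \<times> int) set"
  assumes T: "0 < T1" "0 < T2" "0 < T3" "1 \<le> T1 * T2 * T3"
    and dual0: "\<And>A B C :: int. primitive (A, B, C) \<Longrightarrow> \<bar>real_of_int A\<bar> \<le> 1 / (6 * T2) \<Longrightarrow>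
      \<bar>real_of_int B\<bar> \<le> 1 / (6 * T3) \<Longrightarrow> 1 / (6 * T1) < \<bar>A * \<alpha> - B * \<beta> + real_of_int C\<bar>"
    and prim: "\<And>t. t \<in> S \<Longrightarrow> primitive t"
    and S: "\<And>q r p. (q, r, p) \<in> S \<Longrightarrow> \<bar>real_of_int q\<bar> \<le> T1 \<and> \<bar>q * \<alpha> - r\<bar> \<le> T2 \<and> \<bar>q * \<beta> - p\<bar> \<le> T3"
  shows "finite S \<and> real (card S) \<le> 7680 * (T1 * T2 * T3)"
proof -
  \<comment> \<open>Dividing a triple by its gcd shrinks coefficients and linear form alike, so a
    hypothesis about primitive triples reaches all nonzero ones.\<close>
  have dual: "1 / (6 * T1) < \<bar>A * \<alpha> - B * \<beta> + real_of_int C\<bar>"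
    if nz0: "(A, B, C) \<noteq> 0" and "\<bar>real_of_int A\<bar> \<le> 1 / (6 * T2)" "\<bar>real_of_int B\<bar> \<le> 1 / (6 * T3)" for A B C :: int
  proof -
    obtain k A' B' C' where k: "1 \<le> k" "primitive (A', B', C')" "A = k * A'" "B = k * B'" "C = k * C'"
      using exists_primitive_part[OF nz0] by metis
    have e: "A * \<alpha> - B * \<beta> + real_of_int C = k * (A' * \<alpha> - B' * \<beta> + C')" "real_of_int A = k * real_of_int A'"
      "real_of_int B = k * real_of_int B'"
      unfolding k by (simp_all add: algebra_simps)
    show ?thesis
      using dual0[OF k(2)] that(2,3) abs_le_of_int_mult_abs[OF k(1), of "A' * \<alpha> - B' * \<beta> + C'"]
        abs_le_of_int_mult_abs[OF k(1), of A'] abs_le_of_int_mult_abs[OF k(1), of B'] unfolding e(1) unfolding e(2,3) by linarith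
  qed
  define g :: "int \<times> int \<times> int \<Rightarrow> real^3" where
    "g = (\<lambda>(q, r, p). vector [q / T1, (q * \<alpha> - r) / T2, (q * \<beta> - p) / T3])"
  have gc: "g (q, r, p) $ 1 = q / T1" "g (q, r, p) $ 2 = (q * \<alpha> - r) / T2"
    "g (q, r, p) $ 3 = (q * \<beta> - p) / T3" for q r p
    unfolding g_def by (auto simp: vector_3)
  have cr: "cross3 (g (q, r, p)) (g (q', r', p')) =
    vector [((p*q' - q*p') * \<alpha> - (r*q' - q*r') * \<beta> + (r*p' - p*r')) / (T2 * T3),
      - (p*q' - q*p') / (T1 * T3), (r*q' - q*r') / (T1 * T2)]" for q r p q' r' p'
    using T by (simp add: cross3_def vec_eq_iff forall_3 gc vector_3 field_simps)
  note c3 = vec_eq_iff forall_3 vector_3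
  have crz: "cross3 (g (q, r, p)) (g (q', r', p')) = 0 \<longleftrightarrow> (p*q' - q*p', r*q' - q*r', r*p' - p*r') = 0"
    (is "_ \<longleftrightarrow> (?A, ?B, ?C) = 0") for q r p q' r' p'
  proof -
    have "cross3 (g (q, r, p)) (g (q', r', p')) = 0 \<longleftrightarrow>
      real_of_int ?A * \<alpha> - real_of_int ?B * \<beta> + real_of_int ?C = 0 \<and> real_of_int ?A = 0 \<and> real_of_int ?B = 0"
      unfolding cr using T by (auto simp: c3)
    also have "\<dots> \<longleftrightarrow> (?A, ?B, ?C) = 0"
      unfolding of_int_eq_0_iff zero_prod_def prod.inject by (auto simp del: of_int_diff of_int_mult)
    finally show ?thesis .
  qed
  show ?thesis
  proof (rule lattice_points_count[where g = g])
    show "g (s - t) = g s - g t" for s t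
      by (cases s; cases t) (use T in \<open>simp add: c3 gc field_simps\<close>)
    show "T1 * T2 * T3 * (g u \<bullet> cross3 (g s) (g t)) \<in> \<int>" for s t u
    proof -
      obtain q r p q' r' p' q'' r'' p'' where st: "s = (q, r, p)" "t = (q', r', p')" "u = (q'', r'', p'')"
        by (metis prod_cases3)
      let ?k = "q'' * (r*p' - p*r') + r'' * (p*q' - q*p') - p'' * (r*q' - q*r')"
      have "T1 * T2 * T3 * (g u \<bullet> cross3 (g s) (g t)) = of_int ?k"
        unfolding st cr inner_vec_def sum_3 gc vector_3 using T by (simp add: field_simps)
      then show ?thesis by (metis Ints_of_int)
    qed
    show "inj g"
    proof (rule injI)
      fix s t assume "g s = g t"
      then show "s = t"
        by (cases s; cases t) (use T in \<open>auto simp: c3 gc\<close>)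
    qed
    show "finite {t. infnorm (g t) \<le> 2}"
    proof -
      define k where "k = \<lceil>2 * T1\<rceil>"
      define m where "m = \<lceil>2 * T2 + 2 * T1 * \<bar>\<alpha>\<bar>\<rceil>"
      define n where "n = \<lceil>2 * T3 + 2 * T1 * \<bar>\<beta>\<bar>\<rceil>"
      have "{t. infnorm (g t) \<le> 2} \<subseteq> {-k..k} \<times> {-m..m} \<times> {-n..n}"
      proof clarsimp
        fix q r p assume "infnorm (g (q, r, p)) \<le> 2"
        then have h: "\<bar>real_of_int q\<bar> \<le> 2 * T1" "\<bar>q * \<alpha> - r\<bar> \<le> 2 * T2" "\<bar>q * \<beta> - p\<bar> \<le> 2 * T3"
          unfolding infnorm_le_iff_3 gc using T by (auto simp: field_simps)
        have "\<bar>q * \<alpha>\<bar> \<le> 2 * T1 * \<bar>\<alpha>\<bar>" "\<bar>q * \<beta>\<bar> \<le> 2 * T1 * \<bar>\<beta>\<bar>"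
          unfolding abs_mult using h(1) by (auto intro: mult_right_mono)
        then have "\<bar>real_of_int r\<bar> \<le> 2 * T2 + 2 * T1 * \<bar>\<alpha>\<bar>" "\<bar>real_of_int p\<bar> \<le> 2 * T3 + 2 * T1 * \<bar>\<beta>\<bar>"
          using h(2,3) by linarith+
        with h(1) show "- k \<le> q \<and> q \<le> k \<and> - m \<le> r \<and> r \<le> m \<and> - n \<le> p \<and> p \<le> n"
          unfolding k_def m_def n_def by linarith
      qed
      then show ?thesis using finite_subset by fastforce
    qed
    show "1 < 6 * (T1 * T2 * T3) * infnorm (cross3 (g s) (g t))" if nz: "cross3 (g s) (g t) \<noteq> 0" for s t
    proof (rule ccontr)
      assume "\<not> ?thesis"
      then have le: "infnorm (cross3 (g s) (g t)) \<le> 1 / (6 * (T1 * T2 * T3))"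
        using T by (simp add: field_simps)
      obtain q r p q' r' p' where st: "s = (q, r, p)" "t = (q', r', p')"
        by (metis prod_cases3)
      have nz': "(p*q' - q*p', r*q' - q*r', r*p' - p*r') \<noteq> 0" (is "(?A, ?B, ?C) \<noteq> 0")
        using nz crz unfolding st by blast
      have "\<bar>real_of_int ?A\<bar> \<le> 1 / (6 * T2) \<and> \<bar>real_of_int ?B\<bar> \<le> 1 / (6 * T3) \<and>
        \<bar>real_of_int ?A * \<alpha> - real_of_int ?B * \<beta> + real_of_int ?C\<bar> \<le> 1 / (6 * T1)"
        using le T unfolding st cr infnorm_le_iff_3 vector_3 by (simp add: field_simps abs_minus_commute)
      then show False using dual[OF nz'] by linarith
    qed
    show "t = s \<or> t = - s" if st: "s \<in> S" "t \<in> S" "cross3 (g s) (g t) = 0" for s t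
    proof -
      obtain q r p q' r' p' where eq: "s = (q, r, p)" "t = (q', r', p')"
        by (metis prod_cases3)
      have "primitive (q, r, p)" "primitive (q', r', p')" using st prim eq by auto
      moreover have "q * r' = r * q'" "r * p' = p * r'" "p * q' = q * p'"
        using st(3) crz unfolding eq by (auto simp: zero_prod_def)
      ultimately show ?thesis unfolding eq by (rule primitive_parallel)
    qed
    show "infnorm (g t) \<le> 1" if "t \<in> S" for t
    proof -
      obtain q r p where eq: "t = (q, r, p)" by (metis prod_cases3)
      show ?thesis using S[of q r p] that T unfolding eq infnorm_le_iff_3 gc by (simp add: field_simps)
    qed
  qed (rule T(4))
qed

text \<open>Points and lines change places: the cross product of two lines is their intersection (r
  / q, p / q) in homogeneous coordinates, possibly at infinity. A short one is a rational point of
  small height close to (\<alpha>, \<beta>).\<close>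

lemma line_count:
  fixes \<alpha> \<beta> T1 T2 T3 :: real and S :: "(int \<times> int \<times> int) set"
  assumes T: "0 < T1" "0 < T2" "0 < T3" "1 \<le> T1 * T2 * T3"
    and dual0: "\<And>q r p :: int. primitive (q, r, p) \<Longrightarrow> \<bar>q * \<alpha> - real_of_int r\<bar> \<le> 1 / (6 * T1) \<Longrightarrow> \<bar>q * \<beta> - p\<bar> \<le> 1 / (6 * T2)
      \<Longrightarrow> 1 / (6 * T3) < \<bar>real_of_int q\<bar>"
    and prim: "\<And>t. t \<in> S \<Longrightarrow> primitive t"
    and S: "\<And>A B C. (A, B, C) \<in> S \<Longrightarrow> \<bar>real_of_int A\<bar> \<le> T1 \<and> \<bar>real_of_int B\<bar> \<le> T2 \<and> \<bar>A * \<alpha> - B * \<beta> + C\<bar> \<le> T3"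
  shows "finite S \<and> real (card S) \<le> 7680 * (T1 * T2 * T3)"
proof -
  have dual: "1 / (6 * T3) < \<bar>real_of_int q\<bar>"
    if nz0: "(q, r, p) \<noteq> 0" and "\<bar>q * \<alpha> - real_of_int r\<bar> \<le> 1 / (6 * T1)" "\<bar>q * \<beta> - p\<bar> \<le> 1 / (6 * T2)" for q r p :: int
  proof -
    obtain k q' r' p' where k: "1 \<le> k" "primitive (q', r', p')" "q = k * q'" "r = k * r'" "p = k * p'"
      using exists_primitive_part[OF nz0] by metis
    have e: "q * \<alpha> - real_of_int r = k * (q' * \<alpha> - r')" "q * \<beta> - p = k * (q' * \<beta> - p')" "real_of_int q = k * real_of_int q'"
      unfolding k by (simp_all add: algebra_simps)
    show ?thesis
      using dual0[OF k(2)] that(2,3) abs_le_of_int_mult_abs[OF k(1), of "q' * \<alpha> - r'"]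
        abs_le_of_int_mult_abs[OF k(1), of "q' * \<beta> - p'"] abs_le_of_int_mult_abs[OF k(1), of q'] unfolding e(1,2) unfolding e(3) by linarith
  qed
  define g :: "int \<times> int \<times> int \<Rightarrow> real^3" where
    "g = (\<lambda>(A, B, C). vector [A / T1, B / T2, (A * \<alpha> - B * \<beta> + C) / T3])"
  have gc: "g (A, B, C) $ 1 = A / T1" "g (A, B, C) $ 2 = B / T2"
    "g (A, B, C) $ 3 = (A * \<alpha> - B * \<beta> + C) / T3" for A B C
    unfolding g_def by (auto simp: vector_3)
  have cr: "cross3 (g (A, B, C)) (g (A', B', C')) =
    vector [- ((A*B' - B*A') * \<alpha> - (B*C' - C*B')) / (T2 * T3),
      ((A*B' - B*A') * \<beta> - (A*C' - C*A')) / (T1 * T3), (A*B' - B*A') / (T1 * T2)]" for A B C A' B' C'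
    using T by (simp add: cross3_def vec_eq_iff forall_3 gc vector_3 field_simps)
  note c3 = vec_eq_iff forall_3 vector_3
  have crz: "cross3 (g (A, B, C)) (g (A', B', C')) = 0 \<longleftrightarrow> (A*B' - B*A', B*C' - C*B', A*C' - C*A') = 0"
    (is "_ \<longleftrightarrow> (?q, ?r, ?p) = 0") for A B C A' B' C'
  proof -
    have "cross3 (g (A, B, C)) (g (A', B', C')) = 0 \<longleftrightarrow>
      real_of_int ?q * \<alpha> - real_of_int ?r = 0 \<and> real_of_int ?q * \<beta> - real_of_int ?p = 0 \<and> real_of_int ?q = 0"
      unfolding cr using T by (auto simp: c3)
    also have "\<dots> \<longleftrightarrow> (?q, ?r, ?p) = 0"
      unfolding of_int_eq_0_iff zero_prod_def prod.inject by (auto simp del: of_int_diff of_int_mult)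
    finally show ?thesis .
  qed
  show ?thesis
  proof (rule lattice_points_count[where g = g])
    show "g (s - t) = g s - g t" for s t
      by (cases s; cases t) (use T in \<open>simp add: c3 gc field_simps\<close>)
    show "T1 * T2 * T3 * (g u \<bullet> cross3 (g s) (g t)) \<in> \<int>" for s t u
    proof -
      obtain A B C A' B' C' A'' B'' C'' where st: "s = (A, B, C)" "t = (A', B', C')" "u = (A'', B'', C'')"
        by (metis prod_cases3)
      let ?k = "A'' * (B*C' - C*B') - B'' * (A*C' - C*A') + C'' * (A*B' - B*A')"
      have "T1 * T2 * T3 * (g u \<bullet> cross3 (g s) (g t)) = of_int ?k"
        unfolding st cr inner_vec_def sum_3 gc vector_3 using T by (simp add: field_simps)
      then show ?thesis by (metis Ints_of_int)
    qed
    show "inj g"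
    proof (rule injI)
      fix s t assume "g s = g t"
      then show "s = t"
        by (cases s; cases t) (use T in \<open>auto simp: c3 gc\<close>)
    qed
    show "finite {t. infnorm (g t) \<le> 2}"
    proof -
      define k where "k = \<lceil>2 * T1\<rceil>"
      define m where "m = \<lceil>2 * T2\<rceil>"
      define n where "n = \<lceil>2 * T3 + 2 * T1 * \<bar>\<alpha>\<bar> + 2 * T2 * \<bar>\<beta>\<bar>\<rceil>"
      have "{t. infnorm (g t) \<le> 2} \<subseteq> {-k..k} \<times> {-m..m} \<times> {-n..n}"
      proof clarsimp
        fix A B C assume "infnorm (g (A, B, C)) \<le> 2"
        then have h: "\<bar>real_of_int A\<bar> \<le> 2 * T1" "\<bar>real_of_int B\<bar> \<le> 2 * T2" "\<bar>A * \<alpha> - B * \<beta> + C\<bar> \<le> 2 * T3"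
          unfolding infnorm_le_iff_3 gc using T by (auto simp: field_simps)
        have "\<bar>A * \<alpha>\<bar> \<le> 2 * T1 * \<bar>\<alpha>\<bar>" "\<bar>B * \<beta>\<bar> \<le> 2 * T2 * \<bar>\<beta>\<bar>"
          unfolding abs_mult using h(1,2) by (auto intro: mult_right_mono)
        then have "\<bar>real_of_int C\<bar> \<le> 2 * T3 + 2 * T1 * \<bar>\<alpha>\<bar> + 2 * T2 * \<bar>\<beta>\<bar>"
          using h(3) by linarith+
        with h(1,2) show "- k \<le> A \<and> A \<le> k \<and> - m \<le> B \<and> B \<le> m \<and> - n \<le> C \<and> C \<le> n"
          unfolding k_def m_def n_def by linarith
      qed
      then show ?thesis using finite_subset by fastforce
    qed
    show "1 < 6 * (T1 * T2 * T3) * infnorm (cross3 (g s) (g t))" if nz: "cross3 (g s) (g t) \<noteq> 0" for s t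
    proof (rule ccontr)
      assume "\<not> ?thesis"
      then have le: "infnorm (cross3 (g s) (g t)) \<le> 1 / (6 * (T1 * T2 * T3))"
        using T by (simp add: field_simps)
      obtain A B C A' B' C' where st: "s = (A, B, C)" "t = (A', B', C')"
        by (metis prod_cases3)
      have nz': "(A*B' - B*A', B*C' - C*B', A*C' - C*A') \<noteq> 0" (is "(?q, ?r, ?p) \<noteq> 0")
        using nz crz unfolding st by blast
      have "\<bar>real_of_int ?q * \<alpha> - real_of_int ?r\<bar> \<le> 1 / (6 * T1) \<and>
        \<bar>real_of_int ?q * \<beta> - real_of_int ?p\<bar> \<le> 1 / (6 * T2) \<and> \<bar>real_of_int ?q\<bar> \<le> 1 / (6 * T3)"
        using le T unfolding st cr infnorm_le_iff_3 vector_3 by (simp add: field_simps abs_minus_commute)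
      then show False using dual[OF nz'] by linarith
    qed
    show "t = s \<or> t = - s" if st: "s \<in> S" "t \<in> S" "cross3 (g s) (g t) = 0" for s t
    proof -
      obtain A B C A' B' C' where eq: "s = (A, B, C)" "t = (A', B', C')"
        by (metis prod_cases3)
      have "primitive (A, B, C)" "primitive (A', B', C')" using st prim eq by auto
      moreover have "A * B' = B * A'" "B * C' = C * B'" "C * A' = A * C'"
        using st(3) crz unfolding eq by (auto simp: zero_prod_def)
      ultimately show ?thesis unfolding eq by (rule primitive_parallel)
    qed
    show "infnorm (g t) \<le> 1" if "t \<in> S" for t
    proof -
      obtain A B C where eq: "t = (A, B, C)" by (metis prod_cases3)
      show ?thesis using S[of A B C] that T unfolding eq infnorm_le_iff_3 gc by (simp add: field_simps)
    qed
  qed (rule T(4))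
qed

section \<open>Rational points and lines near a dyadic square\<close>

definition dyadic_square :: "nat \<Rightarrow> int \<times> int \<Rightarrow> (real \<times> real) set" where
  "dyadic_square K = (\<lambda>(i, j). {of_int i / 2^K .. (of_int i + 1) / 2^K} \<times> {of_int j / 2^K .. (of_int j + 1) / 2^K})"

text \<open>Squares are handled through their integer indices: floor division by 2^m gives the index
  of the ancestor m scales up. Descendants of distinct squares are then disjoint as index sets,
  although the closed squares share edges.\<close>

definition subsquares :: "nat \<Rightarrow> int \<times> int \<Rightarrow> (int \<times> int) set" where
  "subsquares m = (\<lambda>(i, j). {k. k div 2^m = i} \<times> {k. k div 2^m = j})"

definition near_point :: "nat \<Rightarrow> nat \<Rightarrow> nat \<Rightarrow> real \<times> real \<Rightarrow> bool" where
  "near_point a b d = (\<lambda>(\<alpha>, \<beta>). \<exists>q r p :: int. primitive (q, r, p) \<and> 2^a \<le> q \<and> q < 2^(a+1) \<and>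
     \<bar>of_int q * \<alpha> - of_int r\<bar> \<le> 1 / 2^b \<and> \<bar>of_int q * \<beta> - of_int p\<bar> \<le> 1 / 2^d)"

text \<open>
  One of A, B may vanish here (it then has size class 0): although such pairs are irrelevant for
  the limit inferior in \<^const>\<open>Mad_L\<close>, the duality argument produces them.
\<close>

definition near_line :: "nat \<Rightarrow> nat \<Rightarrow> nat \<Rightarrow> real \<times> real \<Rightarrow> bool" where
  "near_line a b g = (\<lambda>(\<alpha>, \<beta>). \<exists>A B C :: int. primitive (A, B, C) \<and> \<bar>A\<bar> \<le> 2^(a+1) \<and> \<bar>B\<bar> \<le> 2^(b+1) \<and>
     2^max a b \<le> max \<bar>A\<bar> \<bar>B\<bar> \<and>
     \<bar>of_int A * \<alpha> - of_int B * \<beta> + of_int C\<bar> \<le> 1 / 2^g)"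

text \<open>A rational point of class (a, b, d) owns a rectangle with half-sides about 2^-(a+b) and
  2^-(a+d), a line a strip of half-width about 2^-(g + max a b). The bounds by K admit the pieces
  whose thickness is at least about 2^-K, those visible at that scale. The bounds involving E say
  that q |q\<alpha> - r| |q\<beta> - p|, or 2^(a+b) times the linear form, is of order at most 2^-E.
  Exponents b and d start at 1 because the distance to the nearest integer is at most 1/2.\<close>

definition clean :: "nat \<Rightarrow> nat \<Rightarrow> real \<times> real \<Rightarrow> bool" where
  "clean E K x \<longleftrightarrow>
     (\<forall>a b d. 1 \<le> b \<longrightarrow> 1 \<le> d \<longrightarrow> a + E \<le> b + d + 1 \<longrightarrow> a + max b d \<le> K \<longrightarrow> \<not> near_point a b d x) \<and>
     (\<forall>a b g. a + b + E \<le> g \<longrightarrow> g + max a b \<le> K \<longrightarrow> \<not> near_line a b g x)"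

lemma exists_dyadic_size:
  fixes A :: int
  obtains a :: nat where "\<bar>A\<bar> < 2^(a+1)" "2^a \<le> \<bar>A\<bar> \<or> a = 0"
proof (cases "A = 0")
  case True
  then show thesis using that[of 0] by simp
next
  case False
  then have "1 \<le> nat \<bar>A\<bar>" by simp
  then obtain n where n: "2^n \<le> nat \<bar>A\<bar>" "nat \<bar>A\<bar> < 2^(n+1)"
    using ex_power_ivl1[of 2 "nat \<bar>A\<bar>"] by auto
  have "2^n \<le> \<bar>A\<bar>" "\<bar>A\<bar> < 2^(n+1)"
    using n by (simp_all add: nat_less_iff le_nat_iff)
  then show thesis using that by blast
qed

lemma pow2_mult_le_imp:
  fixes k :: real
  assumes "k * 2^x \<le> 2^y" "2^c \<le> k"
  shows "x + c \<le> y"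
proof -
  have "(2::real)^(x + c) \<le> 2^y"
    using order_trans[OF mult_right_mono[OF assms(2), of "2^x"] assms(1)] by (simp add: power_add mult.commute)
  then show ?thesis by simp
qed

lemma div_eq_interval: "{k::int. k div 2^m = i} = {i * 2^m..<i * 2^m + 2^m}"
proof (rule set_eqI)
  fix k :: int
  have "k div 2^m = i \<longleftrightarrow> 0 \<le> k - i * 2^m \<and> k - i * 2^m < 2^m"
  proof
    assume "k div 2^m = i"
    moreover have "k - (k div 2^m) * 2^m = k mod 2^m" by (simp add: minus_div_mult_eq_mod)
    ultimately show "0 \<le> k - i * 2^m \<and> k - i * 2^m < 2^m" by simp
  next
    assume a: "0 \<le> k - i * 2^m \<and> k - i * 2^m < 2^m"
    have "(k - i * 2^m + i * 2^m) div 2^m = (k - i * 2^m) div 2^m + i" by (subst div_mult_self1) auto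
    then show "k div 2^m = i" using a by (simp add: div_pos_pos_trivial)
  qed
  then show "k \<in> {k. k div 2^m = i} \<longleftrightarrow> k \<in> {i * 2^m..<i * 2^m + 2^m}" by auto
qed

lemma card_div_eq: "card {k::int. k div 2^m = i} = 2^m" "finite {k::int. k div 2^m = i}"
  unfolding div_eq_interval by (simp_all add: nat_power_eq)

lemma card_near_dyadic_le:
  fixes c X :: real
  assumes "0 \<le> X"
    and S: "\<And>i. i \<in> S \<Longrightarrow> \<exists>x. of_int i / 2^K \<le> x \<and> x \<le> (of_int i + 1) / 2^K \<and> \<bar>x - c\<bar> \<le> X"
  shows "finite S" "real (card S) \<le> 2 * X * 2^K + 2"
proof -
  have r: "(c - X) * 2^K - 1 \<le> of_int i \<and> of_int i \<le> (c - X) * 2^K - 1 + (2 * X * 2^K + 1)" if i: "i \<in> S" for i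
  proof -
    obtain x where x: "of_int i / 2^K \<le> x" "x \<le> (of_int i + 1) / 2^K" "\<bar>x - c\<bar> \<le> X" using S[OF i] by blast
    have "of_int i \<le> x * 2^K" "x * 2^K \<le> of_int i + 1" using x by (simp_all add: field_simps)
    moreover have "(c - X) * 2^K \<le> x * 2^K" "x * 2^K \<le> (c + X) * 2^K"
      using x(3) by (intro mult_right_mono; simp)+
    ultimately show ?thesis by (simp add: algebra_simps)
  qed
  show "finite S" "real (card S) \<le> 2 * X * 2^K + 2"
    using card_int_atLeastAtMost_le[of S, OF r] assms(1) by auto
qed

lemma dyadic_subset_real:
  fixes k i :: int and x :: real
  assumes "k div 2^m = i" "of_int k / 2^(K+m) \<le> x" "x \<le> (of_int k + 1) / 2^(K+m)"
  shows "of_int i / 2^K \<le> x" "x \<le> (of_int i + 1) / 2^K"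
proof -
  have "k \<in> {i * 2^m..<i * 2^m + 2^m}" using assms(1) div_eq_interval[of m i] by blast
  then have k: "i * 2^m \<le> k" "k + 1 \<le> (i + 1) * 2^m"
    by (auto simp: algebra_simps)
  have "real_of_int (i * 2^m) \<le> of_int k" "real_of_int (k + 1) \<le> of_int ((i + 1) * 2^m)"
    using k unfolding of_int_le_iff by auto
  then have k': "real_of_int i * 2^m \<le> k" "real_of_int k + 1 \<le> (real_of_int i + 1) * 2^m"
    by simp_all
  have "of_int i / 2^K = of_int i * 2^m / (2^(K+m)::real)" "(of_int i + 1) / 2^K = (of_int i + 1) * 2^m / (2^(K+m)::real)"
    by (simp_all add: power_add)
  then have "of_int i / 2^K \<le> of_int k / (2^(K+m)::real)" "(real_of_int k + 1) / 2^(K+m) \<le> (of_int i + 1) / 2^K"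
    using k' by (simp_all add: divide_right_mono)
  then show "of_int i / 2^K \<le> x" "x \<le> (of_int i + 1) / 2^K" using assms(2,3) by linarith+
qed

lemma subsquares_subset:
  assumes "x \<in> subsquares m y"
  shows "dyadic_square (K + m) x \<subseteq> dyadic_square K y"
  using assms dyadic_subset_real[where m = m and K = K]
  unfolding dyadic_square_def subsquares_def by (auto split: prod.splits)

lemma card_subsquares: "card (subsquares m y) = 4^m" "finite (subsquares m y)"
  unfolding subsquares_def
  by (auto simp: card_cartesian_product card_div_eq power_mult_distrib[symmetric] split: prod.splits)

lemma clean_antimono: "clean E K x \<Longrightarrow> E \<le> E' \<Longrightarrow> clean E' K x"
  unfolding clean_def by (meson add_le_mono le_refl order_trans)

text \<open>The weight is a side of the box used in the lattice count, so that it cancels when the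
  number of rationals is multiplied by the number of squares near each. Its first term is paired
  with the trivial bound 2^m for the descendants, its second with the length of the neighbourhood of
  r / q; hence 9 = 1 + 8.\<close>

lemma card_dyadic_near_rational_le:
  fixes q r i0 :: int and a b K m :: nat
  assumes q: "2^a \<le> q" and ab: "a + b \<le> K + m"
  defines "I \<equiv> {i. i div 2^m = i0 \<and>
    (\<exists>x::real. of_int i / 2^(K+m) \<le> x \<and> x \<le> (of_int i + 1) / 2^(K+m) \<and> \<bar>of_int q * x - of_int r\<bar> \<le> 1 / 2^b)}"
  shows "finite I" "(1 / 2^b + 2^(a+1) / 2^K) * real (card I) \<le> 9 * 2^m / 2^b"
proof -
  have q': "2^a \<le> real_of_int q" using q by (metis of_int_le_iff of_int_numeral of_int_power)
  have q0: "0 < real_of_int q" using q' by (smt (verit) zero_less_power)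
  have "\<exists>x::real. of_int i / 2^(K+m) \<le> x \<and> x \<le> (of_int i + 1) / 2^(K+m) \<and> \<bar>x - of_int r / of_int q\<bar> \<le> 1 / 2^(a+b)"
    if i: "i \<in> I" for i
  proof -
    obtain x :: real where x: "of_int i / 2^(K+m) \<le> x" "x \<le> (of_int i + 1) / 2^(K+m)" "\<bar>of_int q * x - of_int r\<bar> \<le> 1 / 2^b"
      using i unfolding I_def by blast
    have "2^a * \<bar>x - of_int r / of_int q\<bar> \<le> of_int q * \<bar>x - of_int r / of_int q\<bar>"
      using q' by (intro mult_right_mono) auto
    also have "\<dots> = \<bar>of_int q * x - of_int r\<bar>"
      using q0 abs_mult[of "of_int q" "x - of_int r / of_int q"] by (simp add: right_diff_distrib)
    finally have "2^a * \<bar>x - of_int r / of_int q\<bar> \<le> 1 / 2^b" using x(3) by simp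
    then have "\<bar>x - of_int r / of_int q\<bar> \<le> 1 / 2^(a+b)" by (simp add: power_add field_simps)
    then show ?thesis using x by blast
  qed
  from card_near_dyadic_le[OF _ this]
  have fin: "finite I" and c1: "real (card I) \<le> 2 * (1 / 2^(a+b)) * 2^(K+m) + 2" by auto
  show "finite I" by fact
  have "(2::real)^(a+b) \<le> 2^(K+m)" using ab by (intro power_increasing) auto
  then have "1 \<le> (1 / 2^(a+b)) * (2::real)^(K+m)" by (simp add: field_simps)
  then have c1: "real (card I) \<le> 4 * (1 / 2^(a+b)) * 2^(K+m)" using c1 by linarith
  have "card I \<le> card {k::int. k div 2^m = i0}"
    by (rule card_mono[OF card_div_eq(2)]) (auto simp: I_def)
  then have c2: "real (card I) \<le> 2^m" using card_div_eq(1)[of m i0] of_nat_mono by fastforce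
  have "1 / 2^b * real (card I) \<le> 1 / 2^b * 2^m" using c2 by (intro mult_left_mono) auto
  moreover have "2^(a+1) / 2^K * real (card I) \<le> 2^(a+1) / 2^K * (4 * (1 / 2^(a+b)) * 2^(K+m))"
    using c1 by (intro mult_left_mono) auto
  moreover have "2^(a+1) / 2^K * (4 * (1 / 2^(a+b)) * 2^(K+m)) = 8 * 2^m / (2^b::real)"
    by (simp add: power_add field_simps)
  ultimately show "(1 / 2^b + 2^(a+1) / 2^K) * real (card I) \<le> 9 * 2^m / 2^b"
    by (simp add: distrib_right)
qed

lemma abs_affine_shift:
  fixes q x x0 r l :: real
  assumes "\<bar>q * x - r\<bar> \<le> u" "\<bar>q\<bar> \<le> Q" "\<bar>x - x0\<bar> \<le> l"
  shows "\<bar>q * x0 - r\<bar> \<le> u + Q * l"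
proof -
  have "\<bar>q * (x - x0)\<bar> \<le> Q * l" unfolding abs_mult using assms by (intro mult_mono) auto
  moreover have "q * x0 - r = (q * x - r) - q * (x - x0)" by (simp add: right_diff_distrib)
  ultimately show ?thesis using assms(1) by linarith
qed

text \<open>
  K' is the level in between; K' \<ge> K + 2E makes a dual line found at scale K one of
  those already excluded by cleanness. At the root, K = 0, no short dual vector exists at all.
\<close>

lemma card_near_point_subsquares_le:
  fixes a b d E K K' m :: nat and y :: "int \<times> int"
  assumes cl: "\<And>x. x \<in> dyadic_square K y \<Longrightarrow> clean E K x"
    and bd: "1 \<le> b" "1 \<le> d" "b + d + 1 = a + E"
    and M: "K' < a + max b d" "a + max b d \<le> K + m"
    and K: "K \<le> K'" "K = 0 \<or> K + 2 * E \<le> K'"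
  shows "real (card {z \<in> subsquares m y. \<exists>x \<in> dyadic_square (K + m) z. near_point a b d x}) \<le> 2488320 * 4^m / 2^E"
proof -
  obtain i0 j0 where y: "y = (i0, j0)" by fastforce
  define \<alpha> where "\<alpha> = real_of_int i0 / 2^K"
  define \<beta> where "\<beta> = real_of_int j0 / 2^K"
  have base: "(\<alpha>, \<beta>) \<in> dyadic_square K y"
    unfolding dyadic_square_def y \<alpha>_def \<beta>_def by (simp add: divide_right_mono)
  \<comment> \<open>Sides of a box that holds all relevant triples as seen from the corner
    (\<alpha>, \<beta>): moving a point across the square changes q x by at most 2^(a+1) /
    2^K.\<close>
  define T1 :: real where "T1 = 2^(a+1)"
  define T2 :: real where "T2 = 1 / 2^b + 2^(a+1) / 2^K"
  define T3 :: real where "T3 = 1 / 2^d + 2^(a+1) / 2^K"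
  have T: "0 < T1" "0 < T2" "0 < T3" unfolding T1_def T2_def T3_def by (auto intro!: add_pos_pos)
  have T23: "1 / 2^b \<le> T2" "2^(a+1) / 2^K \<le> T2" "1 / 2^d \<le> T3" "2^(a+1) / 2^K \<le> T3"
    unfolding T2_def T3_def by auto
  \<comment> \<open>For b \<le> d and K > 0, invisibility at K' means a + d > K + 2E, and
    eliminating d through b + d + 1 = a + E leaves this inequality. One E of the gap is used up
    here; the remaining one pays for the quality of the dual line in \<open>g1\<close>.\<close>
  have arith: "K = 0 \<or> (b \<le> d \<and> K + E + b + 2 \<le> 2 * a) \<or> (d \<le> b \<and> K + E + d + 2 \<le> 2 * a)"
    using M(1) bd(3) K by (auto simp: max_def split: if_splits)
  have V: "1 \<le> T1 * T2 * T3"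
  proof -
    have half: "1 \<le> T1 * (1 / 2^c * (2^(a+1) / 2^K))" if "K + E + c + 2 \<le> 2 * a" for c
    proof -
      have "(2::real)^(c + K) \<le> 2^((a+1) + (a+1))" using that by (intro power_increasing) auto
      then show ?thesis unfolding T1_def by (simp add: power_add field_simps)
    qed
    consider "K = 0" | "K + E + b + 2 \<le> 2 * a" | "K + E + d + 2 \<le> 2 * a" using arith by blast
    then show ?thesis
    proof cases
      case 1
      have "1 \<le> T1" unfolding T1_def by (rule one_le_power) simp
      moreover have "1 \<le> T2" "1 \<le> T3" using T23 1 one_le_power[of "2::real" "a+1"] by auto
      ultimately show ?thesis by (smt (verit, best) mult_le_cancel_left1 mult_le_cancel_right1)
    next
      case 2
      have "T1 * (1 / 2^b * (2^(a+1) / 2^K)) \<le> T1 * (T2 * T3)"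
        using T T23 by (intro mult_left_mono mult_mono) auto
      then show ?thesis unfolding mult.assoc using half[OF 2] by (rule order_trans[rotated])
    next
      case 3
      have "T1 * (1 / 2^d * (2^(a+1) / 2^K)) \<le> T1 * (T3 * T2)"
        using T T23 by (intro mult_left_mono mult_mono) auto
      then show ?thesis unfolding mult.assoc mult.commute[of T2 T3] using half[OF 3] by (rule order_trans[rotated])
    qed
  qed
  define S where "S = {(q, r, p). primitive (q, r, p) \<and> 2^a \<le> q \<and> q < 2^(a+1) \<and>
    (\<exists>x x'. (x, x') \<in> dyadic_square K y \<and> \<bar>of_int q * x - of_int r\<bar> \<le> 1 / 2^b \<and> \<bar>of_int q * x' - of_int p\<bar> \<le> 1 / 2^d)}"
  have cS: "finite S \<and> real (card S) \<le> 7680 * (T1 * T2 * T3)"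
  proof (rule point_count[OF T V, where \<alpha> = \<alpha> and \<beta> = \<beta>])
    fix A B C :: int
    assume prim: "primitive (A, B, C)" and A: "\<bar>real_of_int A\<bar> \<le> 1 / (6 * T2)" and B: "\<bar>real_of_int B\<bar> \<le> 1 / (6 * T3)"
    show "1 / (6 * T1) < \<bar>of_int A * \<alpha> - of_int B * \<beta> + of_int C\<bar>"
    proof (rule ccontr)
      assume "\<not> ?thesis"
      then have le: "\<bar>of_int A * \<alpha> - of_int B * \<beta> + of_int C\<bar> \<le> 1 / (6 * T1)" by simp
      have T1': "1 / (6 * T1) \<le> 1 / 2^(a+3)" unfolding T1_def by (simp add: field_simps power_add)
      have nz: "A \<noteq> 0 \<or> B \<noteq> 0"
      proof (rule ccontr)
        assume "\<not> ?thesis"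
        then have "\<bar>real_of_int C\<bar> \<le> 1 / 2^(a+3)" using le T1' by simp
        also have "\<dots> < 1" by (simp add: power_less_one_iff one_less_power)
        finally have "C = 0" by linarith
        then show False using prim \<open>\<not> (A \<noteq> 0 \<or> B \<noteq> 0)\<close> unfolding primitive_def by simp
      qed
      obtain a' where a': "\<bar>A\<bar> < 2^(a'+1)" "2^a' \<le> \<bar>A\<bar> \<or> a' = 0" by (rule exists_dyadic_size)
      obtain b' where b': "\<bar>B\<bar> < 2^(b'+1)" "2^b' \<le> \<bar>B\<bar> \<or> b' = 0" by (rule exists_dyadic_size)
      \<comment> \<open>T dominates both 2^-c and 2^(a+1) / 2^K. The first gives the bound that
        enters the quality of the dual line, the second its visibility at scale K.\<close>
      have size: "n + 1 \<le> c \<and> a + n + 3 \<le> K"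
        if N: "\<bar>real_of_int N\<bar> \<le> 1 / (6 * T)" and Tc: "1 / 2^c \<le> T" "2^(a+1) / 2^K \<le> T" and n: "2^n \<le> \<bar>N\<bar>"
        for N :: int and T :: real and n c :: nat
      proof -
        have n': "2^n \<le> \<bar>real_of_int N\<bar>" using n by (metis of_int_abs of_int_le_iff of_int_numeral of_int_power)
        have "0 < T" using Tc(1) by (smt (verit) zero_less_divide_1_iff zero_less_power)
        then have m1: "6 * T * 2^n \<le> 1" using N n' by (simp add: field_simps) (smt (verit) mult_left_mono)
        have "6 * (1 / 2^c) * 2^n \<le> 6 * T * (2^n::real)" using Tc by (intro mult_right_mono) auto
        then have "6 * (1 / 2^c) * (2^n::real) \<le> 1" using m1 by linarith
        then have "6 * 2^n \<le> (2::real)^c" by (simp add: field_simps)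
        then have c1: "n + 2 \<le> c" by (rule pow2_mult_le_imp) simp
        have "6 * (2^(a+1) / 2^K) * 2^n \<le> 6 * T * (2^n::real)" using Tc by (intro mult_right_mono) auto
        then have "6 * (2^(a+1) / 2^K) * (2^n::real) \<le> 1" using m1 by linarith
        then have "12 * 2^(a + n) \<le> (2::real)^K" by (simp add: field_simps power_add)
        then have "a + n + 3 \<le> K" by (rule pow2_mult_le_imp) simp
        then show ?thesis using c1 by simp
      qed
      \<comment> \<open>One coefficient is nonzero, so K \<ge> 3. This rules out the root, and
        together with 1 \<le> b and 1 \<le> d it covers a coefficient 0, which was given size class
        0.\<close>
      have K3: "a + 3 \<le> K"
        using nz size[OF A T23(1,2), of 0] size[OF B T23(3,4), of 0] by fastforce
      have sa: "a' + 1 \<le> b \<and> a + a' + 3 \<le> K" using a'(2) size[OF A T23(1,2), of a'] K3 bd by auto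
      have sb: "b' + 1 \<le> d \<and> a + b' + 3 \<le> K" using b'(2) size[OF B T23(3,4), of b'] K3 bd by auto
      have g1: "a' + b' + E \<le> a + 3" using sa sb arith by auto
      have g2: "(a + 3) + max a' b' \<le> K" using sa sb by auto
      have "2^max a' b' \<le> max \<bar>A\<bar> \<bar>B\<bar>"
      proof (cases "max a' b' = 0")
        case True then show ?thesis using nz by (auto simp: max_def)
      next
        case False then show ?thesis using a'(2) b'(2) by (auto simp: max_def)
      qed
      then have "near_line a' b' (a + 3) (\<alpha>, \<beta>)"
        unfolding near_line_def prod.case using prim a'(1) b'(1) le T1'
        by (intro exI[of _ A] exI[of _ B] exI[of _ C]) auto
      then show False using cl[OF base] g1 g2 unfolding clean_def by blast
    qed
  next
    fix q r p assume "(q, r, p) \<in> S"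
    then obtain x x' where h: "2^a \<le> q" "q < 2^(a+1)" "(x, x') \<in> dyadic_square K y"
      "\<bar>of_int q * x - of_int r\<bar> \<le> 1 / 2^b" "\<bar>of_int q * x' - of_int p\<bar> \<le> 1 / 2^d" unfolding S_def by auto
    have "real_of_int q \<le> 2^(a+1)"
      using h(2) by (metis less_imp_le of_int_le_iff of_int_numeral of_int_power)
    moreover have "0 \<le> q" using h(1) by (smt (verit) zero_less_power)
    ultimately have q: "\<bar>real_of_int q\<bar> \<le> 2^(a+1)" by simp
    have d: "\<bar>x - \<alpha>\<bar> \<le> 1 / 2^K" "\<bar>x' - \<beta>\<bar> \<le> 1 / 2^K"
      using h(3) unfolding dyadic_square_def y \<alpha>_def \<beta>_def by (auto simp: add_divide_distrib)
    show "\<bar>real_of_int q\<bar> \<le> T1 \<and> \<bar>of_int q * \<alpha> - of_int r\<bar> \<le> T2 \<and> \<bar>of_int q * \<beta> - of_int p\<bar> \<le> T3"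
      using q abs_affine_shift[OF h(4) q d(1)] abs_affine_shift[OF h(5) q d(2)] unfolding T1_def T2_def T3_def by simp
  qed (auto simp: S_def)
  define G where "G = (\<lambda>(q, r, p). {z \<in> subsquares m y. \<exists>x x'. (x, x') \<in> dyadic_square (K + m) z \<and>
    \<bar>of_int q * x - of_int r\<bar> \<le> 1 / 2^b \<and> \<bar>of_int q * x' - real_of_int p\<bar> \<le> 1 / 2^d})"
  have G: "real (card (G t)) \<le> (9 * 2^m / 2^b / T2) * (9 * 2^m / 2^d / T3)" if t: "t \<in> S" for t
  proof -
    obtain q r p where t': "t = (q, r, p)" using prod_cases3 by blast
    have q: "2^a \<le> q" using t unfolding t' S_def by auto
    define I where "I c k i0 = {i. i div 2^m = i0 \<and>
      (\<exists>x. of_int i / 2^(K+m) \<le> x \<and> x \<le> (of_int i + 1) / 2^(K+m) \<and> \<bar>of_int q * x - real_of_int k\<bar> \<le> 1 / 2^c)}" for c k i0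
    have ab: "a + b \<le> K + m" "a + d \<le> K + m" using M(2) by auto
    note I1 = card_dyadic_near_rational_le[OF q ab(1), of i0 r, folded I_def]
    note I2 = card_dyadic_near_rational_le[OF q ab(2), of j0 p, folded I_def]
    have "G t \<subseteq> Sigma (I b r i0) (\<lambda>_. I d p j0)"
      unfolding G_def t' I_def subsquares_def dyadic_square_def y by fastforce
    then have "card (G t) \<le> card (Sigma (I b r i0) (\<lambda>_. I d p j0))" using I1 I2 by (intro card_mono) auto
    then have "real (card (G t)) \<le> real (card (I b r i0)) * real (card (I d p j0))"
      unfolding card_cartesian_product of_nat_mult[symmetric] by (rule of_nat_mono)
    also have "\<dots> \<le> (9 * 2^m / 2^b / T2) * (9 * 2^m / 2^d / T3)"
      using I1(2) I2(2) T unfolding T2_def[symmetric] T3_def[symmetric]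
      by (intro mult_mono) (simp_all add: pos_le_divide_eq mult_ac)
    finally show ?thesis .
  qed
  let ?Z = "{z \<in> subsquares m y. \<exists>x \<in> dyadic_square (K + m) z. near_point a b d x}"
  have "?Z \<subseteq> (\<Union>t\<in>S. G t)"
  proof
    fix z assume z: "z \<in> ?Z"
    then obtain x x' q r p where h: "(x, x') \<in> dyadic_square (K + m) z" "primitive (q, r, p)"
      "2^a \<le> q" "q < 2^(a+1)" "\<bar>of_int q * x - real_of_int r\<bar> \<le> 1 / 2^b" "\<bar>of_int q * x' - real_of_int p\<bar> \<le> 1 / 2^d"
      unfolding near_point_def by auto
    have "(x, x') \<in> dyadic_square K y" using subsquares_subset[of z m y K] z h(1) by auto
    then have "(q, r, p) \<in> S" unfolding S_def using h by auto
    moreover have "z \<in> G (q, r, p)" unfolding G_def using h z by auto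
    ultimately show "z \<in> (\<Union>t\<in>S. G t)" by blast
  qed
  moreover have "finite (\<Union>t\<in>S. G t)"
    using finite_subset[OF _ card_subsquares(2)[of m y]] unfolding G_def by (auto simp: cS)
  ultimately have "card ?Z \<le> card (\<Union>t\<in>S. G t)" by (intro card_mono)
  also have "\<dots> \<le> (\<Sum>t\<in>S. card (G t))" using card_UN_le cS by blast
  finally have "real (card ?Z) \<le> (\<Sum>t\<in>S. real (card (G t)))" using of_nat_mono by fastforce
  also have "\<dots> \<le> (\<Sum>t\<in>S. (9 * 2^m / 2^b / T2) * (9 * 2^m / 2^d / T3))" by (intro sum_mono G)
  also have "\<dots> = real (card S) * ((9 * 2^m / 2^b / T2) * (9 * 2^m / 2^d / T3))" by simp
  \<comment> \<open>T2 and T3 cancel, leaving 7680 * 81 T1 / 2^(b+d), and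
    \<open>b + d + 1 = a + E\<close> turns T1 / 2^(b+d) into 4 / 2^E.\<close>
  also have "\<dots> \<le> 7680 * (T1 * T2 * T3) * ((9 * 2^m / 2^b / T2) * (9 * 2^m / 2^d / T3))"
    using cS T by (intro mult_right_mono) auto
  also have "\<dots> = 622080 * T1 * (2^m * 2^m) / 2^(b+d)"
    using T by (simp add: field_simps power_add)
  also have "\<dots> = 622080 * (2^m * 2^m) * (T1 / 2^(b+d))" by simp
  also have "T1 / 2^(b+d) = 4 / 2^E"
  proof -
    have "(2::real)^(b+d) * 2 = 2^a * 2^E" using bd(3) by (metis power_add power_one_right)
    then show ?thesis unfolding T1_def by (simp add: field_simps)
  qed
  also have "622080 * (2^m * 2^m) * (4 / 2^E) = 2488320 * 4^m / (2^E::real)"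
    by (simp flip: power_mult_distrib)
  finally show ?thesis .
qed

text \<open>In each column of squares the inequality is solved for x', whose coefficient is the
  larger one. The strip has half-height at most 2^-(g+n), and as its slope is at most 1, letting x
  run through the column adds only one side length.\<close>

lemma card_dyadic_strip_le:
  fixes A B C i0 j0 :: int and K g m n :: nat
  assumes B: "2^n \<le> \<bar>B\<bar>" "\<bar>A\<bar> \<le> \<bar>B\<bar>" and gn: "g + n \<le> K + m"
  defines "G \<equiv> {(i, j). i div 2^m = i0 \<and> j div 2^m = j0 \<and>
    (\<exists>x x'::real. of_int i / 2^(K+m) \<le> x \<and> x \<le> (of_int i + 1) / 2^(K+m) \<and>
      of_int j / 2^(K+m) \<le> x' \<and> x' \<le> (of_int j + 1) / 2^(K+m) \<and> \<bar>of_int A * x + of_int B * x' + of_int C\<bar> \<le> 1 / 2^g)}"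
  shows "real (card G) \<le> 6 * 2^m * 2^(K+m) / 2^(g+n)"
proof -
  let ?I = "{i::int. i div 2^m = i0}"
  define J where "J i = {j. (i, j) \<in> G}" for i
  have B': "2^n \<le> \<bar>real_of_int B\<bar>" using B(1) by (metis of_int_abs of_int_le_iff of_int_numeral of_int_power)
  have B0: "0 < \<bar>real_of_int B\<bar>" using B' by (smt (verit) zero_less_power)
  have J: "finite (J i) \<and> real (card (J i)) \<le> 6 * 2^(K+m) / 2^(g+n)" for i
  proof -
    let ?X = "1 / 2^(g+n) + 1 / 2^(K+m) :: real"
    let ?c = "- ((of_int A * (of_int i / 2^(K+m)) + of_int C) / of_int B) :: real"
    have "\<exists>x'::real. of_int j / 2^(K+m) \<le> x' \<and> x' \<le> (of_int j + 1) / 2^(K+m) \<and> \<bar>x' - ?c\<bar> \<le> ?X" if j: "j \<in> J i" for j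
    proof -
      obtain x x' :: real where x: "of_int i / 2^(K+m) \<le> x" "x \<le> (of_int i + 1) / 2^(K+m)"
        "of_int j / 2^(K+m) \<le> x'" "x' \<le> (of_int j + 1) / 2^(K+m)"
        "\<bar>of_int A * x + of_int B * x' + of_int C\<bar> \<le> 1 / 2^g"
        using j unfolding J_def G_def by auto
      have "\<bar>x - of_int i / 2^(K+m)\<bar> \<le> 1 / 2^(K+m)" using x(1,2) by (simp add: add_divide_distrib)
      then have "\<bar>of_int A * (x - of_int i / 2^(K+m))\<bar> \<le> \<bar>real_of_int B\<bar> * (1 / 2^(K+m))"
        unfolding abs_mult using B(2) by (intro mult_mono) (auto simp flip: of_int_abs)
      moreover have "1 / 2^g \<le> \<bar>real_of_int B\<bar> * (1 / 2^(g+n))"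
        using mult_right_mono[OF B', of "1 / 2^(g+n)"] by (simp add: power_add)
      moreover have "of_int A * (of_int i / 2^(K+m)) + of_int B * x' + of_int C =
        (of_int A * x + of_int B * x' + of_int C) - of_int A * (x - of_int i / 2^(K+m))"
        by (simp add: right_diff_distrib)
      ultimately have "\<bar>of_int A * (of_int i / 2^(K+m)) + of_int B * x' + of_int C\<bar> \<le> \<bar>real_of_int B\<bar> * ?X"
        using x(5) unfolding distrib_left by linarith
      moreover have "of_int A * (of_int i / 2^(K+m)) + of_int B * x' + of_int C = of_int B * (x' - ?c)"
        using B0 by (simp add: field_simps)
      ultimately have "\<bar>real_of_int B\<bar> * \<bar>x' - ?c\<bar> \<le> \<bar>real_of_int B\<bar> * ?X" by (simp add: abs_mult)
      then have "\<bar>x' - ?c\<bar> \<le> ?X" using B0 by (simp only: mult_le_cancel_left_pos)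
      then show ?thesis using x by blast
    qed
    from card_near_dyadic_le[where S = "J i", OF _ this]
    have "finite (J i) \<and> real (card (J i)) \<le> 2 * ?X * 2^(K+m) + 2" by auto
    moreover have "(2::real)^(g+n) \<le> 2^(K+m)" using gn by (intro power_increasing) auto
    then have "1 \<le> (2::real)^(K+m) / 2^(g+n)" by (simp add: field_simps)
    moreover have "2 * ?X * 2^(K+m) = 2 * (2^(K+m) / 2^(g+n)) + 2" by (simp add: field_simps)
    ultimately show ?thesis by linarith
  qed
  have GS: "G \<subseteq> Sigma ?I J" unfolding J_def G_def by auto
  have "card G \<le> card (Sigma ?I J)" using GS J card_div_eq(2) by (intro card_mono finite_SigmaI) auto
  also have "\<dots> = (\<Sum>i\<in>?I. card (J i))" using J card_div_eq(2) by (intro card_SigmaI) auto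
  finally have "real (card G) \<le> (\<Sum>i\<in>?I. real (card (J i)))" using of_nat_mono by fastforce
  also have "\<dots> \<le> (\<Sum>i\<in>?I. 6 * 2^(K+m) / 2^(g+n))" using J by (intro sum_mono) auto
  also have "\<dots> = 6 * 2^m * 2^(K+m) / 2^(g+n)" using card_div_eq(1)[of m i0] by simp
  finally show ?thesis .
qed

text \<open>Mirror image of the count for points: a short dual vector is now a rational point of
  class (c, a + 3, b + 3). Its visibility follows from |q| \<le> 2^K / (30 * 2^n), and its quality
  from this together with \<open>arith\<close>, where the gap 2E enters. Cleanness at scale K
  excludes it.\<close>

lemma card_near_line_subsquares_le:
  fixes a b g E K K' m :: nat and y :: "int \<times> int"
  assumes cl: "\<And>x. x \<in> dyadic_square K y \<Longrightarrow> clean E K x"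
    and g: "g = a + b + E"
    and M: "K' < g + max a b" "g + max a b \<le> K + m"
    and K: "K \<le> K'" "K = 0 \<or> K + 2 * E \<le> K'"
  shows "real (card {z \<in> subsquares m y. \<exists>x \<in> dyadic_square (K + m) z. near_line a b g x}) \<le> 921600 * 4^m / 2^E"
proof -
  obtain i0 j0 where y: "y = (i0, j0)" by fastforce
  define \<alpha> where "\<alpha> = real_of_int i0 / 2^K"
  define \<beta> where "\<beta> = real_of_int j0 / 2^K"
  define n where "n = max a b"
  have base: "(\<alpha>, \<beta>) \<in> dyadic_square K y"
    unfolding dyadic_square_def y \<alpha>_def \<beta>_def by (simp add: divide_right_mono)
  define T1 :: real where "T1 = 2^(a+1)"
  define T2 :: real where "T2 = 2^(b+1)"
  \<comment> \<open>5 = 2 + 2 + 1: moving to the corner changes each of A x and B x' by at most 2 *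
    2^n / 2^K, and the linear form itself is at most 2^-g \<le> 2^n / 2^K.\<close>
  define T3 :: real where "T3 = 5 * 2^n / 2^K"
  have T: "0 < T1" "0 < T2" "0 < T3" unfolding T1_def T2_def T3_def by auto
  have arith: "K = 0 \<or> K + E + 1 \<le> a + b + n"
    using M(1) g K unfolding n_def by auto
  have Teq: "T1 * T2 * T3 = 20 * 2^(a+b+n) / 2^K"
    unfolding T1_def T2_def T3_def by (simp add: power_add)
  have V: "1 \<le> T1 * T2 * T3"
  proof -
    have "K \<le> a + b + n" using arith by auto
    then have "(2::real)^K \<le> 2^(a+b+n)" by (intro power_increasing) auto
    then have "(2::real)^K \<le> 20 * 2^(a+b+n)" using zero_less_power[of "2::real" "a+b+n"] by linarith
    then show ?thesis unfolding Teq by (simp add: pos_le_divide_eq)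
  qed
  define S where "S = {(A, B, C). primitive (A, B, C) \<and> \<bar>A\<bar> \<le> 2^(a+1) \<and> \<bar>B\<bar> \<le> 2^(b+1) \<and> 2^max a b \<le> max \<bar>A\<bar> \<bar>B\<bar> \<and>
    (\<exists>x x'. (x, x') \<in> dyadic_square K y \<and> \<bar>of_int A * x - of_int B * x' + of_int C\<bar> \<le> 1 / 2^g)}"
  have cS: "finite S \<and> real (card S) \<le> 7680 * (T1 * T2 * T3)"
  proof (rule line_count[OF T V, where \<alpha> = \<alpha> and \<beta> = \<beta>])
    fix q r p :: int
    assume prim: "primitive (q, r, p)" and r: "\<bar>of_int q * \<alpha> - of_int r\<bar> \<le> 1 / (6 * T1)"
      and p: "\<bar>of_int q * \<beta> - of_int p\<bar> \<le> 1 / (6 * T2)"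
    have T1': "1 / (6 * T1) \<le> 1 / 2^(a+3)" unfolding T1_def by (simp add: field_simps power_add)
    have T2': "1 / (6 * T2) \<le> 1 / 2^(b+3)" unfolding T2_def by (simp add: field_simps power_add)
    show "1 / (6 * T3) < \<bar>real_of_int q\<bar>"
    proof (rule ccontr)
      assume "\<not> ?thesis"
      then have le: "\<bar>real_of_int q\<bar> \<le> 1 / (6 * T3)" by simp
      have nz: "q \<noteq> 0"
      proof
        assume q: "q = 0"
        have lt: "1 / 2^(c+3) < (1::real)" for c by (simp add: one_less_power)
        have "\<bar>real_of_int r\<bar> \<le> 1 / (6 * T1)" "\<bar>real_of_int p\<bar> \<le> 1 / (6 * T2)"
          using r p unfolding q by simp_all
        then have "\<bar>real_of_int r\<bar> < 1" "\<bar>real_of_int p\<bar> < 1"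
          using T1' T2' lt[of a] lt[of b] by linarith+
        then have "r = 0" "p = 0" by linarith+
        then show False using prim q unfolding primitive_def by simp
      qed
      \<comment> \<open>\<open>near_point\<close> asks for a positive denominator; the sign change
        keeps the triple primitive.\<close>
      obtain s :: int where s: "s = 1 \<or> s = -1" "0 < s * q"
        using nz by (metis mult_1 mult_minus1 neg_0_less_iff_less not_less_iff_gr_or_eq)
      obtain c where c: "\<bar>q\<bar> < 2^(c+1)" "2^c \<le> \<bar>q\<bar> \<or> c = 0" by (rule exists_dyadic_size)
      have c2: "2^c \<le> \<bar>q\<bar>" using c(2) nz by auto
      then have c2': "2^c \<le> \<bar>real_of_int q\<bar>" by (metis of_int_abs of_int_le_iff of_int_numeral of_int_power)
      then have "2^c \<le> 1 / (6 * T3)" using le by linarith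
      then have "30 * 2^(n + c) \<le> (2::real)^K"
        unfolding T3_def by (simp add: field_simps power_add)
      then have K4: "n + c + 4 \<le> K" by (rule pow2_mult_le_imp) simp
      have sq: "s * q = \<bar>q\<bar>" using s by auto
      have "primitive (s * q, s * r, s * p)" using prim s(1) unfolding primitive_def by auto
      moreover have "\<bar>of_int (s * q) * \<alpha> - of_int (s * r)\<bar> \<le> 1 / 2^(a+3)" "\<bar>of_int (s * q) * \<beta> - of_int (s * p)\<bar> \<le> 1 / 2^(b+3)"
        using s(1) r p T1' T2' by (auto simp: abs_minus_commute)
      ultimately have "near_point c (a + 3) (b + 3) (\<alpha>, \<beta>)"
        unfolding near_point_def prod.case using c(1) c2
        by (intro exI[of _ "s * q"] exI[of _ "s * r"] exI[of _ "s * p"]) (auto simp: sq)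
      moreover have "c + E \<le> (a + 3) + (b + 3) + 1" using arith K4 by auto
      moreover have "c + max (a + 3) (b + 3) \<le> K" using K4 unfolding n_def by auto
      ultimately show False using cl[OF base] unfolding clean_def by auto
    qed
  next
    fix A B C assume "(A, B, C) \<in> S"
    then obtain x x' where h: "\<bar>A\<bar> \<le> 2^(a+1)" "\<bar>B\<bar> \<le> 2^(b+1)" "(x, x') \<in> dyadic_square K y"
      "\<bar>of_int A * x - of_int B * x' + of_int C\<bar> \<le> 1 / 2^g" unfolding S_def by auto
    have A: "\<bar>real_of_int A\<bar> \<le> 2^(a+1)" and B: "\<bar>real_of_int B\<bar> \<le> 2^(b+1)"
      using h(1,2) by (metis of_int_abs of_int_le_iff of_int_numeral of_int_power)+
    have p2: "(2::real)^(a+1) \<le> 2 * 2^n" "(2::real)^(b+1) \<le> 2 * 2^n" unfolding n_def by (auto intro: power_increasing)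
    have d: "\<bar>x - \<alpha>\<bar> \<le> 1 / 2^K" "\<bar>x' - \<beta>\<bar> \<le> 1 / 2^K"
      using h(3) unfolding dyadic_square_def y \<alpha>_def \<beta>_def by (auto simp: add_divide_distrib)
    have "\<bar>of_int A * (x - \<alpha>)\<bar> \<le> 2 * 2^n * (1 / 2^K)" "\<bar>of_int B * (x' - \<beta>)\<bar> \<le> 2 * 2^n * (1 / 2^K)"
      unfolding abs_mult using A B p2 d by (intro mult_mono; linarith)+
    then have "\<bar>of_int A * (x - \<alpha>)\<bar> \<le> 2 * (2^n / 2^K)" "\<bar>of_int B * (x' - \<beta>)\<bar> \<le> 2 * (2^n / 2^K)" by simp_all
    moreover have "1 / 2^g \<le> (2::real)^n / 2^K"
    proof -
      have "(2::real)^K \<le> 2^(g + n)" using M(1) K(1) unfolding n_def by (intro power_increasing) auto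
      then show ?thesis by (simp add: field_simps power_add)
    qed
    moreover have "of_int A * \<alpha> - of_int B * \<beta> + of_int C =
      (of_int A * x - of_int B * x' + of_int C) - of_int A * (x - \<alpha>) + of_int B * (x' - \<beta>)"
      by (simp add: algebra_simps)
    ultimately have "\<bar>of_int A * \<alpha> - of_int B * \<beta> + of_int C\<bar> \<le> 5 * (2^n / 2^K)" using h(4) by linarith
    then have "\<bar>of_int A * \<alpha> - of_int B * \<beta> + of_int C\<bar> \<le> T3" unfolding T3_def by simp
    then show "\<bar>real_of_int A\<bar> \<le> T1 \<and> \<bar>real_of_int B\<bar> \<le> T2 \<and> \<bar>of_int A * \<alpha> - of_int B * \<beta> + of_int C\<bar> \<le> T3"
      using A B unfolding T1_def T2_def by simp
  qed (auto simp: S_def)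
  define G where "G = (\<lambda>(A, B, C). {z \<in> subsquares m y. \<exists>x x'. (x, x') \<in> dyadic_square (K + m) z \<and>
    \<bar>of_int A * x - of_int B * x' + real_of_int C\<bar> \<le> 1 / 2^g})"
  have gn: "g + n \<le> K + m" using M(2) unfolding n_def .
  have G: "real (card (G t)) \<le> 6 * 2^m * 2^(K+m) / 2^(g+n)" if t: "t \<in> S" for t
  proof -
    obtain A B C where t': "t = (A, B, C)" using prod_cases3 by blast
    have AB: "2^n \<le> max \<bar>A\<bar> \<bar>B\<bar>" using t unfolding t' S_def n_def by auto
    show ?thesis
    proof (cases "\<bar>A\<bar> \<le> \<bar>B\<bar>")
      case True
      have "G t = {(i, j). i div 2^m = i0 \<and> j div 2^m = j0 \<and>
        (\<exists>x x'::real. of_int i / 2^(K+m) \<le> x \<and> x \<le> (of_int i + 1) / 2^(K+m) \<and>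
        of_int j / 2^(K+m) \<le> x' \<and> x' \<le> (of_int j + 1) / 2^(K+m) \<and> \<bar>of_int A * x + of_int (- B) * x' + of_int C\<bar> \<le> 1 / 2^g)}"
        unfolding G_def t' subsquares_def dyadic_square_def y by (auto; blast)
      then show ?thesis using card_dyadic_strip_le[of n "- B" A g K m] gn AB True by simp
    next
      case False
      \<comment> \<open>The coordinates are exchanged so that the second one carries the dominant
        coefficient.\<close>
      have "prod.swap ` G t = {(i, j). i div 2^m = j0 \<and> j div 2^m = i0 \<and>
        (\<exists>x x'::real. of_int i / 2^(K+m) \<le> x \<and> x \<le> (of_int i + 1) / 2^(K+m) \<and>
        of_int j / 2^(K+m) \<le> x' \<and> x' \<le> (of_int j + 1) / 2^(K+m) \<and> \<bar>of_int (- B) * x + of_int A * x' + of_int C\<bar> \<le> 1 / 2^g)}"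
        (is "_ = ?R")
      proof -
        have "(j, i) \<in> G t \<longleftrightarrow> (i, j) \<in> ?R" for i j
          unfolding G_def t' subsquares_def dyadic_square_def y by (auto simp: algebra_simps)
        moreover have "prod.swap ` G t = {(i, j). (j, i) \<in> G t}" by force
        ultimately show ?thesis by (simp add: set_eq_iff)
      qed
      then have "real (card (prod.swap ` G t)) \<le> 6 * 2^m * 2^(K+m) / 2^(g+n)"
        using card_dyadic_strip_le[of n A "- B" g K m] gn AB False by simp
      then show ?thesis by (simp add: card_image)
    qed
  qed
  let ?Z = "{z \<in> subsquares m y. \<exists>x \<in> dyadic_square (K + m) z. near_line a b g x}"
  have "?Z \<subseteq> (\<Union>t\<in>S. G t)"
  proof
    fix z assume z: "z \<in> ?Z"
    then obtain x x' A B C where h: "(x, x') \<in> dyadic_square (K + m) z" "primitive (A, B, C)"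
      "\<bar>A\<bar> \<le> 2^(a+1)" "\<bar>B\<bar> \<le> 2^(b+1)" "2^max a b \<le> max \<bar>A\<bar> \<bar>B\<bar>" "\<bar>of_int A * x - of_int B * x' + real_of_int C\<bar> \<le> 1 / 2^g"
      unfolding near_line_def by auto
    have "(x, x') \<in> dyadic_square K y" using subsquares_subset[of z m y K] z h(1) by auto
    then have "(A, B, C) \<in> S" unfolding S_def using h by auto
    moreover have "z \<in> G (A, B, C)" unfolding G_def using h z by auto
    ultimately show "z \<in> (\<Union>t\<in>S. G t)" by blast
  qed
  moreover have "finite (\<Union>t\<in>S. G t)"
    using finite_subset[OF _ card_subsquares(2)[of m y]] unfolding G_def by (auto simp: cS)
  ultimately have "card ?Z \<le> card (\<Union>t\<in>S. G t)" by (intro card_mono)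
  also have "\<dots> \<le> (\<Sum>t\<in>S. card (G t))" using card_UN_le cS by blast
  finally have "real (card ?Z) \<le> (\<Sum>t\<in>S. real (card (G t)))" using of_nat_mono by fastforce
  also have "\<dots> \<le> (\<Sum>t\<in>S. 6 * 2^m * 2^(K+m) / 2^(g+n))" by (intro sum_mono G)
  also have "\<dots> = real (card S) * (6 * 2^m * 2^(K+m) / 2^(g+n))" by simp
  also have "\<dots> \<le> 7680 * (20 * 2^(a+b+n) / 2^K) * (6 * 2^m * 2^(K+m) / 2^(g+n))"
    using cS unfolding Teq by (intro mult_right_mono) auto
  also have "\<dots> = 921600 * (2^m * 2^m) / 2^E"
    unfolding g by (simp add: power_add)
  also have "\<dots> = 921600 * 4^m / (2^E::real)" by (simp flip: power_mult_distrib)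
  finally show ?thesis .
qed

section \<open>Dimension of a homogeneous dyadic tree\<close>

text \<open>Arbitrary countable covers are reduced to finite covers by open balls: each set is put
  into a ball of radius slightly above its diameter, the excess in r^s' being spread geometrically,
  and compactness leaves finitely many balls. The separate exponent s' > 0 allows s = 0, since the
  radius is recovered by an s'-th root; as diameters are at most 1, replacing s by s' only lowers
  the sum.\<close>

lemma hausdorff_measure_ne_0I:
  fixes K E :: "'a::metric_space set"
  assumes "compact K" "K \<subseteq> E" "0 \<le> s" "s \<le> s'" "0 < s'" "0 < \<eta>"
    and cov: "\<And>I c r. finite (I :: nat set) \<Longrightarrow> (\<And>i. i \<in> I \<Longrightarrow> 0 < r i) \<Longrightarrow> K \<subseteq> (\<Union>i\<in>I. ball (c i) (r i)) \<Longrightarrow>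
      \<eta> \<le> (\<Sum>i\<in>I. r i powr s')"
  shows "hausdorff_measure s E \<noteq> 0"
proof
  assume "hausdorff_measure s E = 0"
  then have "hausdorff_pre_measure s 1 E \<le> 0"
    unfolding hausdorff_measure_def by (metis SUP_upper greaterThan_iff zero_less_one)
  then have "hausdorff_pre_measure s 1 E < ennreal (\<eta> / 4)" using assms(6) by (simp add: ennreal_zero_less_divide)
  then obtain U :: "nat \<Rightarrow> 'a set" where U: "E \<subseteq> (\<Union>i. U i)" "\<And>i. bounded (U i)" "\<And>i. diameter (U i) \<le> 1"
    and sum: "(\<Sum>i. diam_pow s (U i)) < ennreal (\<eta> / 4)"
    unfolding hausdorff_pre_measure_def INF_less_iff by auto
  define J where "J = {i. U i \<noteq> {}}"
  define r where "r i = (diameter (U i) powr s' + \<eta> / 4 * (1/2)^Suc i) powr (1 / s')" for i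
  define c where "c i = (SOME x. x \<in> U i)" for i
  have rp: "r i powr s' = diameter (U i) powr s' + \<eta> / 4 * (1/2)^Suc i" for i
  proof -
    have "0 < diameter (U i) powr s' + \<eta> / 4 * (1/2)^Suc i" using assms(6) by (intro add_nonneg_pos) auto
    then show ?thesis unfolding r_def powr_powr using assms(5) by simp
  qed
  have r0: "0 < r i" for i
  proof -
    have "0 < diameter (U i) powr s' + \<eta> / 4 * (1/2)^Suc i" using assms(6) by (intro add_nonneg_pos) auto
    then show ?thesis unfolding r_def by simp
  qed
  have dr: "diameter (U i) < r i" for i
  proof (rule ccontr)
    assume "\<not> ?thesis"
    then have "r i powr s' \<le> diameter (U i) powr s'" using r0[of i] assms by (intro powr_mono2) auto
    moreover have "0 < \<eta> / 4 * (1/2)^Suc i" using assms by simp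
    ultimately show False using rp[of i] by linarith
  qed
  have "K \<subseteq> (\<Union>i\<in>J. ball (c i) (r i))"
  proof
    fix x assume "x \<in> K"
    then obtain i where i: "x \<in> U i" using U assms by blast
    then have "c i \<in> U i" unfolding c_def by (rule someI)
    then have "dist (c i) x < r i" using diameter_bounded_bound[OF U(2)[of i] _ i] dr[of i] by fastforce
    then show "x \<in> (\<Union>i\<in>J. ball (c i) (r i))" using i unfolding J_def by auto
  qed
  then obtain I where I: "I \<subseteq> J" "finite I" "K \<subseteq> (\<Union>i\<in>I. ball (c i) (r i))"
    using compactE_image[OF assms(1), of J "\<lambda>i. ball (c i) (r i)"] by auto
  have "(\<Sum>i\<in>I. diam_pow s (U i)) \<le> (\<Sum>i. diam_pow s (U i))" using I by (intro sum_le_suminf) auto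
  moreover have "(\<Sum>i\<in>I. ennreal (diameter (U i) powr s')) \<le> (\<Sum>i\<in>I. diam_pow s (U i))"
  proof (rule sum_mono)
    fix i assume "i \<in> I"
    then have ne: "U i \<noteq> {}" using I unfolding J_def by auto
    have d: "0 \<le> diameter (U i)" using U by (simp add: diameter_ge_0)
    show "ennreal (diameter (U i) powr s') \<le> diam_pow s (U i)"
    proof (cases "s = 0")
      case True
      then show ?thesis using ne d U(3)[of i] assms by (simp add: diam_pow_def powr_le1)
    next
      case False
      have "diameter (U i) powr s' \<le> diameter (U i) powr s"
        using d U(3)[of i] assms by (cases "diameter (U i) = 0") (auto intro: powr_mono')
      then show ?thesis using ne False by (simp add: diam_pow_def ennreal_leI)
    qed
  qed
  ultimately have "ennreal (\<Sum>i\<in>I. diameter (U i) powr s') < ennreal (\<eta> / 4)" using sum by (simp add: sum_ennreal)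
  then have s1: "(\<Sum>i\<in>I. diameter (U i) powr s') < \<eta> / 4" by (simp add: ennreal_less_iff sum_nonneg)
  have "(\<Sum>i\<in>I. (1/2::real)^Suc i) \<le> (\<Sum>i. (1/2::real)^Suc i)"
    using I power_half_series by (intro sum_le_suminf) (auto simp: sums_iff)
  also have "\<dots> = 1" using power_half_series by (simp add: sums_iff)
  finally have "\<eta> / 4 * (\<Sum>i\<in>I. (1/2::real)^Suc i) \<le> \<eta> / 4 * 1" using assms by (intro mult_left_mono) auto
  then have s2: "(\<Sum>i\<in>I. \<eta> / 4 * (1/2)^Suc i) \<le> \<eta> / 4" by (simp add: sum_distrib_left)
  have "\<eta> \<le> (\<Sum>i\<in>I. r i powr s')" by (rule cov[OF I(2) r0 I(3)])
  also have "\<dots> < \<eta> / 4 + \<eta> / 4" unfolding rp sum.distrib using s1 s2 by linarith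
  finally show False using assms by simp
qed

section \<open>Dyadic subdivision and homogeneous trees of squares\<close>

lemma subsquares_disjoint: "z \<in> subsquares m y \<Longrightarrow> z \<in> subsquares m y' \<Longrightarrow> y = y'"
  unfolding subsquares_def by (auto split: prod.splits)

lemma subsquares_add: "z \<in> subsquares m2 x \<Longrightarrow> x \<in> subsquares m1 y \<Longrightarrow> z \<in> subsquares (m1 + m2) y"
proof -
  assume h: "z \<in> subsquares m2 x" "x \<in> subsquares m1 y"
  have "(2::int)^(m1 + m2) = 2^m2 * 2^m1" by (subst add.commute) (rule power_add)
  then have d: "k div 2^(m1 + m2) = k div 2^m2 div 2^m1" for k :: int
    using zdiv_zmult2_eq[of "2^m1" k "2^m2"] by simp
  show ?thesis using h unfolding subsquares_def
    by (cases x; cases y; cases z) (auto simp only: prod.case mem_Sigma_iff mem_Collect_eq d)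
qed

lemma compact_dyadic_square: "compact (dyadic_square K y)"
  unfolding dyadic_square_def by (cases y) (simp add: compact_Times)

lemma dyadic_square_ne: "dyadic_square K y \<noteq> {}"
proof -
  obtain i j where y: "y = (i, j)" by fastforce
  have "(of_int i / 2^K, of_int j / 2^K) \<in> dyadic_square K y"
    unfolding dyadic_square_def y by (simp add: divide_right_mono)
  then show ?thesis by blast
qed

lemma card_dyadic_squares_ball_le:
  assumes "0 < r" "1 \<le> r * 2^K"
  shows "real (card {y \<in> Y. dyadic_square K y \<inter> ball c r \<noteq> {}}) \<le> 16 * r^2 * 4^K"
proof -
  obtain c1 c2 where c: "c = (c1, c2)" by fastforce
  define I where "I k = {i::int. \<exists>x. of_int i / 2^K \<le> x \<and> x \<le> (of_int i + 1) / 2^K \<and> \<bar>x - k\<bar> \<le> r}" for k :: real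
  have I: "finite (I k)" "real (card (I k)) \<le> 2 * r * 2^K + 2" for k
    by (rule card_near_dyadic_le[of r _ K k]; use assms in \<open>simp add: I_def\<close>)+
  have "{y \<in> Y. dyadic_square K y \<inter> ball c r \<noteq> {}} \<subseteq> I c1 \<times> I c2"
  proof
    fix y assume "y \<in> {y \<in> Y. dyadic_square K y \<inter> ball c r \<noteq> {}}"
    then obtain x1 x2 where x: "(x1, x2) \<in> dyadic_square K y" "dist (c1, c2) (x1, x2) < r" unfolding c by auto
    have "dist c1 x1 < r" "dist c2 x2 < r"
      using x(2) dist_fst_le[of "(c1, c2)" "(x1, x2)"] dist_snd_le[of "(c1, c2)" "(x1, x2)"]
      unfolding fst_conv snd_conv by linarith+
    then have d: "\<bar>x1 - c1\<bar> \<le> r" "\<bar>x2 - c2\<bar> \<le> r" by (auto simp: dist_real_def)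
    obtain i j where y: "y = (i, j)" by fastforce
    have "i \<in> I c1" "j \<in> I c2" using x(1) d unfolding y dyadic_square_def I_def by auto
    then show "y \<in> I c1 \<times> I c2" using y by simp
  qed
  then have "card {y \<in> Y. dyadic_square K y \<inter> ball c r \<noteq> {}} \<le> card (I c1) * card (I c2)"
    unfolding card_cartesian_product[symmetric] by (intro card_mono finite_cartesian_product I)
  then have "real (card {y \<in> Y. dyadic_square K y \<inter> ball c r \<noteq> {}}) \<le> real (card (I c1)) * real (card (I c2))"
    unfolding of_nat_mult[symmetric] by (rule of_nat_mono)
  also have "\<dots> \<le> (4 * (r * 2^K)) * (4 * (r * 2^K))"
    using I(2)[of c1] I(2)[of c2] assms by (intro mult_mono) auto
  also have "\<dots> = 16 * r^2 * (2^K * 2^K)" by (simp add: power2_eq_square)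
  also have "(2^K * 2^K :: real) = 4^K" by (simp flip: power_mult_distrib)
  finally show ?thesis .
qed

text \<open>The exact number c n of children is what later replaces a measure: equal numbers of
  descendants make the proportion of nodes a substitute for mass. \<open>Inv\<close> is the property
  a node must have for enough children to be found, and the children are chosen so as to have it
  again.\<close>

locale dyadic_tree =
  fixes L :: "nat \<Rightarrow> nat" and sub :: "nat \<Rightarrow> int \<times> int \<Rightarrow> (int \<times> int) set" and c :: "nat \<Rightarrow> nat"
    and Inv :: "nat \<Rightarrow> int \<times> int \<Rightarrow> bool"
  assumes L0: "L 0 = 0" and L_mono: "L n \<le> L (Suc n)" 
    and root: "Inv 0 (0, 0)"
    and sub: "Inv n y \<Longrightarrow> sub n y \<subseteq> {z \<in> subsquares (L (Suc n) - L n) y. Inv (Suc n) z}"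
    and card_sub: "Inv n y \<Longrightarrow> card (sub n y) = c n"
    and c_ge: "4^(L (Suc n) - L n) \<le> 2 * c n"
begin

primrec nodes :: "nat \<Rightarrow> (int \<times> int) set" where
  "nodes 0 = {(0, 0)}"
| "nodes (Suc n) = (\<Union>y\<in>nodes n. sub n y)"

definition limit_set :: "(real \<times> real) set" where
  "limit_set = (\<Inter>n. \<Union>y\<in>nodes n. dyadic_square (L n) y)"

lemma nodes_Inv: "y \<in> nodes n \<Longrightarrow> Inv n y"
proof (induction n arbitrary: y)
  case 0 then show ?case using root by simp
next
  case (Suc n)
  then obtain y' where "y' \<in> nodes n" "y \<in> sub n y'" by auto
  then show ?case using sub[OF Suc.IH, of y'] by blast
qed

lemma c_pos: "0 < c n"
  using c_ge[of n] by (cases "c n") auto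

lemma finite_sub: "Inv n y \<Longrightarrow> finite (sub n y)"
  by (rule finite_subset[OF _ card_subsquares(2)[of "L (Suc n) - L n" y]]) (use sub[of n y] in auto)

lemma finite_nodes: "finite (nodes n)"
  by (induction n) (auto simp: finite_sub nodes_Inv)

lemma sub_nested: "Inv n y \<Longrightarrow> z \<in> sub n y \<Longrightarrow> dyadic_square (L (Suc n)) z \<subseteq> dyadic_square (L n) y"
  using subsquares_subset[of z "L (Suc n) - L n" y "L n"] sub[of n y] L_mono[of n] by auto

lemma card_nodes: "card (nodes (Suc n)) = card (nodes n) * c n"
proof -
  have "card (\<Union>y\<in>nodes n. sub n y) = (\<Sum>y\<in>nodes n. card (sub n y))"
  proof (rule card_UN_disjoint)
    show "\<forall>i\<in>nodes n. \<forall>j\<in>nodes n. i \<noteq> j \<longrightarrow> sub n i \<inter> sub n j = {}"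
    proof (intro ballI impI equals0I)
      fix i j z assume h: "i \<in> nodes n" "j \<in> nodes n" "i \<noteq> j" "z \<in> sub n i \<inter> sub n j"
      then show False
        using sub[OF nodes_Inv[OF h(1)]] sub[OF nodes_Inv[OF h(2)]]
          subsquares_disjoint[of z "L (Suc n) - L n" i j] by blast
    qed
  qed (auto simp: finite_nodes finite_sub nodes_Inv)
  then show ?thesis using card_sub nodes_Inv by simp
qed

lemma card_nodes_ge: "4^L n \<le> real (card (nodes n)) * 2^n"
proof (induction n)
  case 0 then show ?case by (simp add: L0)
next
  case (Suc n)
  have "(4::real)^(L (Suc n) - L n) \<le> 2 * real (c n)"
    using c_ge[of n] by (metis of_nat_le_iff of_nat_mult of_nat_numeral of_nat_power)
  then have "(4::real)^L n * 4^(L (Suc n) - L n) \<le> (real (card (nodes n)) * 2^n) * (2 * real (c n))"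
    using Suc by (intro mult_mono) auto
  then show ?case using L_mono[of n] by (simp add: card_nodes mult_ac del: nodes.simps flip: power_add)
qed

definition hit :: "nat \<Rightarrow> (real \<times> real) set \<Rightarrow> (int \<times> int) set" where
  "hit n U = {y \<in> nodes n. dyadic_square (L n) y \<inter> U \<noteq> {}}"

lemma card_hit_Suc: "card (hit (Suc n) U) \<le> card (hit n U) * c n"
proof -
  have fin: "finite (hit n U)" unfolding hit_def using finite_nodes by auto
  have "hit (Suc n) U \<subseteq> (\<Union>y\<in>hit n U. sub n y)"
  proof
    fix z assume "z \<in> hit (Suc n) U"
    then obtain y where y: "y \<in> nodes n" "z \<in> sub n y" "dyadic_square (L (Suc n)) z \<inter> U \<noteq> {}"
      unfolding hit_def by auto
    then show "z \<in> (\<Union>y\<in>hit n U. sub n y)"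
      using sub_nested[OF nodes_Inv[OF y(1)] y(2)] unfolding hit_def by blast
  qed
  then have "card (hit (Suc n) U) \<le> card (\<Union>y\<in>hit n U. sub n y)"
    using fin by (intro card_mono) (auto simp: hit_def finite_sub nodes_Inv)
  also have "\<dots> \<le> (\<Sum>y\<in>hit n U. card (sub n y))" by (rule card_UN_le[OF fin])
  also have "\<dots> = card (hit n U) * c n" using card_sub nodes_Inv unfolding hit_def by simp
  finally show ?thesis .
qed

text \<open>All nodes of a generation have equally many children, so the proportion of nodes that
  meet U cannot rise from one generation to the next. Estimates made at different generations
  thereby become comparable at a common later one.\<close>

lemma card_hit_ratio:
  assumes "real (card (hit n U)) \<le> q * real (card (nodes n))" "n \<le> N"
  shows "real (card (hit N U)) \<le> q * real (card (nodes N))"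
  using assms(2)
proof (induction N rule: dec_induct)
  case base then show ?case using assms by simp
next
  case (step N)
  have "real (card (hit (Suc N) U)) \<le> real (card (hit N U)) * real (c N)"
    using card_hit_Suc by (metis of_nat_le_iff of_nat_mult)
  also have "\<dots> \<le> q * real (card (nodes N)) * real (c N)" using step by (intro mult_right_mono) auto
  finally show ?case by (simp add: card_nodes del: nodes.simps)
qed

lemma ancestor: "y \<in> nodes (n + k) \<Longrightarrow> \<exists>y'\<in>nodes n. dyadic_square (L (n + k)) y \<subseteq> dyadic_square (L n) y'"
proof (induction k arbitrary: y)
  case 0 then show ?case by auto
next
  case (Suc k)
  then obtain y1 where y1: "y1 \<in> nodes (n + k)" "y \<in> sub (n + k) y1" by auto
  obtain y' where "y' \<in> nodes n" "dyadic_square (L (n + k)) y1 \<subseteq> dyadic_square (L n) y'"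
    using Suc.IH[OF y1(1)] by blast
  moreover have "dyadic_square (L (n + Suc k)) y \<subseteq> dyadic_square (L (n + k)) y1"
    using sub_nested[OF nodes_Inv[OF y1(1)] y1(2)] by simp
  ultimately show ?case by blast
qed

lemma compact_limit_set: "compact limit_set"
  unfolding limit_set_def
proof (rule compact_Inter)
  fix T assume "T \<in> range (\<lambda>n. \<Union>y\<in>nodes n. dyadic_square (L n) y)"
  then obtain n where "T = (\<Union>y\<in>nodes n. dyadic_square (L n) y)" by blast
  then show "compact T" using compact_UN[OF finite_nodes[of n]] compact_dyadic_square by blast
qed simp

text \<open>Every node has a child, so a chain of chosen children gives nested compact squares with
  a common point. Hence some member of any cover of the limit set meets a given node.\<close>

lemma node_meets_limit_set:
  assumes "y \<in> nodes N"
  shows "dyadic_square (L N) y \<inter> limit_set \<noteq> {}"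
proof -
  define p where "p = rec_nat y (\<lambda>k z. SOME z'. z' \<in> sub (N + k) z)"
  have p0: "p 0 = y" and pS: "p (Suc k) = (SOME z'. z' \<in> sub (N + k) (p k))" for k
    unfolding p_def by auto
  have step: "p (Suc k) \<in> sub (N + k) (p k)" if "p k \<in> nodes (N + k)" for k
  proof -
    have "card (sub (N + k) (p k)) \<noteq> 0" using card_sub[OF nodes_Inv[OF that]] c_pos by simp
    then have "sub (N + k) (p k) \<noteq> {}" by auto
    then show ?thesis unfolding pS by (rule some_in_eq[THEN iffD2])
  qed
  have p: "p k \<in> nodes (N + k)" for k
    by (induction k) (use p0 assms step in auto)
  define F where "F k = dyadic_square (L (N + k)) (p k)" for k
  have dec: "F (Suc k) \<subseteq> F k" for k
    unfolding F_def using sub_nested[OF nodes_Inv[OF p] step[OF p]] by simp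
  have "\<Inter> (range F) \<noteq> {}"
  proof (rule compact_nest)
    show "F n \<subseteq> F m" if "m \<le> n" for m n using lift_Suc_antimono_le[of F, OF dec that] .
  qed (auto simp: F_def compact_dyadic_square dyadic_square_ne)
  then obtain x where x: "\<And>k. x \<in> F k" by auto
  have "x \<in> (\<Union>y\<in>nodes n. dyadic_square (L n) y)" for n
  proof (cases "N \<le> n")
    case True
    then show ?thesis using x[of "n - N"] p[of "n - N"] unfolding F_def by auto
  next
    case False
    then obtain k where "N = n + k" by (metis le_add_diff_inverse nat_le_linear)
    then show ?thesis using ancestor[of y n k] assms x[of 0] p0 unfolding F_def by auto
  qed
  moreover have "x \<in> dyadic_square (L N) y" using x[of 0] p0 unfolding F_def by simp
  ultimately show ?thesis unfolding limit_set_def by auto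
qed

text \<open>Mass distribution principle with proportions of nodes as mass. A ball of radius r < 1 is
  examined at the first generation n whose side 2^-L(n) is at most r. It meets at most 16 r^2 4^L(n)
  nodes, a proportion of at most 16 r^2 2^n. By minimality of n and the growth hypothesis, 2^(n-1)
  \<le> C r^(s-2), so the proportion is at most 32 C r^s. The proportions of all balls add up to at
  least 1.\<close>

lemma cover_bound:
  fixes s C :: real
  assumes s: "0 \<le> s" "s < 2" and C: "1 \<le> C" "\<And>n. 2^n \<le> C * (2^L n) powr (2 - s)"
    and unb: "\<And>k. \<exists>n. k \<le> L n"
    and I: "finite I" "\<And>i. i \<in> I \<Longrightarrow> 0 < r i" "limit_set \<subseteq> (\<Union>i\<in>I. ball (x i) (r i))"
  shows "1 / (32 * C) \<le> (\<Sum>i\<in>I. r i powr s)"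
proof (cases "\<exists>i\<in>I. 1 \<le> r i")
  case True
  then obtain i where i: "i \<in> I" "1 \<le> r i" by blast
  have "1 / (32 * C) \<le> 1" using C by simp
  also have "1 \<le> r i powr s" using i s by (simp add: ge_one_powr_ge_zero)
  also have "\<dots> \<le> (\<Sum>i\<in>I. r i powr s)" by (rule member_le_sum[OF i(1) _ I(1)]) auto
  finally show ?thesis .
next
  case False
  have "\<exists>n. real (card (hit n (ball (x i) (r i)))) \<le> (32 * C * r i powr s) * real (card (nodes n))" if i: "i \<in> I" for i
  proof -
    have r: "0 < r i" "r i < 1" using I(2)[OF i] False i by auto
    obtain k where k: "1 / r i < 2^k" using real_arch_pow[of 2 "1 / r i"] by auto
    obtain n0 where "k \<le> L n0" using unb by blast
    then have "(2::real)^k \<le> 2^L n0" by (intro power_increasing) auto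
    then have "r i * 2^k \<le> r i * 2^L n0" using r by (intro mult_left_mono) auto
    moreover have "1 < r i * 2^k" using k r by (simp add: field_simps)
    ultimately have "1 \<le> r i * 2^L n0" by linarith
    define n where "n = (LEAST n. 1 \<le> r i * 2^L n)"
    have n: "1 \<le> r i * 2^L n" unfolding n_def using \<open>1 \<le> r i * 2^L n0\<close> by (rule LeastI)
    \<comment> \<open>Generation 0 has side 1, which exceeds r i, so the first suitable generation
      has a predecessor.\<close>
    have "n \<noteq> 0" using n r L0 by (cases n) auto
    then obtain m where m: "n = Suc m" by (cases n) auto
    have "r i * 2^L m < 1" using not_less_Least[of m "\<lambda>n. 1 \<le> r i * 2^L n"] unfolding n_def[symmetric] m by auto
    then have "(2^L m) powr (2 - s) \<le> (1 / r i) powr (2 - s)"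
      using r s by (intro powr_mono2) (auto simp: field_simps)
    then have "C * (2^L m) powr (2 - s) \<le> C * (1 / r i) powr (2 - s)" using C(1) by (intro mult_left_mono) auto
    then have "2^m \<le> C * (1 / r i) powr (2 - s)" using C(2)[of m] by linarith
    then have "r i^2 * 2^m \<le> r i^2 * (C * (1 / r i) powr (2 - s))" by (intro mult_left_mono) auto
    also have "\<dots> = C * (r i^2 * r i powr (s - 2))"
      using r by (simp add: powr_divide powr_minus_divide[symmetric])
    also have "r i^2 * r i powr (s - 2) = r i powr s"
      using r by (simp add: powr_diff powr_numeral)
    finally have b: "r i^2 * 2^m \<le> C * r i powr s" .
    have "real (card (hit n (ball (x i) (r i)))) \<le> 16 * r i^2 * 4^L n"
      unfolding hit_def by (rule card_dyadic_squares_ball_le[OF r(1) n])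
    also have "\<dots> \<le> 16 * r i^2 * (real (card (nodes n)) * 2^n)"
      using card_nodes_ge by (intro mult_left_mono) auto
    also have "\<dots> = 32 * (r i^2 * 2^m) * real (card (nodes n))" unfolding m by simp
    also have "\<dots> \<le> 32 * (C * r i powr s) * real (card (nodes n))"
      using b by (intro mult_right_mono mult_left_mono) auto
    finally show ?thesis by (auto simp: mult.assoc)
  qed
  then obtain n where n: "\<And>i. i \<in> I \<Longrightarrow>
    real (card (hit (n i) (ball (x i) (r i)))) \<le> (32 * C * r i powr s) * real (card (nodes (n i)))" by metis
  \<comment> \<open>The sum serves as a common upper bound of the generations n i.\<close>
  define N where "N = (\<Sum>i\<in>I. n i)"
  have nN: "n i \<le> N" if "i \<in> I" for i unfolding N_def using I(1) that by (simp add: member_le_sum)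
  have "nodes N \<subseteq> (\<Union>i\<in>I. hit N (ball (x i) (r i)))"
  proof
    fix y assume y: "y \<in> nodes N"
    then show "y \<in> (\<Union>i\<in>I. hit N (ball (x i) (r i)))"
      using node_meets_limit_set[OF y] I(3) unfolding hit_def by blast
  qed
  then have "card (nodes N) \<le> card (\<Union>i\<in>I. hit N (ball (x i) (r i)))"
    using I(1) finite_nodes by (intro card_mono) (auto simp: hit_def)
  also have "\<dots> \<le> (\<Sum>i\<in>I. card (hit N (ball (x i) (r i))))" by (rule card_UN_le[OF I(1)])
  finally have "real (card (nodes N)) \<le> (\<Sum>i\<in>I. real (card (hit N (ball (x i) (r i)))))"
    using of_nat_mono by fastforce
  also have "\<dots> \<le> (\<Sum>i\<in>I. (32 * C * r i powr s) * real (card (nodes N)))"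
    by (intro sum_mono card_hit_ratio[OF n nN])
  also have "\<dots> = (32 * C * (\<Sum>i\<in>I. r i powr s)) * real (card (nodes N))"
    by (simp add: sum_distrib_left sum_distrib_right)
  finally have "1 * real (card (nodes N)) \<le> (32 * C * (\<Sum>i\<in>I. r i powr s)) * real (card (nodes N))" by simp
  moreover have "0 < real (card (nodes N))"
  proof -
    have "0 < real (card (nodes N)) * 2^N" by (rule less_le_trans[OF _ card_nodes_ge]) simp
    then show ?thesis by (simp add: zero_less_mult_iff)
  qed
  ultimately have "1 \<le> 32 * C * (\<Sum>i\<in>I. r i powr s)" by (simp only: mult_le_cancel_right_pos)
  then show ?thesis using C(1) by (simp add: field_simps)
qed

end

section \<open>The scales\<close>

text \<open>
  The constants 36 and 40 make \<^term>\<open>2 ^ expo n\<close> exceed the number of classes times the implied constants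
  of the counting lemmas; see \<open>class_total_bound\<close> below.
\<close>

definition expo :: "nat \<Rightarrow> nat" where
  "expo n = 36 + nat \<lceil>log 2 ((real n + 2) * (log 2 (real n + 2) + 40)^2)\<rceil>"

text \<open>
  The first step is trivial, so that the level 1 square is the unit square and its children can be counted inside the
  level 0 square like all later ones.
\<close>

fun level :: "nat \<Rightarrow> nat" where
  "level 0 = 0"
| "level (Suc n) = (if n = 0 then 0 else level n + 2 * expo (n + 2))"

lemma expo_arg:
  fixes n :: nat
  shows "1 \<le> log 2 (real n + 2)" "2 \<le> (real n + 2) * (log 2 (real n + 2) + 40)^2"
proof -
  show l: "1 \<le> log 2 (real n + 2)" using log_mono[of 2 2 "real n + 2"] by simp
  have "1 \<le> (log 2 (real n + 2) + 40)^2" using l by (intro one_le_power) simp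
  then have "2 * 1 \<le> (real n + 2) * (log 2 (real n + 2) + 40)^2" by (intro mult_mono) auto
  then show "2 \<le> (real n + 2) * (log 2 (real n + 2) + 40)^2" by simp
qed

lemma real_expo:
  "36 + log 2 ((real n + 2) * (log 2 (real n + 2) + 40)^2) \<le> real (expo n)"
  "real (expo n) \<le> 37 + log 2 ((real n + 2) * (log 2 (real n + 2) + 40)^2)"
proof -
  have "0 \<le> log 2 ((real n + 2) * (log 2 (real n + 2) + 40)^2)" using expo_arg(2)[of n] by simp
  then show "36 + log 2 ((real n + 2) * (log 2 (real n + 2) + 40)^2) \<le> real (expo n)"
    "real (expo n) \<le> 37 + log 2 ((real n + 2) * (log 2 (real n + 2) + 40)^2)"
    unfolding expo_def by (simp_all add: of_nat_nat) linarith+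
qed

lemma two_power_expo:
  "2^36 * ((real n + 2) * (log 2 (real n + 2) + 40)^2) \<le> 2^expo n"
  "2^expo n \<le> 2^37 * ((real n + 2) * (log 2 (real n + 2) + 40)^2)"
proof -
  let ?x = "(real n + 2) * (log 2 (real n + 2) + 40)^2"
  have x: "0 < ?x" using expo_arg(2)[of n] by linarith
  have "2 powr (36 + log 2 ?x) \<le> 2 powr (real (expo n))" using real_expo(1) by (intro powr_mono) auto
  moreover have "2 powr (36 + log 2 ?x) = 2^36 * ?x" using x by (simp add: powr_add)
  ultimately show "2^36 * ?x \<le> 2^expo n" by (simp add: powr_realpow)
  have "2 powr (real (expo n)) \<le> 2 powr (37 + log 2 ?x)" using real_expo(2) by (intro powr_mono) auto
  moreover have "2 powr (37 + log 2 ?x) = 2^37 * ?x" using x by (simp add: powr_add)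
  ultimately show "2^expo n \<le> 2^37 * ?x" by (simp add: powr_realpow)
qed

lemma expo_mono: "m \<le> n \<Longrightarrow> expo m \<le> expo n"
proof -
  assume mn: "m \<le> n"
  have "log 2 (real m + 2) \<le> log 2 (real n + 2)" using mn by simp
  then have "(real m + 2) * (log 2 (real m + 2) + 40)^2 \<le> (real n + 2) * (log 2 (real n + 2) + 40)^2"
    using mn expo_arg(1)[of m] by (intro mult_mono power_mono) auto
  then show ?thesis unfolding expo_def
    using expo_arg(2)[of m] by (intro add_left_mono nat_mono ceiling_mono) simp
qed

lemma log2_le: "1 \<le> x \<Longrightarrow> log 2 x \<le> 3/2 * (x - 1)"
proof -
  assume x: "1 \<le> (x::real)"
  have "ln x \<le> x - 1" using x by (intro ln_le_minus_one) auto
  also have "\<dots> \<le> (3/2 * (x - 1)) * ln 2" using x ln2_ge_two_thirds mult_left_mono[of "2/3" "ln 2" "3/2 * (x - 1)"] by simp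
  finally show ?thesis unfolding log_def by (simp add: pos_divide_le_eq)
qed

lemma expo_ge_log: "log 2 (real n + 2) \<le> real (expo n)"
proof -
  have "1 \<le> (log 2 (real n + 2) + 40)^2" using expo_arg(1)[of n] by (intro one_le_power) simp
  then have "(real n + 2) * 1 \<le> (real n + 2) * (log 2 (real n + 2) + 40)^2" by (intro mult_left_mono) auto
  then have "log 2 (real n + 2) \<le> log 2 ((real n + 2) * (log 2 (real n + 2) + 40)^2)"
    by (intro log_mono) auto
  then show ?thesis using real_expo(1)[of n] by linarith
qed

text \<open>Origin of the 40: with z = log 2 (n + 3) the bound is 37 + z + 3 (z + 39) = 4 z + 154,
  and z \<le> 1 + log 2 (n + 2) gives an additive constant 158, below 4 * 40.\<close>

lemma expo_Suc_le: "real (expo (Suc n)) \<le> 4 * (log 2 (real n + 2) + 40)"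
proof -
  let ?y = "log 2 (real n + 2)" and ?z = "log 2 (real (Suc n) + 2)"
  have "?z \<le> log 2 (2 * (real n + 2))" by simp
  also have "\<dots> = 1 + ?y" by (subst log_mult) auto
  finally have z: "?z \<le> 1 + ?y" .
  have z1: "1 \<le> ?z" by (rule expo_arg)
  have "real (expo (Suc n)) \<le> 37 + log 2 ((real (Suc n) + 2) * (?z + 40)^2)" by (rule real_expo)
  also have "log 2 ((real (Suc n) + 2) * (?z + 40)^2) = ?z + 2 * log 2 (?z + 40)"
  proof -
    have "0 < ?z + 40" using z1 by linarith
    then show ?thesis by (subst log_mult) (auto simp: log_nat_power)
  qed
  also have "log 2 (?z + 40) \<le> 3/2 * ((?z + 40) - 1)" using z1 by (intro log2_le) auto
  finally show ?thesis using z by (simp add: algebra_simps)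
qed

lemma level_diff: "level (Suc (Suc n)) - level (Suc n) = 2 * expo (n + 3)"
  by (simp add: numeral_3_eq_3)

lemma level_mono_Suc: "level n \<le> level (Suc n)"
  by (cases n) auto

lemma level_le: "level (Suc n) \<le> 2 * n * expo (n + 2)"
proof (induction n)
  case (Suc n)
  have "level (Suc (Suc n)) = level (Suc n) + 2 * expo (Suc n + 2)" by simp
  also have "\<dots> \<le> 2 * n * expo (n + 2) + 2 * expo (Suc n + 2)" using Suc by simp
  also have "\<dots> \<le> 2 * n * expo (Suc n + 2) + 2 * expo (Suc n + 2)"
    by (intro add_right_mono mult_left_mono expo_mono) auto
  finally show ?case by (simp add: algebra_simps)
qed simp

lemma level_ge: "1 \<le> m \<Longrightarrow> 2 * k * expo m \<le> level (m + k)"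
proof (induction k)
  case (Suc k)
  have "expo m \<le> expo (m + k + 2)" by (intro expo_mono) auto
  then show ?case using Suc by (simp add: algebra_simps)
qed simp

text \<open>109117440 = 16 * 2 * (2488320 + 921600): the constants of the two counting lemmas, the 2
  from \<open>card_classes\<close>, and a 16 that lets at most one sixteenth of the grandchildren be
  bad. With e = expo (n + 3), the step has length 2 e and the level is at most 2 (n + 1) e; as e is
  of order log n, the left side is O(n (log n)^2), the order of the right side.\<close>

lemma class_total_bound:
  "109117440 * real (level (n + 2) - level (n + 1)) * (real (level (n + 2)) + 1) \<le> 2^expo (n + 2)"
proof -
  let ?e = "real (expo (n + 3))" and ?y = "log 2 (real (n + 2) + 2) + 40"
  have d: "real (level (n + 2) - level (n + 1)) = 2 * ?e" using level_diff[of n] by simp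
  have "level (Suc (n + 1)) \<le> 2 * (n + 1) * expo (n + 3)" using level_le[of "n + 1"] by (simp add: numeral_3_eq_3)
  then have "real (level (n + 2)) \<le> real (2 * (n + 1) * expo (n + 3))"
    by (simp del: level.simps of_nat_mult)
  then have l: "real (level (n + 2)) \<le> 2 * (real n + 1) * ?e"
    unfolding of_nat_mult of_nat_add by (simp only: of_nat_numeral of_nat_1)
  have e1: "1 \<le> ?e" unfolding expo_def by simp
  have e: "?e \<le> 4 * ?y" using expo_Suc_le[of "n + 2"] by (simp add: numeral_3_eq_3)
  have "109117440 * real (level (n + 2) - level (n + 1)) * (real (level (n + 2)) + 1)
    \<le> 109117440 * (2 * ?e) * (2 * (real n + 2) * ?e)"
  proof -
    have "real (level (n + 2)) + 1 \<le> 2 * (real n + 1) * ?e + 2 * ?e" using l e1 by linarith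
    also have "\<dots> = 2 * (real n + 2) * ?e" by (simp add: algebra_simps)
    finally show ?thesis unfolding d using e1 by (intro mult_left_mono) auto
  qed
  also have "\<dots> = 436469760 * (real n + 2) * ?e^2" by (simp add: power2_eq_square)
  also have "\<dots> \<le> 436469760 * (real n + 2) * (4 * ?y)^2"
    using e e1 by (intro mult_left_mono power_mono) auto
  also have "\<dots> = 6983516160 * ((real n + 2) * ?y^2)" unfolding power_mult_distrib by simp
  also have "\<dots> \<le> 2^36 * ((real (n + 2) + 2) * ?y^2)"
    by (intro mult_mono) auto
  also have "\<dots> \<le> 2^expo (n + 2)" by (rule two_power_expo)
  finally show ?thesis .
qed

text \<open>Growth hypothesis of \<open>cover_bound\<close>: step lengths tend to infinity, so
  \<open>level n\<close> outgrows every multiple of n.\<close>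

lemma level_growth:
  fixes t :: real
  assumes "0 < t"
  shows "\<exists>C\<ge>1. \<forall>n. 2^n \<le> C * (2^level n) powr t"
proof -
  obtain m where m: "1 / t \<le> real m" using real_arch_simple by blast
  \<comment> \<open>From generation M on, every step has length at least 2 / t and so multiplies
    (2^level n)^t by more than 2; the first M generations are absorbed in the constant 2^M.\<close>
  define M where "M = Suc (2^m)"
  have eM: "1 / t \<le> real (expo M)"
  proof -
    have "log 2 (2^m) \<le> log 2 (real M + 2)" unfolding M_def by (intro log_mono) auto
    then show ?thesis using m expo_ge_log[of M] by simp
  qed
  have "2^n \<le> 2^M * (2^level n) powr t" for n
  proof (cases "n \<le> M")
    case True
    have "(2::real)^n * 1 \<le> 2^M * (2^level n) powr t"
      using True assms by (intro mult_mono power_increasing ge_one_powr_ge_zero) auto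
    then show ?thesis by simp
  next
    case False
    then obtain k where k: "n = M + k" by (metis le_add_diff_inverse nat_le_linear)
    have "real (2 * k * expo M) \<le> real (level n)"
      using level_ge[of M k] unfolding k of_nat_le_iff by (simp add: M_def)
    then have "2 * real k * real (expo M) * t \<le> real (level n) * t" using assms by (intro mult_right_mono) auto
    moreover have "real k \<le> 2 * real k * (real (expo M) * t)"
    proof -
      have "1 \<le> real (expo M) * t" using eM assms by (simp add: field_simps)
      then have "2 * real k * 1 \<le> 2 * real k * (real (expo M) * t)" by (intro mult_left_mono) auto
      then show ?thesis by simp
    qed
    ultimately have "2 powr real k \<le> 2 powr (real (level n) * t)" by (intro powr_mono) (auto simp: mult.assoc)
    then have "2^k \<le> (2^level n) powr t" by (simp add: powr_realpow powr_powr[symmetric])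
    then show ?thesis unfolding k power_add by (intro mult_left_mono) auto
  qed
  then show ?thesis by (intro exI[of _ "2^M"]) auto
qed

lemma level_unbounded: "\<exists>n. k \<le> level n"
proof -
  have "1 \<le> expo 1" unfolding expo_def by simp
  then have "k * 1 \<le> 2 * k * expo 1" by (intro mult_mono) auto
  then show ?thesis using level_ge[of 1 k] by (intro exI[of _ "1 + k"]) linarith
qed

text \<open>Finds a level fine enough for height 2^h at which 2^expo n is still O(h log h). From
  \<open>level_ge\<close>, level (2 m) \<ge> 2 m expo m with expo m \<ge> log 2 (m + 2), so m about
  u = 2h / ln h gives a level of at least about 4h, ample room for 2h + expo n. For n = 2 m, the
  quantity n (log n)^2 is then of order h log h; \<open>X\<close> bounds n + 2 by an explicit
  function of h.\<close>

lemma height_level_bound: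
  "\<exists>c>0. \<forall>\<^sub>F h in sequentially. \<exists>n. 2 * h + expo n \<le> level n \<and> c * 2^expo n \<le> real h * ln (real h)"
proof -
  define u where "u h = 2 * real h / ln (real h)" for h :: nat
  define X where "X h = 2 * (u h + 1) + 2" for h
  have e1: "\<forall>\<^sub>F h in sequentially. 1 \<le> u h" unfolding u_def by real_asymp
  have e2: "\<forall>\<^sub>F h in sequentially. 2 * real h + (37 + 2 * ln (X h * (2 * ln (X h) + 40)^2)) \<le> 2 * u h * ln (u h)"
    unfolding X_def u_def by real_asymp
  have e3: "\<forall>\<^sub>F h in sequentially. X h * (2 * ln (X h) + 40)^2 \<le> 100 * (real h * ln (real h))"
    unfolding X_def u_def by real_asymp
  have log_bounds: "ln x \<le> log 2 x" "log 2 x \<le> 2 * ln x" if "1 \<le> x" for x :: real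
  proof -
    have "ln x * ln 2 \<le> ln x * 1" using that ln2_le_25_over_36 by (intro mult_left_mono) auto
    then show "ln x \<le> log 2 x" unfolding log_def by (simp add: pos_le_divide_eq)
    have "ln x * 1 \<le> ln x * (2 * ln 2)" using that ln2_ge_two_thirds by (intro mult_left_mono) auto
    then show "log 2 x \<le> 2 * ln x" unfolding log_def by (simp add: pos_divide_le_eq mult_ac)
  qed
  have "\<forall>\<^sub>F h in sequentially. \<exists>n. 2 * h + expo n \<le> level n \<and> (1 / (2^37 * 100)) * 2^expo n \<le> real h * ln (real h)"
    using e1 e2 e3
  proof eventually_elim
    case (elim h)
    define m where "m = nat \<lceil>u h\<rceil>"
    have m: "u h \<le> real m" "real m \<le> u h + 1" "1 \<le> m" unfolding m_def using elim(1) by linarith+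
    let ?n = "m + m"
    let ?v = "(real ?n + 2) * (log 2 (real ?n + 2) + 40)^2"
    have n: "real ?n + 2 \<le> X h" using m unfolding X_def by simp
    have "log 2 (real ?n + 2) \<le> 2 * ln (X h)"
      using log_bounds(2)[of "real ?n + 2"] n by (smt (verit) ln_le_cancel_iff of_nat_0_le_iff)
    then have v: "?v \<le> X h * (2 * ln (X h) + 40)^2"
      using n expo_arg(1)[of ?n] by (intro mult_mono power_mono) auto
    have v2: "2 \<le> ?v" by (rule expo_arg)
    have "2^expo ?n \<le> 2^37 * ?v" by (rule two_power_expo)
    also have "\<dots> \<le> 2^37 * (100 * (real h * ln (real h)))" using v elim(3) by (intro mult_left_mono) auto
    finally have "(1 / (2^37 * 100)) * 2^expo ?n \<le> real h * ln (real h)" by simp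
    moreover have "2 * h + expo ?n \<le> level ?n"
    proof -
      have "real (expo ?n) \<le> 37 + log 2 ?v" by (rule real_expo)
      also have "log 2 ?v \<le> 2 * ln ?v" using v2 by (intro log_bounds) auto
      also have "ln ?v \<le> ln (X h * (2 * ln (X h) + 40)^2)" using v v2 by simp
      finally have 1: "2 * real h + real (expo ?n) \<le> 2 * u h * ln (u h)" using elim(2) by simp
      have "ln (u h) \<le> log 2 (real m + 2)"
        using log_bounds(1)[OF elim(1)] m elim(1) by (smt (verit) log_le_cancel_iff)
      then have "ln (u h) \<le> real (expo m)" using expo_ge_log[of m] by linarith
      then have "2 * u h * ln (u h) \<le> 2 * real m * real (expo m)" using m elim(1) by (intro mult_mono) auto
      also have "\<dots> = real (2 * m * expo m)" by simp
      also have "\<dots> \<le> real (level ?n)" using level_ge[OF m(3), of m] unfolding of_nat_le_iff .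
      finally show ?thesis using 1 by linarith
    qed
    ultimately show ?case by blast
  qed
  then show ?thesis by (intro exI[of _ "1 / (2^37 * 100)"]) auto
qed

section \<open>The Cantor set\<close>

declare level.simps(2)[simp del]

text \<open>Classes that become visible between generations n - 1 and n. Prescribing b + d by an
  equation suffices: closer approximations fall into these classes by
  \<open>near_point_antimono\<close>, and the equation removes one free parameter from the number of
  classes.\<close>

definition point_classes :: "nat \<Rightarrow> (nat \<times> nat \<times> nat) set" where
  "point_classes n = {(a, b, d). 1 \<le> b \<and> 1 \<le> d \<and> b + d + 1 = a + expo n \<and>
     level (n - 1) < a + max b d \<and> a + max b d \<le> level n}"

definition line_classes :: "nat \<Rightarrow> (nat \<times> nat) set" where
  "line_classes n = {(a, b). level (n - 1) < a + b + expo n + max a b \<and> a + b + expo n + max a b \<le> level n}"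

definition bad :: "nat \<Rightarrow> int \<times> int \<Rightarrow> bool" where
  "bad n z \<longleftrightarrow> (\<exists>x \<in> dyadic_square (level n) z.
     (\<exists>(a, b, d) \<in> point_classes n. near_point a b d x) \<or>
     (\<exists>(a, b) \<in> line_classes n. near_line a b (a + b + expo n) x))"

definition clean_square :: "nat \<Rightarrow> int \<times> int \<Rightarrow> bool" where
  "clean_square n z \<longleftrightarrow> (\<forall>x \<in> dyadic_square (level n) z. clean (expo n) (level n) x)"

definition branch :: "nat \<Rightarrow> nat" where
  "branch n = level (Suc n) - level n"

definition good :: "nat \<Rightarrow> int \<times> int \<Rightarrow> bool" where
  "good n y \<longleftrightarrow> 4 * card {z \<in> subsquares (branch n) y. bad (Suc n) z} \<le> 4^branch n"

lemma level_branch: "level n + branch n = level (Suc n)"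
  unfolding branch_def using level_mono_Suc[of n] by simp

lemma near_point_antimono:
  assumes "near_point a b d x" "b' \<le> b" "d' \<le> d"
  shows "near_point a b' d' x"
proof -
  have "1 / 2^b \<le> (1 / 2^b' :: real)" "1 / 2^d \<le> (1 / 2^d' :: real)"
    using assms by (auto intro!: divide_left_mono power_increasing)
  then show ?thesis using assms(1) unfolding near_point_def by (cases x) (auto intro: order_trans)
qed

lemma near_line_antimono:
  assumes "near_line a b g x" "g' \<le> g"
  shows "near_line a b g' x"
proof -
  have "1 / 2^g \<le> (1 / 2^g' :: real)"
    using assms by (auto intro!: divide_left_mono power_increasing)
  then show ?thesis using assms(1) unfolding near_line_def by (cases x) (auto intro: order_trans)
qed

lemma clean_square_0: "clean_square 0 z"
  unfolding clean_square_def clean_def by (auto simp: expo_def)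

lemma not_bad_1: "\<not> bad (Suc 0) z"
  unfolding bad_def point_classes_def line_classes_def by (auto simp: level.simps expo_def)

text \<open>A piece already visible at the parent is excluded by the parent's cleanness, since
  \<open>expo\<close> only grows. A newly visible one is first enlarged to exact quality and then
  belongs to a class that \<open>bad\<close> tests.\<close>

lemma clean_square_Suc:
  assumes y: "clean_square n y" and z: "z \<in> subsquares (branch n) y" "\<not> bad (Suc n) z"
  shows "clean_square (Suc n) z"
  unfolding clean_square_def
proof
  fix x assume x: "x \<in> dyadic_square (level (Suc n)) z"
  then have "x \<in> dyadic_square (level n) y"
    using subsquares_subset[OF z(1), of "level n"] unfolding level_branch by blast
  then have c: "clean (expo (Suc n)) (level n) x"
    using y clean_antimono[OF _ expo_mono[of n "Suc n"]] unfolding clean_square_def by auto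
  have "\<not> near_point a b d x" if h: "1 \<le> b" "1 \<le> d" "a + expo (Suc n) \<le> b + d + 1" "a + max b d \<le> level (Suc n)" for a b d
  proof
    assume np: "near_point a b d x"
    have e: "36 \<le> expo (Suc n)" unfolding expo_def by simp
    \<comment> \<open>b and d are lowered until b' + d' + 1 = a + expo (Suc n); the cap on b' keeps
      d' at least 1.\<close>
    define b' where "b' = min b (a + expo (Suc n) - 2)"
    define d' where "d' = a + expo (Suc n) - 1 - b'"
    have h': "1 \<le> b'" "1 \<le> d'" "b' + d' + 1 = a + expo (Suc n)" "b' \<le> b" "d' \<le> d"
      using h e unfolding b'_def d'_def by auto
    then have np': "near_point a b' d' x" using near_point_antimono[OF np] by blast
    have M: "a + max b' d' \<le> level (Suc n)" using h' h by auto
    show False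
    proof (cases "a + max b' d' \<le> level n")
      case True
      then show False using c np' h' unfolding clean_def by auto
    next
      case False
      then have "(a, b', d') \<in> point_classes (Suc n)" using h' M unfolding point_classes_def by auto
      then show False using z(2) x np' unfolding bad_def by blast
    qed
  qed
  moreover have "\<not> near_line a b g x" if h: "a + b + expo (Suc n) \<le> g" "g + max a b \<le> level (Suc n)" for a b g
  proof
    assume "near_line a b g x"
    then have nl: "near_line a b (a + b + expo (Suc n)) x" using near_line_antimono h by blast
    show False
    proof (cases "a + b + expo (Suc n) + max a b \<le> level n")
      case True
      then show False using c nl unfolding clean_def by auto
    next
      case False
      then have "(a, b) \<in> line_classes (Suc n)" using h unfolding line_classes_def by auto
      then show False using z(2) x nl unfolding bad_def by blast
    qed
  qed
  ultimately show "clean (expo (Suc n)) (level (Suc n)) x" unfolding clean_def by blast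
qed

text \<open>With b + d prescribed, a point class is determined by its scale a + max b d, by a, and
  by which of b, d is larger; a line class by its scale, max a b, and which of a, b is larger. These
  data have level n - level (n - 1), level n + 1 and 2 values.\<close>

lemma card_classes:
  "finite (point_classes n)" "card (point_classes n) \<le> 2 * ((level n - level (n - 1)) * (level n + 1))"
  "finite (line_classes n)" "card (line_classes n) \<le> 2 * ((level n - level (n - 1)) * (level n + 1))"
proof -
  let ?R = "{level (n - 1)<..level n} \<times> {..level n} \<times> (UNIV :: bool set)"
  have R: "finite ?R" "card ?R = 2 * ((level n - level (n - 1)) * (level n + 1))"
    by (simp_all add: card_cartesian_product)
  have i1: "inj_on (\<lambda>(a, b, d). (a + max b d, a, b \<le> d)) (point_classes n)"
    unfolding inj_on_def point_classes_def by (auto simp: max_def split: if_splits)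
  have s1: "(\<lambda>(a, b, d). (a + max b d, a, b \<le> d)) ` point_classes n \<subseteq> ?R"
    unfolding point_classes_def by auto
  show "finite (point_classes n)" using inj_on_finite[OF i1 s1 R(1)] .
  show "card (point_classes n) \<le> 2 * ((level n - level (n - 1)) * (level n + 1))"
    using card_inj_on_le[OF i1 s1 R(1)] R(2) by simp
  have i2: "inj_on (\<lambda>(a, b). (a + b + expo n + max a b, max a b, a \<le> b)) (line_classes n)"
    unfolding inj_on_def line_classes_def by (auto simp: max_def split: if_splits)
  have s2: "(\<lambda>(a, b). (a + b + expo n + max a b, max a b, a \<le> b)) ` line_classes n \<subseteq> ?R"
    unfolding line_classes_def by auto
  show "finite (line_classes n)" using inj_on_finite[OF i2 s2 R(1)] .
  show "card (line_classes n) \<le> 2 * ((level n - level (n - 1)) * (level n + 1))"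
    using card_inj_on_le[OF i2 s2 R(1)] R(2) by simp
qed

text \<open>The counting lemmas run with K = \<open>level n\<close> and K' =
  \<open>level (n + 1)\<close>, and \<open>class_total_bound\<close> sums them over all classes. The
  share 1/16 is 1/4 * 1/4, as the averaging in \<open>card_not_good\<close> requires.\<close>

lemma card_bad_grandchildren:
  assumes y: "clean_square n y"
  defines "m \<equiv> branch n + branch (Suc n)"
  shows "16 * card {z \<in> subsquares m y. bad (n + 2) z} \<le> 4^m"
proof -
  have Km: "level n + m = level (n + 2)" unfolding m_def using level_branch[of n] level_branch[of "Suc n"] by simp
  let ?E = "expo (n + 2)"
  have cl: "clean ?E (level n) x" if "x \<in> dyadic_square (level n) y" for x
    using y that clean_antimono[OF _ expo_mono[of n "n + 2"]] unfolding clean_square_def by auto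
  \<comment> \<open>The second alternative is the reason for the step length 2 * expo (n + 2) in
    \<open>level\<close>; the first settles n = 0, where both levels are 0.\<close>
  have K: "level n \<le> level (n + 1)" "level n = 0 \<or> level n + 2 * ?E \<le> level (n + 1)"
    using level_mono_Suc[of n] by (auto simp: level.simps)
  define P where "P = (\<lambda>(a, b, d). {z \<in> subsquares m y. \<exists>x \<in> dyadic_square (level n + m) z. near_point a b d x})"
  define Q where "Q = (\<lambda>(a, b). {z \<in> subsquares m y. \<exists>x \<in> dyadic_square (level n + m) z. near_line a b (a + b + ?E) x})"
  have P: "real (card (P t)) \<le> 2488320 * 4^m / 2^?E" if t: "t \<in> point_classes (n + 2)" for t
  proof -
    obtain a b d where t': "t = (a, b, d)" using prod_cases3 by blast
    show ?thesis unfolding P_def t' prod.case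
      by (rule card_near_point_subsquares_le[where K' = "level (n + 1)", OF cl])
        (use t K Km in \<open>auto simp: point_classes_def t'\<close>)
  qed
  have Q: "real (card (Q t)) \<le> 921600 * 4^m / 2^?E" if t: "t \<in> line_classes (n + 2)" for t
  proof -
    obtain a b where t': "t = (a, b)" by fastforce
    show ?thesis unfolding Q_def t' prod.case
      by (rule card_near_line_subsquares_le[where K' = "level (n + 1)", OF cl])
        (use t K Km in \<open>auto simp: line_classes_def t'\<close>)
  qed
  have fin: "finite (P t)" "finite (Q t')" for t t'
    using card_subsquares(2)[of m y] unfolding P_def Q_def by (auto split: prod.splits)
  let ?B = "{z \<in> subsquares m y. bad (n + 2) z}"
  let ?k = "real (level (n + 2) - level (n + 1)) * (real (level (n + 2)) + 1)"
  have "?B \<subseteq> (\<Union>t\<in>point_classes (n + 2). P t) \<union> (\<Union>t\<in>line_classes (n + 2). Q t)"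
  proof
    fix z assume "z \<in> ?B"
    then obtain x where z: "z \<in> subsquares m y" and x: "x \<in> dyadic_square (level (n + 2)) z"
      and d: "(\<exists>(a, b, d) \<in> point_classes (n + 2). near_point a b d x) \<or>
        (\<exists>(a, b) \<in> line_classes (n + 2). near_line a b (a + b + ?E) x)" unfolding bad_def by blast
    from d show "z \<in> (\<Union>t\<in>point_classes (n + 2). P t) \<union> (\<Union>t\<in>line_classes (n + 2). Q t)"
    proof
      assume "\<exists>(a, b, d) \<in> point_classes (n + 2). near_point a b d x"
      then obtain a b d where t: "(a, b, d) \<in> point_classes (n + 2)" "near_point a b d x" by blast
      then have "z \<in> P (a, b, d)" unfolding P_def Km using z x by blast
      then show ?thesis using t by blast
    next
      assume "\<exists>(a, b) \<in> line_classes (n + 2). near_line a b (a + b + ?E) x"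
      then obtain a b where t: "(a, b) \<in> line_classes (n + 2)" "near_line a b (a + b + ?E) x" by blast
      then have "z \<in> Q (a, b)" unfolding Q_def Km using z x by blast
      then show ?thesis using t by blast
    qed
  qed
  then have "card ?B \<le> card ((\<Union>t\<in>point_classes (n + 2). P t) \<union> (\<Union>t\<in>line_classes (n + 2). Q t))"
    using card_classes fin by (intro card_mono) auto
  also have "\<dots> \<le> card (\<Union>t\<in>point_classes (n + 2). P t) + card (\<Union>t\<in>line_classes (n + 2). Q t)" by (rule card_Un_le)
  also have "\<dots> \<le> (\<Sum>t\<in>point_classes (n + 2). card (P t)) + (\<Sum>t\<in>line_classes (n + 2). card (Q t))"
    using card_classes by (intro add_mono card_UN_le) auto
  finally have "real (card ?B) \<le> real ((\<Sum>t\<in>point_classes (n + 2). card (P t)) + (\<Sum>t\<in>line_classes (n + 2). card (Q t)))"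
    by (rule of_nat_mono)
  also have "\<dots> = (\<Sum>t\<in>point_classes (n + 2). real (card (P t))) + (\<Sum>t\<in>line_classes (n + 2). real (card (Q t)))" by simp
  also have "\<dots> \<le> (\<Sum>t\<in>point_classes (n + 2). 2488320 * 4^m / 2^?E) + (\<Sum>t\<in>line_classes (n + 2). 921600 * 4^m / 2^?E)"
    by (intro add_mono sum_mono P Q)
  also have "\<dots> = real (card (point_classes (n + 2))) * (2488320 * 4^m / 2^?E) + real (card (line_classes (n + 2))) * (921600 * 4^m / 2^?E)"
    by simp
  also have "\<dots> \<le> (2 * ?k) * (2488320 * 4^m / 2^?E) + (2 * ?k) * (921600 * 4^m / 2^?E)"
  proof -
    have "real (2 * ((level (n + 2) - level (n + 1)) * (level (n + 2) + 1))) = 2 * ?k"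
      unfolding of_nat_mult of_nat_add by (simp only: of_nat_numeral of_nat_1)
    moreover have "card (point_classes (n + 2)) \<le> 2 * ((level (n + 2) - level (n + 1)) * (level (n + 2) + 1))"
      "card (line_classes (n + 2)) \<le> 2 * ((level (n + 2) - level (n + 1)) * (level (n + 2) + 1))"
      using card_classes(2,4)[of "n + 2"] by simp_all
    ultimately have "real (card (point_classes (n + 2))) \<le> 2 * ?k" "real (card (line_classes (n + 2))) \<le> 2 * ?k"
      by (metis of_nat_mono)+
    then show ?thesis by (intro add_mono mult_right_mono) auto
  qed
  also have "\<dots> = (109117440 * ?k) * 4^m / 2^?E / 16" by (simp add: field_simps)
  also have "\<dots> \<le> 2^?E * 4^m / 2^?E / 16"
    using class_total_bound[of n] by (intro divide_right_mono mult_right_mono) (auto simp: mult.assoc)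
  finally have "16 * real (card ?B) \<le> 4^m" by simp
  then have "real (16 * card ?B) \<le> real (4^m)" by simp
  then show ?thesis unfolding of_nat_le_iff .
qed

text \<open>Markov's inequality: a child that is not good has more than a quarter of its own
  children bad, and bad grandchildren make up at most one sixteenth.\<close>

lemma card_not_good:
  assumes y: "clean_square n y"
  shows "4 * card {z \<in> subsquares (branch n) y. \<not> good (Suc n) z} \<le> 4^branch n"
proof -
  let ?N = "{z \<in> subsquares (branch n) y. \<not> good (Suc n) z}"
  let ?W = "\<lambda>z. {w \<in> subsquares (branch (Suc n)) z. bad (n + 2) w}"
  let ?B = "{w \<in> subsquares (branch n + branch (Suc n)) y. bad (n + 2) w}"
  have finN: "finite ?N" using card_subsquares(2)[of "branch n" y] by auto
  have finW: "finite (?W z)" for z using card_subsquares(2)[of "branch (Suc n)" z] by auto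
  have "card ?N * 4^branch (Suc n) = (\<Sum>z\<in>?N. 4^branch (Suc n))" by simp
  also have "\<dots> \<le> (\<Sum>z\<in>?N. 4 * card (?W z))"
    unfolding good_def by (intro sum_mono) auto
  also have "\<dots> = 4 * (\<Sum>z\<in>?N. card (?W z))" by (simp add: sum_distrib_left)
  also have "(\<Sum>z\<in>?N. card (?W z)) = card (\<Union>z\<in>?N. ?W z)"
  proof (rule card_UN_disjoint[symmetric])
    show "\<forall>i\<in>?N. \<forall>j\<in>?N. i \<noteq> j \<longrightarrow> ?W i \<inter> ?W j = {}"
    proof (intro ballI impI equals0I)
      fix i j w assume "i \<noteq> j" "w \<in> ?W i \<inter> ?W j"
      then show False using subsquares_disjoint[of w "branch (Suc n)" i j] by blast
    qed
  qed (use finN finW in auto)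
  also have "\<dots> \<le> card ?B"
  proof (rule card_mono)
    show "finite ?B" using card_subsquares(2)[of "branch n + branch (Suc n)" y] by simp
    show "(\<Union>z\<in>?N. ?W z) \<subseteq> ?B" using subsquares_add by blast
  qed
  finally have "4 * (card ?N * 4^branch (Suc n)) \<le> 16 * card ?B" by linarith
  also have "\<dots> \<le> 4^(branch n + branch (Suc n))" by (rule card_bad_grandchildren[OF y])
  finally have "(4 * card ?N) * 4^branch (Suc n) \<le> 4^branch n * 4^branch (Suc n)" by (simp add: power_add)
  then show ?thesis by simp
qed

text \<open>At most a quarter of the children are bad and at most a quarter are not good; a child
  that is not bad inherits cleanness.\<close>

lemma card_children_ge:
  assumes y: "clean_square n y" "good n y"
  shows "4^branch n \<le> 2 * card {z \<in> subsquares (branch n) y. clean_square (Suc n) z \<and> good (Suc n) z}"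
proof -
  let ?S = "subsquares (branch n) y"
  let ?G = "{z \<in> ?S. clean_square (Suc n) z \<and> good (Suc n) z}"
  let ?B = "{z \<in> ?S. bad (Suc n) z}" and ?N = "{z \<in> ?S. \<not> good (Suc n) z}"
  have fin: "finite ?S" by (rule card_subsquares)
  have "?S \<subseteq> ?G \<union> (?B \<union> ?N)" using clean_square_Suc[OF y(1)] by auto
  then have "card ?S \<le> card (?G \<union> (?B \<union> ?N))" using fin by (intro card_mono) auto
  also have "\<dots> \<le> card ?G + (card ?B + card ?N)" by (meson add_left_mono card_Un_le order_trans)
  finally have "4^branch n \<le> card ?G + (card ?B + card ?N)" by (simp add: card_subsquares)
  moreover have "4 * card ?B \<le> 4^branch n" using y(2) unfolding good_def .
  moreover have "4 * card ?N \<le> 4^branch n" by (rule card_not_good[OF y(1)])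
  ultimately show ?thesis by linarith
qed

definition kept :: "nat \<Rightarrow> int \<times> int \<Rightarrow> bool" where
  "kept n y \<longleftrightarrow> clean_square n y \<and> good n y"

text \<open>The children are trimmed to a fixed number, half of all subsquares, to make the tree
  homogeneous. Rounding up matters only when \<open>branch n = 0\<close>, where it keeps the single
  square.\<close>

definition select :: "nat \<Rightarrow> int \<times> int \<Rightarrow> (int \<times> int) set" where
  "select n y = (SOME T. T \<subseteq> {z \<in> subsquares (branch n) y. kept (Suc n) z} \<and> card T = (4^branch n + 1) div 2)"

lemma select:
  assumes "kept n y"
  shows "select n y \<subseteq> {z \<in> subsquares (branch n) y. kept (Suc n) z}" "card (select n y) = (4^branch n + 1) div 2"
proof -
  have "(4^branch n + 1) div 2 \<le> card {z \<in> subsquares (branch n) y. kept (Suc n) z}"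
    using card_children_ge[of n y] assms unfolding kept_def by linarith
  then obtain T where "T \<subseteq> {z \<in> subsquares (branch n) y. kept (Suc n) z}" "card T = (4^branch n + 1) div 2"
    by (rule obtain_subset_with_card_n)
  then have "\<exists>T. T \<subseteq> {z \<in> subsquares (branch n) y. kept (Suc n) z} \<and> card T = (4^branch n + 1) div 2" by blast
  from someI_ex[OF this, folded select_def]
  show "select n y \<subseteq> {z \<in> subsquares (branch n) y. kept (Suc n) z}" "card (select n y) = (4^branch n + 1) div 2"
    by simp_all
qed

interpretation tree: dyadic_tree level select "\<lambda>n. (4^branch n + 1) div 2" kept
proof
  show "kept 0 (0, 0)" unfolding kept_def good_def using clean_square_0 not_bad_1 by simp
  show "4^(level (Suc n) - level n) \<le> 2 * (((4::nat)^branch n + 1) div 2)" for n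
    unfolding branch_def by linarith
  show "select n y \<subseteq> {z \<in> subsquares (level (Suc n) - level n) y. kept (Suc n) z}" if "kept n y" for n y
    using select(1)[OF that] unfolding branch_def .
qed (use select level_mono_Suc in simp_all)

lemma limit_set_clean:
  assumes "x \<in> tree.limit_set"
  shows "clean (expo n) (level n) x"
proof -
  obtain y where "y \<in> tree.nodes n" "x \<in> dyadic_square (level n) y" using assms unfolding tree.limit_set_def by blast
  moreover from this have "clean_square n y" using tree.nodes_Inv[of y n] unfolding kept_def by simp
  ultimately show ?thesis unfolding clean_square_def by blast
qed

section \<open>The limit set and the conclusion\<close>

lemma dist_nearest_int_attained:
  obtains r :: int where "dist_nearest_int x = \<bar>x - of_int r\<bar>" "\<bar>x - of_int r\<bar> \<le> 1/2"
proof -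
  obtain y where y: "y \<in> \<int>" "infdist x \<int> = dist x y"
    using infdist_attains_inf[OF closed_Ints, of x] Ints_0 by blast
  then obtain r where r: "y = of_int r" by (auto elim: Ints_cases)
  have "infdist x \<int> \<le> dist x (of_int (round x))" by (intro infdist_le) auto
  also have "\<dots> \<le> 1/2" using of_int_round_abs_le[of x] by (simp add: dist_real_def abs_minus_commute)
  finally show thesis using that[of r] y r by (simp add: dist_nearest_int_def dist_real_def)
qed

text \<open>A smaller product would allow dyadic exponents with \<open>b + d + 1 = a + E\<close>,
  making the primitive part of (q, r, p) a forbidden rational point; dividing by the gcd does not
  increase any of the three factors. It is visible at scale K because a + max b d \<le> 2 a + E
  \<le> 2 h + E.\<close>

lemma clean_imp_point_bound:
  fixes q r p :: int
  assumes cl: "clean E K (\<alpha>, \<beta>)" and E: "3 \<le> E" and h: "2 * h + E \<le> K" and q: "1 \<le> q" "q < 2^(h+1)"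
    and u: "\<bar>of_int q * \<alpha> - of_int r\<bar> \<le> 1/2" and w: "\<bar>of_int q * \<beta> - of_int p\<bar> \<le> 1/2"
  shows "1 / 2^E \<le> of_int q * \<bar>of_int q * \<alpha> - of_int r\<bar> * \<bar>of_int q * \<beta> - of_int p\<bar>"
proof -
  have nz: "(q, r, p) \<noteq> 0" using q by (simp add: zero_prod_def)
  obtain k q' r' p' where k: "1 \<le> k" "primitive (q', r', p')" "q = k * q'" "r = k * r'" "p = k * p'"
    using exists_primitive_part[OF nz] by metis
  have q': "1 \<le> q'" using q(1) k(1,3) by (smt (verit) mult_nonneg_nonpos)
  have q'q: "q' \<le> q" unfolding k(3) using k(1) q' by simp
  define u' where "u' = \<bar>of_int q' * \<alpha> - of_int r'\<bar>"
  define w' where "w' = \<bar>of_int q' * \<beta> - of_int p'\<bar>"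
  have e: "of_int q * \<alpha> - of_int r = of_int k * (of_int q' * \<alpha> - of_int r')"
    "of_int q * \<beta> - of_int p = of_int k * (of_int q' * \<beta> - of_int p')"
    unfolding k by (simp_all add: algebra_simps)
  have uu: "u' \<le> \<bar>of_int q * \<alpha> - of_int r\<bar>" unfolding u'_def e by (rule abs_le_of_int_mult_abs[OF k(1)])
  have ww: "w' \<le> \<bar>of_int q * \<beta> - of_int p\<bar>" unfolding w'_def e by (rule abs_le_of_int_mult_abs[OF k(1)])
  obtain a where a: "\<bar>q'\<bar> < 2^(a+1)" "2^a \<le> \<bar>q'\<bar> \<or> a = 0" by (rule exists_dyadic_size)
  then have a': "q' < 2^(a+1)" "2^a \<le> q'" using q' by auto
  then have ar: "2^a \<le> real_of_int q'" by (metis of_int_le_iff of_int_numeral of_int_power)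
  have "(2::int)^a < 2^(h+1)" using a'(2) q'q q(2) by linarith
  then have ah: "a \<le> h" using power_less_imp_less_exp[of "2::int" a "h+1"] by simp
  have main: "1 / 2^E \<le> of_int q' * u' * w'"
  proof (rule ccontr)
    assume "\<not> ?thesis"
    then have lt: "of_int q' * u' * w' < 1 / 2^E" by simp
    \<comment> \<open>b is the last exponent before u' \<le> 2^-b fails; then u' > 2^-(b+1), with q'
      \<ge> 2^a and the assumed product bound, gives w' \<le> 2^-d. If u' is so small that d would
      drop below 1, d = 1 works since w' \<le> 1/2.\<close>
    have "\<exists>b d. 1 \<le> b \<and> 1 \<le> d \<and> b + d + 1 = a + E \<and> u' \<le> 1 / 2^b \<and> w' \<le> 1 / 2^d"
    proof (cases "u' \<le> 1 / 2^(a + E - 2)")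
      case True
      then show ?thesis using E ww w by (intro exI[of _ "a + E - 2"] exI[of _ 1]) auto
    next
      case False
      define c where "c = (LEAST c. \<not> u' \<le> 1 / 2^c)"
      have c: "\<not> u' \<le> 1 / 2^c" unfolding c_def using False by (rule LeastI)
      have cle: "c \<le> a + E - 2" unfolding c_def using False by (rule Least_le)
      have "u' \<le> 1/2" using uu u by linarith
      then have "u' \<le> 1 / 2^0" "u' \<le> 1 / 2^1" by simp_all
      then have "c \<noteq> 0 \<and> c \<noteq> 1" using c by metis
      then obtain b where b: "c = Suc b" "1 \<le> b" by (cases c) auto
      have ub: "u' \<le> 1 / 2^b" using not_less_Least[of b "\<lambda>c. \<not> u' \<le> 1 / 2^c"] unfolding c_def[symmetric] b by auto
      define d where "d = a + E - 1 - b"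
      have bd: "b + d + 1 = a + E" "1 \<le> d" using cle b E unfolding d_def by auto
      have "2^a * (1 / 2^c) * w' \<le> of_int q' * u' * w'"
        using ar c q' unfolding w'_def by (intro mult_right_mono mult_mono) auto
      then have "2^a * (1 / 2^c) * w' \<le> 1 / 2^E" using lt by linarith
      then have "w' \<le> 2^c / (2^a * 2^E)" by (simp add: field_simps)
      also have "\<dots> = 1 / 2^d"
      proof -
        have "c + d = a + E" using bd b by simp
        then have "(2::real)^c * 2^d = 2^a * 2^E" by (simp only: power_add[symmetric])
        then show ?thesis by (simp add: field_simps)
      qed
      finally show ?thesis using bd b ub by blast
    qed
    then obtain b d where bd: "1 \<le> b" "1 \<le> d" "b + d + 1 = a + E" "u' \<le> 1 / 2^b" "w' \<le> 1 / 2^d" by blast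
    have "near_point a b d (\<alpha>, \<beta>)"
      unfolding near_point_def prod.case using k(2) a' bd(4,5) unfolding u'_def w'_def
      by (intro exI[of _ q'] exI[of _ r'] exI[of _ p']) simp
    moreover have "a + max b d \<le> K" using bd ah h by auto
    ultimately show False using cl bd unfolding clean_def by auto
  qed
  also have "of_int q' * u' * w' \<le> of_int q * \<bar>of_int q * \<alpha> - of_int r\<bar> * \<bar>of_int q * \<beta> - of_int p\<bar>"
    using q'q q' uu ww unfolding u'_def w'_def by (intro mult_mono) auto
  finally show ?thesis .
qed

text \<open>Cleanness is applied to the primitive part with g = a' + b' + E, where a' \<le> a and b'
  \<le> b, so that g + max a' b' \<le> 2 h + E. Multiplying back by the gcd only enlarges the linear
  form.\<close>

lemma clean_imp_line_bound:
  fixes A B C :: int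
  assumes cl: "clean E K (\<alpha>, \<beta>)" and h: "2 * h + E \<le> K" and AB: "A \<noteq> 0" "B \<noteq> 0"
    and ab: "a + b = h" "2^a \<le> \<bar>A\<bar>" "2^b \<le> \<bar>B\<bar>" "\<bar>A\<bar> < 2^(a+1)" "\<bar>B\<bar> < 2^(b+1)"
  shows "1 / 2^E \<le> \<bar>of_int A\<bar> * \<bar>of_int B\<bar> * \<bar>of_int A * \<alpha> - of_int B * \<beta> + of_int C\<bar>"
proof -
  have nz: "(A, B, C) \<noteq> 0" using AB by (simp add: zero_prod_def)
  obtain k A' B' C' where k: "1 \<le> k" "primitive (A', B', C')" "A = k * A'" "B = k * B'" "C = k * C'"
    using exists_primitive_part[OF nz] by metis
  have nz': "A' \<noteq> 0" "B' \<noteq> 0" using AB k by auto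
  have le: "\<bar>A'\<bar> \<le> \<bar>A\<bar>" "\<bar>B'\<bar> \<le> \<bar>B\<bar>" unfolding k(3,4) abs_mult using k(1) by (simp_all add: mult_le_cancel_right1)
  have e: "of_int A * \<alpha> - of_int B * \<beta> + of_int C = of_int k * (of_int A' * \<alpha> - of_int B' * \<beta> + of_int C')"
    unfolding k by (simp add: algebra_simps)
  obtain a' where a': "\<bar>A'\<bar> < 2^(a'+1)" "2^a' \<le> \<bar>A'\<bar> \<or> a' = 0" by (rule exists_dyadic_size)
  obtain b' where b': "\<bar>B'\<bar> < 2^(b'+1)" "2^b' \<le> \<bar>B'\<bar> \<or> b' = 0" by (rule exists_dyadic_size)
  have a2: "2^a' \<le> \<bar>A'\<bar>" and b2: "2^b' \<le> \<bar>B'\<bar>" using a'(2) b'(2) nz' by auto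
  have "(2::int)^a' < 2^(a+1)" "(2::int)^b' < 2^(b+1)" using a2 b2 le ab by linarith+
  then have aa: "a' \<le> a" "b' \<le> b"
    using power_less_imp_less_exp[of "2::int" a' "a+1"] power_less_imp_less_exp[of "2::int" b' "b+1"] by simp_all
  have "\<not> near_line a' b' (a' + b' + E) (\<alpha>, \<beta>)"
    using cl aa ab(1) h unfolding clean_def by auto
  moreover have "2^max a' b' \<le> max \<bar>A'\<bar> \<bar>B'\<bar>" using a2 b2 by (auto simp: max_def)
  ultimately have "\<not> \<bar>of_int A' * \<alpha> - of_int B' * \<beta> + of_int C'\<bar> \<le> 1 / 2^(a' + b' + E)"
    unfolding near_line_def prod.case using k(2) a'(1) b'(1) less_imp_le by blast
  then have "1 / 2^(a' + b' + E) \<le> \<bar>of_int A * \<alpha> - of_int B * \<beta> + of_int C\<bar>"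
    using abs_le_of_int_mult_abs[OF k(1), of "of_int A' * \<alpha> - of_int B' * \<beta> + of_int C'"] unfolding e by linarith
  moreover have "1 / 2^(a + b + E) \<le> (1 / 2^(a' + b' + E) :: real)"
    using aa by (intro divide_left_mono power_increasing) auto
  ultimately have f: "1 / 2^(a + b + E) \<le> \<bar>of_int A * \<alpha> - of_int B * \<beta> + of_int C\<bar>" by linarith
  have ABr: "2^a \<le> \<bar>real_of_int A\<bar>" "2^b \<le> \<bar>real_of_int B\<bar>"
    using ab by (metis of_int_abs of_int_le_iff of_int_numeral of_int_power)+
  have "1 / 2^E = 2^a * 2^b * (1 / 2^(a + b + E) :: real)" by (simp add: power_add)
  also have "\<dots> \<le> \<bar>of_int A\<bar> * \<bar>of_int B\<bar> * \<bar>of_int A * \<alpha> - of_int B * \<beta> + of_int C\<bar>"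
    using ABr f by (intro mult_mono) auto
  finally show ?thesis .
qed

text \<open>ln 2 \<ge> 2/3 gives ln x \<ge> 2h/3, which for h \<ge> 4 exceeds sqrt h, and ln (sqrt
  h) is half of ln h; hence 1/3 = 2/3 * 1/2.\<close>

lemma ln_lnln_ge:
  fixes x :: real
  assumes "2^h \<le> x" "4 \<le> h"
  shows "real h * ln (real h) / 3 \<le> ln x * ln (ln x)"
proof -
  have hr: "4 \<le> real h" using assms(2) by simp
  have "ln (2^h) \<le> ln x" using assms(1) by (smt (verit) ln_le_cancel_iff zero_less_power)
  then have "real h * ln 2 \<le> ln x" by (simp add: ln_realpow)
  moreover have "real h * (2/3) \<le> real h * ln 2" using ln2_ge_two_thirds by (intro mult_left_mono) auto
  ultimately have l: "2/3 * real h \<le> ln x" by linarith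
  have "sqrt (real h) * 2 \<le> sqrt (real h) * sqrt (real h)"
    using hr real_sqrt_le_mono[OF hr] by (intro mult_left_mono) auto
  then have "sqrt (real h) \<le> ln x" using l hr by simp
  then have "ln (sqrt (real h)) \<le> ln (ln x)" using hr by (smt (verit) ln_le_cancel_iff real_sqrt_gt_zero)
  then have ll: "ln (real h) / 2 \<le> ln (ln x)" using hr by (simp add: ln_sqrt)
  have "2/3 * real h * (ln (real h) / 2) \<le> ln x * ln (ln x)"
    using l ll hr by (intro mult_mono) auto
  then show ?thesis by simp
qed

text \<open>The nonnegativity clause is recorded because f will multiply a lower bound, and ln (ln
  x) is negative for x between 1 and e.\<close>

lemma height_bound:
  "\<exists>c>0::real. \<exists>H. \<forall>h\<ge>H. \<exists>n. 2 * h + expo n \<le> level n \<and> (\<forall>x::real. 2^h \<le> x \<longrightarrow> 0 \<le> ln x * ln (ln x) \<and> c \<le> ln x * ln (ln x) * (1 / 2^expo n))"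
proof -
  obtain c where c: "c > 0" and ev: "\<forall>\<^sub>F h in sequentially. \<exists>n. 2 * h + expo n \<le> level n \<and> c * 2^expo n \<le> real h * ln (real h)"
    using height_level_bound by blast
  then obtain H where H: "\<And>h. H \<le> h \<Longrightarrow> \<exists>n. 2 * h + expo n \<le> level n \<and> c * 2^expo n \<le> real h * ln (real h)"
    unfolding eventually_sequentially by blast
  have "\<exists>n. 2 * h + expo n \<le> level n \<and> (\<forall>x::real. 2^h \<le> x \<longrightarrow> 0 \<le> ln x * ln (ln x) \<and> c / 3 \<le> ln x * ln (ln x) * (1 / 2^expo n))"
    if h: "max H 4 \<le> h" for h
  proof -
    obtain n where n: "2 * h + expo n \<le> level n" "c * 2^expo n \<le> real h * ln (real h)" using H[of h] h by auto
    have "0 \<le> ln x * ln (ln x) \<and> c / 3 \<le> ln x * ln (ln x) * (1 / 2^expo n)" if x: "2^h \<le> x" for x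
    proof -
      have "c / 3 * 2^expo n \<le> ln x * ln (ln x)" using ln_lnln_ge[OF x] h n(2) by simp
      moreover have "0 \<le> c / 3 * 2^expo n" using c by simp
      ultimately show ?thesis by (auto simp: pos_le_divide_eq)
    qed
    then show ?thesis using n by blast
  qed
  then have "\<forall>h\<ge>max H 4. \<exists>n. 2 * h + expo n \<le> level n \<and>
    (\<forall>x::real. 2^h \<le> x \<longrightarrow> 0 \<le> ln x * ln (ln x) \<and> c / 3 \<le> ln x * ln (ln x) * (1 / 2^expo n))" by blast
  moreover have "0 < c / 3" using c by simp
  ultimately show ?thesis by blast
qed

lemma limit_set_subset_Mad_P:
  "tree.limit_set \<subseteq> Mad_P (\<lambda>q. ln q * ln (ln q))"
proof
  fix x assume x: "x \<in> tree.limit_set"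
  obtain \<alpha> \<beta> where x': "x = (\<alpha>, \<beta>)" by fastforce
  obtain c :: real and H where c: "0 < c" and H: "\<And>h. H \<le> h \<Longrightarrow> \<exists>n. 2 * h + expo n \<le> level n \<and>
    (\<forall>x::real. 2^h \<le> x \<longrightarrow> 0 \<le> ln x * ln (ln x) \<and> c \<le> ln x * ln (ln x) * (1 / 2^expo n))"
    using height_bound by blast
  have "\<forall>\<^sub>F q in sequentially. ereal c \<le> ereal (ln (real q) * ln (ln (real q)) * real q *
    dist_nearest_int (real q * \<alpha>) * dist_nearest_int (real q * \<beta>))"
    using eventually_ge_at_top[of "2^H"]
  proof eventually_elim
    case (elim q)
    then have q1: "1 \<le> q" by (meson one_le_numeral one_le_power order_trans)
    obtain h where h: "2^h \<le> q" "q < 2^(h+1)" using ex_power_ivl1[of 2 q] q1 by auto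
    have "(2::nat)^H < 2^(h+1)" using elim h by linarith
    then have "H \<le> h" using power_less_imp_less_exp[of "2::nat" H "h+1"] by simp
    then obtain n where n: "2 * h + expo n \<le> level n"
      "\<And>x. 2^h \<le> x \<Longrightarrow> 0 \<le> ln x * ln (ln x) \<and> c \<le> ln x * ln (ln x) * (1 / 2^expo n)" using H by blast
    obtain r where r: "dist_nearest_int (real q * \<alpha>) = \<bar>real q * \<alpha> - of_int r\<bar>" "\<bar>real q * \<alpha> - of_int r\<bar> \<le> 1/2"
      by (rule dist_nearest_int_attained)
    obtain p where p: "dist_nearest_int (real q * \<beta>) = \<bar>real q * \<beta> - of_int p\<bar>" "\<bar>real q * \<beta> - of_int p\<bar> \<le> 1/2"
      by (rule dist_nearest_int_attained)
    have hq: "2^h \<le> real q" using h(1) by (metis of_nat_le_iff of_nat_numeral of_nat_power)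
    have qi: "1 \<le> int q" "int q < 2^(h+1)" using q1 h(2) by (simp, metis of_nat_less_iff of_nat_numeral of_nat_power)
    have b: "1 / 2^expo n \<le> real q * \<bar>real q * \<alpha> - of_int r\<bar> * \<bar>real q * \<beta> - of_int p\<bar>"
    proof -
      have "3 \<le> expo n" unfolding expo_def by simp
      from clean_imp_point_bound[OF limit_set_clean[OF x, unfolded x'] this n(1) qi, of r p] r(2) p(2)
      show ?thesis by simp
    qed
    have "c \<le> ln (real q) * ln (ln (real q)) * (1 / 2^expo n)" using n(2)[OF hq] by blast
    also have "\<dots> \<le> ln (real q) * ln (ln (real q)) * (real q * \<bar>real q * \<alpha> - of_int r\<bar> * \<bar>real q * \<beta> - of_int p\<bar>)"
      using n(2)[OF hq] b by (intro mult_left_mono) auto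
    finally show ?case unfolding r(1) p(1) by (simp add: mult.assoc)
  qed
  then have "ereal c \<le> Liminf sequentially (\<lambda>q. ereal (ln (real q) * ln (ln (real q)) * real q *
    dist_nearest_int (real q * \<alpha>) * dist_nearest_int (real q * \<beta>)))" by (rule Liminf_bounded)
  then show "x \<in> Mad_P (\<lambda>q. ln q * ln (ln q))" unfolding Mad_P_def x' using c
    by (simp add: less_le_trans[of 0 "ereal c"])
qed

lemma limit_set_subset_Mad_L:
  "tree.limit_set \<subseteq> Mad_L (\<lambda>q. ln q * ln (ln q))"
proof
  fix x assume x: "x \<in> tree.limit_set"
  obtain \<alpha> \<beta> where x': "x = (\<alpha>, \<beta>)" by fastforce
  obtain c :: real and H where c: "0 < c" and H: "\<And>h. H \<le> h \<Longrightarrow> \<exists>n. 2 * h + expo n \<le> level n \<and>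
    (\<forall>x::real. 2^h \<le> x \<longrightarrow> 0 \<le> ln x * ln (ln x) \<and> c \<le> ln x * ln (ln x) * (1 / 2^expo n))"
    using height_bound by blast
  let ?F = "filtercomap (\<lambda>(A::int, B::int). \<bar>A * B\<bar>) at_top"
  let ?g = "\<lambda>(A, B). ereal (ln (abs_star (of_int A) * abs_star (of_int B)) * ln (ln (abs_star (of_int A) * abs_star (of_int B)))
          * (abs_star (of_int A) * abs_star (of_int B))
          * dist_nearest_int (of_int A * \<alpha> - of_int B * \<beta>))"
  have "\<forall>\<^sub>F t in ?F. 2^(H+2) \<le> (case t of (A, B) \<Rightarrow> \<bar>A * B\<bar>)"
    by (rule eventually_filtercomapI[OF eventually_ge_at_top])
  then have "\<forall>\<^sub>F t in ?F. ereal c \<le> ?g t"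
  proof eventually_elim
    case (elim t)
    obtain A B where t: "t = (A, B)" by fastforce
    have big: "2^(H+2) \<le> \<bar>A * B\<bar>" using elim unfolding t by simp
    then have "A * B \<noteq> 0" by (smt (verit) zero_less_power)
    then have nz: "A \<noteq> 0" "B \<noteq> 0" by auto
    obtain a where a: "\<bar>A\<bar> < 2^(a+1)" "2^a \<le> \<bar>A\<bar> \<or> a = 0" by (rule exists_dyadic_size)
    obtain b where b: "\<bar>B\<bar> < 2^(b+1)" "2^b \<le> \<bar>B\<bar> \<or> b = 0" by (rule exists_dyadic_size)
    have a2: "2^a \<le> \<bar>A\<bar>" and b2: "2^b \<le> \<bar>B\<bar>" using a(2) b(2) nz by auto
    \<comment> \<open>This explains the threshold 2^(H+2): it forces H \<le> a + b.\<close>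
    have "\<bar>A * B\<bar> < 2^(a+1) * 2^(b+1)" unfolding abs_mult using a b nz by (intro mult_strict_mono) auto
    then have "(2::int)^(H+2) < 2^(a+b+2)" using big by (simp add: power_add)
    then have "H + 2 < a + b + 2" by (subst (asm) power_strict_increasing_iff) auto
    then have "H \<le> a + b" by simp
    then obtain n where n: "2 * (a + b) + expo n \<le> level n"
      "\<And>x. 2^(a+b) \<le> x \<Longrightarrow> 0 \<le> ln x * ln (ln x) \<and> c \<le> ln x * ln (ln x) * (1 / 2^expo n)" using H by blast
    obtain C where C: "dist_nearest_int (of_int A * \<alpha> - of_int B * \<beta>) = \<bar>of_int A * \<alpha> - of_int B * \<beta> - of_int C\<bar>"
      by (rule dist_nearest_int_attained)
    have Ar: "2^a \<le> \<bar>real_of_int A\<bar>" and Br: "2^b \<le> \<bar>real_of_int B\<bar>"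
      using a2 b2 by (metis of_int_abs of_int_le_iff of_int_numeral of_int_power)+
    have "1 \<le> \<bar>real_of_int A\<bar>" "1 \<le> \<bar>real_of_int B\<bar>" using nz by (simp_all flip: of_int_abs)
    then have star: "abs_star (of_int A) = \<bar>real_of_int A\<bar>" "abs_star (of_int B) = \<bar>real_of_int B\<bar>"
      unfolding abs_star_def by auto
    let ?X = "\<bar>real_of_int A\<bar> * \<bar>real_of_int B\<bar>"
    have hX: "2^(a+b) \<le> ?X" unfolding power_add using Ar Br by (intro mult_mono) auto
    have bd: "1 / 2^expo n \<le> ?X * \<bar>of_int A * \<alpha> - of_int B * \<beta> - of_int C\<bar>"
      using clean_imp_line_bound[OF limit_set_clean[OF x, unfolded x'] n(1) nz refl a2 b2 a(1) b(1), of "- C"] by simp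
    have "c \<le> ln ?X * ln (ln ?X) * (1 / 2^expo n)" using n(2)[OF hX] by blast
    also have "\<dots> \<le> ln ?X * ln (ln ?X) * (?X * \<bar>of_int A * \<alpha> - of_int B * \<beta> - of_int C\<bar>)"
      using n(2)[OF hX] bd by (intro mult_left_mono) auto
    finally show ?case unfolding t prod.case star C by (simp add: mult.assoc)
  qed
  then have "ereal c \<le> Liminf ?F ?g" by (rule Liminf_bounded)
  then show "x \<in> Mad_L (\<lambda>q. ln q * ln (ln q))" unfolding Mad_L_def x' using c
    by (simp add: less_le_trans[of 0 "ereal c"])
qed

lemma hausdorff_dim_ge_2:
  assumes "tree.limit_set \<subseteq> E"
  shows "2 \<le> hausdorff_dim E"
  unfolding hausdorff_dim_def
proof (rule INF_greatest)
  fix s assume s: "s \<in> {s. 0 \<le> s \<and> hausdorff_measure s E = 0}"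
  have "2 \<le> s"
  proof (rule ccontr)
    assume "\<not> 2 \<le> s"
    \<comment> \<open>The covering criterion takes roots and wants a positive exponent, while s may
      be 0.\<close>
    define s' where "s' = max s 1"
    have s': "s \<le> s'" "0 < s'" "s' < 2" "0 \<le> s'" using \<open>\<not> 2 \<le> s\<close> unfolding s'_def by auto
    obtain C where C: "1 \<le> C" "\<And>n. 2^n \<le> C * (2^level n) powr (2 - s')"
      using level_growth[of "2 - s'"] s' by auto
    have "hausdorff_measure s E \<noteq> 0"
    proof (rule hausdorff_measure_ne_0I[OF tree.compact_limit_set assms _ s'(1,2)])
      show "0 < 1 / (32 * C)" using C by simp
      show "1 / (32 * C) \<le> (\<Sum>i\<in>I. r i powr s')"
        if "finite I" "\<And>i. i \<in> I \<Longrightarrow> 0 < r i" "tree.limit_set \<subseteq> (\<Union>i\<in>I. ball (c i) (r i))" for I :: "nat set" and c r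
        by (rule tree.cover_bound[OF s'(4,3) C level_unbounded that])
    qed (use s in auto)
    then show False using s by simp
  qed
  then show "2 \<le> ereal s" by simp
qed

section \<open>The upper bound for the dimension of a plane set\<close>

lemma diameter_dyadic_square_le: "diameter (dyadic_square K z) \<le> 2 / 2^K"
proof (rule diameter_le)
  obtain i j where z: "z = (i, j)" by fastforce
  fix x y assume "x \<in> dyadic_square K z" "y \<in> dyadic_square K z"
  then have "\<bar>fst x - fst y\<bar> \<le> 1 / 2^K" "\<bar>snd x - snd y\<bar> \<le> 1 / 2^K"
    unfolding dyadic_square_def z by (auto simp: add_divide_distrib)
  moreover have "norm (x - y) \<le> norm (fst x - fst y) + norm (snd x - snd y)"
    using norm_Pair_le[of "fst x - fst y" "snd x - snd y"] by (cases x; cases y) simp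
  ultimately show "norm (x - y) \<le> 2 / 2^K" by simp
qed simp

lemma mem_dyadic_square_subsquares:
  fixes x :: "real \<times> real"
  obtains z where "z \<in> subsquares K (\<lfloor>fst x\<rfloor>, \<lfloor>snd x\<rfloor>)" "x \<in> dyadic_square K z"
proof -
  have k: "\<lfloor>t * 2^K\<rfloor> div 2^K = \<lfloor>t\<rfloor> \<and> of_int \<lfloor>t * 2^K\<rfloor> / 2^K \<le> t \<and> t \<le> (of_int \<lfloor>t * 2^K\<rfloor> + 1) / 2^K" for t :: real
  proof -
    have "of_int \<lfloor>t\<rfloor> * 2^K \<le> t * 2^K" by (intro mult_right_mono) auto
    then have "of_int (\<lfloor>t\<rfloor> * 2^K) \<le> t * 2^K" by simp
    then have 1: "\<lfloor>t\<rfloor> * 2^K \<le> \<lfloor>t * 2^K\<rfloor>" unfolding le_floor_iff .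
    have "t * 2^K < (of_int \<lfloor>t\<rfloor> + 1) * 2^K" by (intro mult_strict_right_mono) auto
    then have "t * 2^K < of_int (\<lfloor>t\<rfloor> * 2^K + 2^K)" by (simp add: algebra_simps)
    then have 2: "\<lfloor>t * 2^K\<rfloor> < \<lfloor>t\<rfloor> * 2^K + 2^K" unfolding floor_less_iff .
    have "\<lfloor>t * 2^K\<rfloor> \<in> {k. k div 2^K = \<lfloor>t\<rfloor>}" unfolding div_eq_interval using 1 2 by simp
    moreover have "of_int \<lfloor>t * 2^K\<rfloor> \<le> t * 2^K" "t * 2^K \<le> of_int \<lfloor>t * 2^K\<rfloor> + 1" by linarith+
    ultimately show ?thesis by (simp add: pos_divide_le_eq pos_le_divide_eq)
  qed
  show thesis
    by (rule that[of "(\<lfloor>fst x * 2^K\<rfloor>, \<lfloor>snd x * 2^K\<rfloor>)"])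
      (use k[of "fst x"] k[of "snd x"] in \<open>simp_all add: subsquares_def dyadic_square_def mem_Times_iff\<close>)
qed

text \<open>The plane is a countable union of unit squares. The k-th is cut into 4^K(k) squares of
  side 2^-K(k), with K(k) so large that together they contribute at most \<epsilon> / 2^(k+1); this
  is possible because 4^K (2 / 2^K)^s tends to 0 for s > 2.\<close>

lemma hausdorff_measure_plane_eq_0:
  fixes E :: "(real \<times> real) set"
  assumes s: "2 < s"
  shows "hausdorff_measure s E = 0"
proof -
  have "hausdorff_pre_measure s \<delta> E \<le> ennreal \<epsilon>" if \<delta>: "0 < \<delta>" and \<epsilon>: "0 < \<epsilon>" for \<delta> \<epsilon> :: real
  proof -
    have "\<exists>K. 2 / 2^K \<le> \<delta> \<and> 4^K * (2 / 2^K) powr s \<le> \<epsilon> * (1/2)^Suc k" for k :: nat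
    proof -
      have eq: "4^K * (2 / 2^K) powr s = 2 powr s * (2 powr (2 - s))^K" for K :: nat
      proof -
        have "(2^K) powr s = (2 powr real K) powr s" by (subst powr_realpow) auto
        also have "\<dots> = (2 powr s) powr real K" unfolding powr_powr by (subst mult.commute) (rule refl)
        also have "\<dots> = (2 powr s)^K" by (rule powr_realpow) simp
        finally have "(2 / 2^K) powr s = 2 powr s / (2 powr s)^K" by (subst powr_divide) simp_all
        moreover have "2 powr (2 - s) = 4 / 2 powr s" by (subst powr_diff) simp
        ultimately show ?thesis by (simp add: power_divide)
      qed
      have "(\<lambda>K. 2 powr s * (2 powr (2 - s))^K) \<longlonglongrightarrow> 2 powr s * 0"
        using s by (intro tendsto_mult_left LIMSEQ_power_zero) (simp add: powr_less_one)
      then have "(\<lambda>K. 4^K * (2 / 2^K) powr s) \<longlonglongrightarrow> 0" unfolding eq by simp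
      moreover have "0 < \<epsilon> * (1/2)^Suc k" using \<epsilon> by simp
      ultimately have "\<forall>\<^sub>F K in sequentially. 4^K * (2 / 2^K) powr s < \<epsilon> * (1/2)^Suc k" by (rule order_tendstoD)
      moreover have "(\<lambda>K. 2 / 2^K :: real) \<longlonglongrightarrow> 0" by real_asymp
      then have "\<forall>\<^sub>F K in sequentially. 2 / 2^K < \<delta>" using \<delta> by (rule order_tendstoD)
      ultimately have "\<forall>\<^sub>F K in sequentially. 2 / 2^K \<le> \<delta> \<and> 4^K * (2 / 2^K) powr s \<le> \<epsilon> * (1/2)^Suc k"
        by eventually_elim auto
      then show ?thesis by (rule eventually_happens'[OF sequentially_bot])
    qed
    then have "\<exists>K. \<forall>k. 2 / 2^K k \<le> \<delta> \<and> 4^K k * (2 / 2^K k) powr s \<le> \<epsilon> * (1/2)^Suc k" by (intro choice allI)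
    then obtain K where K: "\<And>k. 2 / 2^K k \<le> \<delta>" "\<And>k. 4^K k * (2 / 2^K k) powr s \<le> \<epsilon> * (1/2)^Suc k" by blast
    define S where "S k = subsquares (K k) (from_nat k)" for k
    \<comment> \<open>The double family becomes a sequence through numerical codes. A number t that
      codes no square of \<open>S k\<close> gets the empty set, whose \<open>diam_pow\<close> is 0,
      so each inner sum is finite.\<close>
    define V where "V = (\<lambda>(k, t). if t \<in> to_nat ` S k then dyadic_square (K k) (from_nat t) else {})"
    define U where "U n = V (prod_decode n)" for n
    have V: "bounded (V p) \<and> diameter (V p) \<le> 2 / 2^K (fst p)" for p
      unfolding V_def using diameter_dyadic_square_le compact_imp_bounded[OF compact_dyadic_square]
      by (cases p) simp
    have "E \<subseteq> (\<Union>i. U i)"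
    proof
      fix x assume "x \<in> E"
      define k where "k = to_nat (\<lfloor>fst x\<rfloor>, \<lfloor>snd x\<rfloor>)"
      obtain z where z: "z \<in> S k" "x \<in> dyadic_square (K k) z"
        by (rule mem_dyadic_square_subsquares[of "K k" x]) (simp add: S_def k_def)
      then have "x \<in> V (k, to_nat z)" unfolding V_def by simp
      then have "x \<in> U (prod_encode (k, to_nat z))" unfolding U_def by simp
      then show "x \<in> (\<Union>i. U i)" by blast
    qed
    moreover have "bounded (U i)" "diameter (U i) \<le> \<delta>" for i
      using V[of "prod_decode i"] K(1)[of "fst (prod_decode i)"] unfolding U_def by linarith+
    ultimately have "hausdorff_pre_measure s \<delta> E \<le> (\<Sum>i. diam_pow s (U i))"
      unfolding hausdorff_pre_measure_def by (intro INF_lower) simp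
    also have "\<dots> = (\<Sum>k. \<Sum>t. diam_pow s (V (k, t)))"
      unfolding U_def by (rule suminf_ennreal_2dimen[where f = "\<lambda>p. diam_pow s (V p)"]) simp
    also have "\<dots> \<le> (\<Sum>k. ennreal (\<epsilon> * (1/2)^Suc k))"
    proof (rule suminf_le)
      fix k
      have fin: "finite (to_nat ` S k)" unfolding S_def by (intro finite_imageI card_subsquares)
      have "(\<Sum>t. diam_pow s (V (k, t))) = (\<Sum>t\<in>to_nat ` S k. diam_pow s (V (k, t)))"
        by (rule suminf_finite[OF fin]) (auto simp: V_def diam_pow_def)
      also have "\<dots> \<le> (\<Sum>t\<in>to_nat ` S k. ennreal ((2 / 2^K k) powr s))"
      proof (rule sum_mono)
        fix t
        have "diameter (V (k, t)) powr s \<le> (2 / 2^K k) powr s"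
          using V[of "(k, t)"] s diameter_ge_0[of "V (k, t)"] by (intro powr_mono2) simp_all
        then show "diam_pow s (V (k, t)) \<le> ennreal ((2 / 2^K k) powr s)"
          using s unfolding diam_pow_def by (auto intro: ennreal_leI)
      qed
      also have "\<dots> = of_nat (card (to_nat ` S k)) * ennreal ((2 / 2^K k) powr s)" by simp
      also have "card (to_nat ` S k) = 4^K k"
      proof -
        have "inj_on to_nat (S k)" by (rule inj_on_subset[OF inj_to_nat subset_UNIV])
        then show ?thesis using card_subsquares(1) unfolding S_def by (simp only: card_image)
      qed
      also have "of_nat (4^K k) * ennreal ((2 / 2^K k) powr s) = ennreal (4^K k * (2 / 2^K k) powr s)"
        unfolding ennreal_of_nat_eq_real_of_nat by (subst ennreal_mult[symmetric]) auto
      also have "\<dots> \<le> ennreal (\<epsilon> * (1/2)^Suc k)" using K(2) by (intro ennreal_leI)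
      finally show "(\<Sum>t. diam_pow s (V (k, t))) \<le> ennreal (\<epsilon> * (1/2)^Suc k)" .
    qed (rule summableI)+
    also have "\<dots> = ennreal (\<epsilon> * 1)"
      using \<epsilon> by (intro suminf_ennreal_eq sums_mult power_half_series) auto
    finally show ?thesis by simp
  qed
  then have "hausdorff_pre_measure s \<delta> E \<le> 0 + ennreal \<epsilon>" if "0 < \<delta>" "0 < \<epsilon>" for \<delta> \<epsilon>
    using that by simp
  then have "hausdorff_pre_measure s \<delta> E \<le> 0" if "0 < \<delta>" for \<delta>
    by (rule ennreal_le_epsilon[rotated]) (use that in simp_all)
  then have "hausdorff_measure s E \<le> 0" unfolding hausdorff_measure_def by (intro SUP_least) simp
  then show ?thesis by simp
qed

lemma hausdorff_dim_plane_le_2: "hausdorff_dim (E :: (real \<times> real) set) \<le> 2"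
proof (rule ccontr)
  assume "\<not> ?thesis"
  then have "ereal 2 < hausdorff_dim E" by simp
  then obtain s where s: "ereal 2 < ereal s" "ereal s < hausdorff_dim E" using ereal_dense2 by blast
  have "hausdorff_dim E \<le> ereal s"
    unfolding hausdorff_dim_def using s(1) hausdorff_measure_plane_eq_0[of s E] by (intro INF_lower) auto
  then show False using s by simp
qed

theorem theorem1:
  fixes f :: "real \<Rightarrow> real"
  assumes "f = (\<lambda>q. ln q * ln (ln q))"
  shows "hausdorff_dim (Mad_P f \<inter> Mad_L f) = 2"
proof (rule antisym)
  show "hausdorff_dim (Mad_P f \<inter> Mad_L f) \<le> 2" by (rule hausdorff_dim_plane_le_2)
  show "2 \<le> hausdorff_dim (Mad_P f \<inter> Mad_L f)"
    unfolding assms using limit_set_subset_Mad_P limit_set_subset_Mad_L by (intro hausdorff_dim_ge_2) blast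
qed

end
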